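(* Let $n$ and $m$ be natural numbers such that $2\le n<m$, and let $I$ and $J$ be ideals of the Lie algebras $\mathfrak{u}_n$ and $\mathfrak{u}_m$ respectively. Then the Lie algebras $\mathfrak{u}_n/I$ and $\mathfrak{u}_m/J$ are isomorphic if and only if $(I,J)=(I_\lambda,I_\mu)$ (with $I_\lambda$ an ideal of $\mathfrak{u}_n$ and $I_\mu$ an ideal of $\mathfrak{u}_m$) where one of the following holds: (a) $\lambda=i\omega^{n-2}+\nu$ and $\mu=\omega^{m-1}+\omega^{m-2}+\cdots+\omega^n+j\omega^{n-2}+\nu$ for some $\nu\in[1,\omega^{n-2})\cup\{0\}$ and $i,j\in\mathbb{N}$; (b) for some $s$ with $2\le s\le n-1$, $\lambda=\omega^{n-1}+\omega^{n-2}+\cdots+\omega^s+i\omega^{s-2}+\nu$ and $\mu=\omega^{m-1}+\omega^{m-2}+\cdots+\omega^s+j\omega^{s-2}+\nu$ for some $\nu\in[1,\omega^{s-2})\cup\{0\}$ and $i,j\in\mathbb{N}$; (c) $\lambda=\omega^{n-1}+\omega^{n-2}+\cdots+\omega+\varepsilon$ and $\mu=\omega^{m-1}+\omega^{m-2}+\cdots+\omega+\varepsilon$ where $\varepsilon\in\{0,1\}$.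
   Context: $K$ is a field of characteristic zero, $\mathbb{N}=\{0,1,\ldots\}$, $P_0=K$, $P_i=K[x_1,\ldots,x_i]$, $\partial_i=\partial/\partial x_i$. For $n\ge 2$, $\mathfrak{u}_n=K\partial_1+P_1\partial_2+\cdots+P_{n-1}\partial_n$, a Lie subalgebra of $\mathrm{Der}_K(P_n)$. $\mathfrak{u}_n$ has the $K$-basis $\mathcal{B}_n=\{X_{\alpha,i}=x^\alpha\partial_i \mid 1\le i\le n,\ \alpha\in\mathbb{N}^{i-1}\}$, where $x^\alpha=x_1^{\alpha_1}\cdots x_{i-1}^{\alpha_{i-1}}$. It is well ordered by: $X_{\alpha,i}>X_{\beta,j}$ iff $i<j$, or $i=j$ and for some $k$ one has $\alpha_k>\beta_k$ and $\alpha_l=\beta_l$ for all $k<l\le i-1$. Its order type is $\omega^{n-1}+\omega^{n-2}+\cdots+\omega+1$, where $\omega$ is the first infinite ordinal and $\omega^0=1$. For $X\in\mathcal{B}_n$ let $\mathrm{ord}(X)$ be the order type of $\{Y\in\mathcal{B}_n\mid Y\le X\}$. For an ordinal $\lambda$ with $1\le\lambda\le\omega^{n-1}+\cdots+\omega+1$ the ideal $I_\lambda$ of $\mathfrak{u}_n$ is $I_\lambda=\bigoplus\{KX\mid X\in\mathcal{B}_n,\ \mathrm{ord}(X)\le\lambda\}$, and $I_0=0$. Every ideal of $\mathfrak{u}_n$ equals $I_\lambda$ for a unique such $\lambda$; the same definitions apply to $\mathfrak{u}_m$ with $n$ replaced by $m$. Intervals are intervals of ordinals; in particular $[1,\omega^0)=\emptyset$.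 For $i\in\mathbb{N}$, $i\omega^k$ denotes the $i$-fold sum $\omega^k+\cdots+\omega^k$. *)

theory Defs
  imports Main "HOL-Library.FuncSet" "HOL-Library.Nat_Bijection" "HOL-Library.Poly_Mapping"
begin

section \<open>Lie algebras, ideals, quotients and isomorphisms\<close>

text \<open>The ground field is a type; a Lie algebra over it is given by an explicit carrier and its
  operations, so that quotients, whose elements are cosets, are again objects of the same kind.\<close>

record ('k, 'a) lie_struct =
  lie_carrier :: "'a set"
  lie_add :: "'a \<Rightarrow> 'a \<Rightarrow> 'a"
  lie_zero :: "'a"
  lie_scale :: "'k \<Rightarrow> 'a \<Rightarrow> 'a"
  lie_bracket :: "'a \<Rightarrow> 'a \<Rightarrow> 'a"

text \<open>One-sided absorption suffices for an ideal because Lie brackets are antisymmetric.\<close>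

definition lie_ideal :: "('k, 'a) lie_struct \<Rightarrow> 'a set \<Rightarrow> bool" where
  "lie_ideal L I \<longleftrightarrow>
     I \<subseteq> lie_carrier L \<and>
     lie_zero L \<in> I \<and>
     (\<forall>x\<in>I. \<forall>y\<in>I. lie_add L x y \<in> I) \<and>
     (\<forall>c. \<forall>x\<in>I. lie_scale L c x \<in> I) \<and>
     (\<forall>x\<in>lie_carrier L. \<forall>y\<in>I. lie_bracket L x y \<in> I)"

definition lie_coset :: "('k, 'a) lie_struct \<Rightarrow> 'a set \<Rightarrow> 'a \<Rightarrow> 'a set" where
  "lie_coset L I x = {lie_add L x y | y. y \<in> I}"

text \<open>The element-wise images of a scaled coset or of a bracket of two cosets may be strictly smaller
  than a coset (for instance when scaling by zero); hence the union over cosets below.\<close>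

definition lie_quotient :: "('k, 'a) lie_struct \<Rightarrow> 'a set \<Rightarrow> ('k, 'a set) lie_struct" where
  "lie_quotient L I =
     \<lparr>lie_carrier = lie_coset L I ` lie_carrier L,
      lie_add = (\<lambda>A B. \<Union>a\<in>A. \<Union>b\<in>B. lie_coset L I (lie_add L a b)),
      lie_zero = I,
      lie_scale = (\<lambda>c A. \<Union>a\<in>A. lie_coset L I (lie_scale L c a)),
      lie_bracket = (\<lambda>A B. \<Union>a\<in>A. \<Union>b\<in>B. lie_coset L I (lie_bracket L a b))\<rparr>"

definition lie_isomorphic :: "('k, 'a) lie_struct \<Rightarrow> ('k, 'b) lie_struct \<Rightarrow> bool" where
  "lie_isomorphic L M \<longleftrightarrow>
     (\<exists>\<phi>. bij_betw \<phi> (lie_carrier L) (lie_carrier M) \<and>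
        (\<forall>x\<in>lie_carrier L. \<forall>y\<in>lie_carrier L. \<phi> (lie_add L x y) = lie_add M (\<phi> x) (\<phi> y)) \<and>
        (\<forall>c. \<forall>x\<in>lie_carrier L. \<phi> (lie_scale L c x) = lie_scale M c (\<phi> x)) \<and>
        (\<forall>x\<in>lie_carrier L. \<forall>y\<in>lie_carrier L.
            \<phi> (lie_bracket L x y) = lie_bracket M (\<phi> x) (\<phi> y)))"


section \<open>Polynomials and derivations\<close>

text \<open>Exponent vectors are finitely supported functions on the variable indices, and polynomials are
  finitely supported functions on exponent vectors. The type contains polynomials in all variables;
  \<open>polys n\<close> is the subring of those involving only the variables with indices \<open>1, \<dots>, n\<close>.\<close>

type_synonym expo = "nat \<Rightarrow>\<^sub>0 nat"
type_synonym 'k mpoly = "expo \<Rightarrow>\<^sub>0 'k"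

definition polys :: "nat \<Rightarrow> 'k::field_char_0 mpoly set" where
  "polys n = {p. \<forall>\<alpha>\<in>Poly_Mapping.keys p. Poly_Mapping.keys \<alpha> \<subseteq> {1..n}}"

definition Const :: "'k::field_char_0 \<Rightarrow> 'k mpoly" where
  "Const c = Poly_Mapping.single 0 c"

definition partial :: "nat \<Rightarrow> 'k::field_char_0 mpoly \<Rightarrow> 'k mpoly" where
  "partial i p =
     (\<Sum>\<alpha>\<in>Poly_Mapping.keys p.
        Poly_Mapping.single (\<alpha> - Poly_Mapping.single i 1)
          (of_nat (Poly_Mapping.lookup \<alpha> i) * Poly_Mapping.lookup p \<alpha>))"

text \<open>Maps \<open>polys n \<rightarrow> polys n\<close> are represented extensionally, i.e. with the value \<open>undefined\<close>
  outside \<open>polys n\<close>, so that two of them are equal iff they agree on \<open>polys n\<close>.\<close>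

definition Der :: "nat \<Rightarrow> ('k::field_char_0, 'k mpoly \<Rightarrow> 'k mpoly) lie_struct" where
  "Der n =
     \<lparr>lie_carrier = {D. D \<in> polys n \<rightarrow>\<^sub>E polys n \<and>
         (\<forall>p\<in>polys n. \<forall>q\<in>polys n. D (p + q) = D p + D q) \<and>
         (\<forall>c. \<forall>p\<in>polys n. D (Const c * p) = Const c * D p) \<and>
         (\<forall>p\<in>polys n. \<forall>q\<in>polys n. D (p * q) = D p * q + p * D q)},
      lie_add = (\<lambda>D E. \<lambda>p\<in>polys n. D p + E p),
      lie_zero = (\<lambda>p\<in>polys n. 0),
      lie_scale = (\<lambda>c D. \<lambda>p\<in>polys n. Const c * D p),
      lie_bracket = (\<lambda>D E. \<lambda>p\<in>polys n. D (E p) - E (D p))\<rparr>"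

definition u_alg :: "nat \<Rightarrow> ('k::field_char_0, 'k mpoly \<Rightarrow> 'k mpoly) lie_struct" where
  "u_alg n = (Der n)
     \<lparr>lie_carrier := {(\<lambda>p\<in>polys n. \<Sum>i=1..n. f i * partial i p) | f.
         \<forall>i\<in>{1..n}. f i \<in> polys (i - 1)}\<rparr>"


section \<open>Ordinals\<close>

text \<open>Following the well-order theories of HOL, an ordinal is a well-order relation, taken up to
  \<open>=o\<close>. All ordinals below are countable, so well-orders on sets of natural numbers suffice;
  keeping one fixed carrier type (by coding sums and pairs) lets sums be iterated.\<close>

unbundle cardinal_syntax

definition ord_zero :: "nat rel" where "ord_zero = {}"

definition ord_one :: "nat rel" where "ord_one = {(0, 0)}"

definition ord_add :: "nat rel \<Rightarrow> nat rel \<Rightarrow> nat rel"  (infixl \<open>+\<^sub>o\<close> 65) where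
  "r +\<^sub>o s = dir_image
     (map_prod Inl Inl ` r \<union> map_prod Inr Inr ` s \<union> (Inl ` Field r) \<times> (Inr ` Field s)) sum_encode"

text \<open>The product \<open>r \<cdot> s\<close> is \<open>s\<close> many copies of \<open>r\<close>: the second component is the more significant one.\<close>

definition ord_mult :: "nat rel \<Rightarrow> nat rel \<Rightarrow> nat rel" where
  "ord_mult r s = dir_image
     {((a, b), (a', b')). a \<in> Field r \<and> a' \<in> Field r \<and>
        ((b, b') \<in> s \<and> b \<noteq> b' \<or> b = b' \<and> b \<in> Field s \<and> (a, a') \<in> r)} prod_encode"

primrec omega_pow :: "nat \<Rightarrow> nat rel" where
  "omega_pow 0 = ord_one"
| "omega_pow (Suc k) = ord_mult (omega_pow k) natLeq"

definition ord_sum :: "nat rel list \<Rightarrow> nat rel" where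
  "ord_sum rs = foldr (+\<^sub>o) rs ord_zero"

definition omega_mult :: "nat \<Rightarrow> nat \<Rightarrow> nat rel" where
  "omega_mult i k = ord_sum (replicate i (omega_pow k))"

text \<open>\<open>omega_tail b a\<close> is \<open>\<omega>\<^sup>b\<^sup>-\<^sup>1 + \<omega>\<^sup>b\<^sup>-\<^sup>2 + \<dots> + \<omega>\<^sup>a\<close>, with exponents in decreasing order.\<close>

definition omega_tail :: "nat \<Rightarrow> nat \<Rightarrow> nat rel" where
  "omega_tail b a = ord_sum (map omega_pow (rev [a..<b]))"

text \<open>Membership in \<open>[1, \<omega>\<^sup>k) \<union> {0}\<close>.\<close>

definition below_omega_pow :: "nat \<Rightarrow> nat rel \<Rightarrow> bool" where
  "below_omega_pow k \<nu> \<longleftrightarrow> (ord_one \<le>o \<nu> \<and> \<nu> <o omega_pow k) \<or> \<nu> =o ord_zero"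


section \<open>The ordered basis and the ideals indexed by ordinals\<close>

definition basis_elt :: "nat \<Rightarrow> expo \<Rightarrow> nat \<Rightarrow> ('k::field_char_0 mpoly \<Rightarrow> 'k mpoly)" where
  "basis_elt n \<alpha> i = (\<lambda>p\<in>polys n. Poly_Mapping.single \<alpha> 1 * partial i p)"

definition basis_index :: "nat \<Rightarrow> (expo \<times> nat) set" where
  "basis_index n = {(\<alpha>, i). 1 \<le> i \<and> i \<le> n \<and> Poly_Mapping.keys \<alpha> \<subseteq> {1..i - 1}}"

definition u_basis :: "nat \<Rightarrow> ('k::field_char_0 mpoly \<Rightarrow> 'k mpoly) set" where
  "u_basis n = {basis_elt n \<alpha> i | \<alpha> i. (\<alpha>, i) \<in> basis_index n}"

definition index_greater :: "expo \<times> nat \<Rightarrow> expo \<times> nat \<Rightarrow> bool" where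
  "index_greater = (\<lambda>(\<alpha>, i) (\<beta>, j). i < j \<or>
     i = j \<and> (\<exists>k\<in>{1..i - 1}. Poly_Mapping.lookup \<alpha> k > Poly_Mapping.lookup \<beta> k \<and>
        (\<forall>l. k < l \<and> l \<le> i - 1 \<longrightarrow> Poly_Mapping.lookup \<alpha> l = Poly_Mapping.lookup \<beta> l)))"

text \<open>The pairs \<open>(Y, Z)\<close> of basis elements with \<open>Y \<le> Z\<close>.\<close>

definition basis_order :: "nat \<Rightarrow> ('k::field_char_0 mpoly \<Rightarrow> 'k mpoly) rel" where
  "basis_order n = {(basis_elt n \<beta> j, basis_elt n \<alpha> i) | \<alpha> i \<beta> j.
     (\<alpha>, i) \<in> basis_index n \<and> (\<beta>, j) \<in> basis_index n \<and>
     ((\<alpha>, i) = (\<beta>, j) \<or> index_greater (\<alpha>, i) (\<beta>, j))}"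

definition ord_type :: "nat \<Rightarrow> ('k::field_char_0 mpoly \<Rightarrow> 'k mpoly) \<Rightarrow> ('k mpoly \<Rightarrow> 'k mpoly) rel" where
  "ord_type n Z = Restr (basis_order n) {Y \<in> u_basis n. (Y, Z) \<in> basis_order n}"

definition lin_span ::
    "nat \<Rightarrow> ('k::field_char_0 mpoly \<Rightarrow> 'k mpoly) set \<Rightarrow> ('k mpoly \<Rightarrow> 'k mpoly) set" where
  "lin_span n S = {(\<lambda>p\<in>polys n. \<Sum>Z\<in>F. Const (c Z) * Z p) | F c. finite F \<and> F \<subseteq> S}"

text \<open>For \<open>r\<close> equal to zero this is the zero ideal, since \<open>ord_type n Z\<close> is never zero.\<close>

definition I_ideal :: "nat \<Rightarrow> nat rel \<Rightarrow> ('k::field_char_0 mpoly \<Rightarrow> 'k mpoly) set" where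
  "I_ideal n r = lin_span n {Z \<in> u_basis n. ord_type n Z \<le>o r}"

end

theory Submission
  imports Defs
begin

text \<open>Throughout, a derivation \<open>D\<close> of \<open>u\<^sub>n\<close> is handled through its components
\<open>D = D\<^sub>1 \<partial>\<^sub>1 + \<dots> + D\<^sub>n \<partial>\<^sub>n\<close>, where \<open>D\<^sub>l\<close> is a polynomial in
\<open>x\<^sub>1, \<dots>, x\<^sub>l\<^sub>-\<^sub>1\<close>, and \<open>e\<^sub>k\<close> is the exponent of \<open>x\<^sub>k\<close>.

\<^bold>\<open>Ideals.\<close> Bracketing with monomial derivations moves the leading basis element of an element of an
ideal to every smaller basis element. As the basis is well ordered, an ideal is therefore the span of
an initial segment: it is everything, or it is the span \<open>below n z\<close> of the basis elements less than
some basis element \<open>z\<close> (\<open>ideal_cases\<close>). For \<open>z\<close> in block \<open>s \<ge> 2\<close> the exponent of \<open>z\<close> is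
written \<open>\<sigma> + i e\<^sub>s\<^sub>-\<^sub>1\<close>, with \<open>\<sigma>\<close> an exponent in the variables \<open>x\<^sub>1, \<dots>, x\<^sub>s\<^sub>-\<^sub>2\<close>.

\<^bold>\<open>The quotient depends only on \<open>s\<close> and \<open>\<sigma>\<close>.\<close> The components beyond \<open>s\<close> lie in the ideal. The
operator \<open>\<partial>\<^sub>s\<^sub>-\<^sub>1\<close> maps the polynomials in \<open>x\<^sub>1, \<dots>, x\<^sub>s\<^sub>-\<^sub>1\<close> onto themselves and commutes with
\<open>u\<^sub>s\<^sub>-\<^sub>1\<close>, because the coefficients occurring there do not involve \<open>x\<^sub>s\<^sub>-\<^sub>1\<close>. Hence
\<open>D \<mapsto> (D\<^sub>1, \<dots>, D\<^sub>s\<^sub>-\<^sub>1, \<partial>\<^sub>s\<^sub>-\<^sub>1\<^sup>i D\<^sub>s)\<close> is a homomorphism of \<open>u\<^sub>n\<close> onto \<open>u\<^sub>s\<close>, and the ideal is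
the preimage of the ideal of \<open>u\<^sub>s\<close> given by \<open>\<sigma>\<close> alone. So neither \<open>n\<close> nor \<open>i\<close> can be seen in the
quotient (\<open>shift_corr_lie_corr\<close>).

\<^bold>\<open>The quotient determines \<open>s\<close> and \<open>\<sigma>\<close>.\<close> The \<open>k\<close>-th derived algebra of \<open>u\<^sub>n\<close> consists of the
derivations whose first \<open>k\<close> components vanish, so \<open>s\<close> is the derived length of the quotient \<open>Q\<close>. In
\<open>Q\<close>, the centralizer of the \<open>(s - 2)\<close>-nd derived algebra is given by the segment below
\<open>(i + 1) e\<^sub>s\<^sub>-\<^sub>1\<close>. Those elements of that derived algebra which are central modulo the next derived
algebra are, modulo the latter, the multiples of \<open>\<partial>\<^sub>s\<^sub>-\<^sub>1\<close>, and their centralizer is given by the segment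
below \<open>\<sigma> + (i + 1) e\<^sub>s\<^sub>-\<^sub>1\<close>. The ideals between these two centralizers form a chain indexed by the
exponents \<open>\<tau> \<le> \<sigma>\<close> in \<open>x\<^sub>1, \<dots>, x\<^sub>s\<^sub>-\<^sub>2\<close>. Exponents are well ordered, so the chain determines \<open>\<sigma>\<close>
(\<open>shift_le_of_corr\<close>).

\<^bold>\<open>Ordinals.\<close> The exponents in \<open>k\<close> variables have order type \<open>\<omega>\<^sup>k\<close>. The segment below \<open>z\<close> consists of
the blocks \<open>n, \<dots>, s + 1\<close>, then of \<open>i\<close> copies of \<open>\<omega>\<^sup>s\<^sup>-\<^sup>2\<close>, one for each smaller exponent of
\<open>x\<^sub>s\<^sub>-\<^sub>1\<close>, then of a proper initial segment of \<open>\<omega>\<^sup>s\<^sup>-\<^sup>2\<close> given by \<open>\<sigma>\<close>. Case (a) is \<open>s = n\<close>, case (b) is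
\<open>2 \<le> s < n\<close>, and case (c) consists of \<open>s = 1\<close> and of the whole algebra.\<close>

section \<open>Polynomials and partial derivatives\<close>

type_synonym 'k oper = "'k mpoly \<Rightarrow> 'k mpoly"

abbreviation supp :: "('a \<Rightarrow>\<^sub>0 'b::zero) \<Rightarrow> 'a set" where
  "supp \<equiv> Poly_Mapping.keys"

abbreviation coef :: "('a \<Rightarrow>\<^sub>0 'b::zero) \<Rightarrow> 'a \<Rightarrow> 'b" where
  "coef \<equiv> Poly_Mapping.lookup"

abbreviation single :: "'a \<Rightarrow> 'b::zero \<Rightarrow> 'a \<Rightarrow>\<^sub>0 'b" where
  "single \<equiv> Poly_Mapping.single"

lemma supp_iff: "\<alpha> \<in> supp p \<longleftrightarrow> coef p \<alpha> \<noteq> 0"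
  by (rule in_keys_iff)

lemma expo_diff_add_single: "0 < coef \<alpha> i \<Longrightarrow> \<alpha> - single i 1 + single i 1 = (\<alpha> :: expo)"
  by (rule poly_mapping_eqI) (auto simp: lookup_add lookup_minus lookup_single when_def)

lemma expo_diff_eq_iff:
  fixes \<alpha> \<beta> :: expo
  assumes "0 < coef \<alpha> i"
  shows "\<alpha> - single i 1 = \<beta> \<longleftrightarrow> \<alpha> = \<beta> + single i 1"
  using expo_diff_add_single[OF assms] by force

lemma mpoly_expand: "p = (\<Sum>\<alpha>\<in>supp p. single \<alpha> (coef p \<alpha>))"
  for p :: "'a \<Rightarrow>\<^sub>0 'b::comm_monoid_add"
  by (rule poly_mapping_eqI) (auto simp: lookup_sum lookup_single when_def supp_iff)

lemma mpoly_induct [case_names zero monomial_add]: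
  fixes p :: "'a \<Rightarrow>\<^sub>0 'b::comm_monoid_add"
  assumes "P 0" and "\<And>\<alpha> c p. P p \<Longrightarrow> P (single \<alpha> c + p)"
  shows "P p"
proof -
  have "P (\<Sum>\<alpha>\<in>A. single \<alpha> (coef p \<alpha>))" if "finite A" for A
    using that assms by (induction A rule: finite_induct) auto
  from this[OF finite_keys[of p]] show ?thesis
    using mpoly_expand[of p] by simp
qed

text \<open>Coefficientwise, differentiation is a shift with nonzero factors. Linearity, commutation of
partial derivatives and the description of supports can be read off from this form.\<close>

lemma coef_partial:
  "coef (partial i p) \<alpha> = of_nat (coef \<alpha> i + 1) * coef p (\<alpha> + single i 1)"
proof -
  have "coef (partial i p) \<alpha> =
     (\<Sum>\<beta>\<in>supp p. if \<beta> = \<alpha> + single i 1 then of_nat (coef \<beta> i) * coef p \<beta> else 0)"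
    unfolding partial_def lookup_sum
  proof (rule sum.cong[OF refl])
    fix \<beta> assume "\<beta> \<in> supp p"
    show "coef (single (\<beta> - single i 1) (of_nat (coef \<beta> i) * coef p \<beta>)) \<alpha> =
       (if \<beta> = \<alpha> + single i 1 then of_nat (coef \<beta> i) * coef p \<beta> else 0)"
    proof (cases "coef \<beta> i = 0")
      case False
      then show ?thesis
        using expo_diff_eq_iff[of \<beta> i \<alpha>] by (auto simp: lookup_single when_def)
    qed (auto simp: lookup_single when_def lookup_add)
  qed
  also have "\<dots> = of_nat (coef \<alpha> i + 1) * coef p (\<alpha> + single i 1)"
    by (auto simp: sum.delta supp_iff lookup_add)
  finally show ?thesis .
qed

text \<open>Characteristic zero enters here: differentiation loses only those monomials that do not contain
the variable.\<close>

lemma supp_partial: "\<alpha> \<in> supp (partial i p) \<longleftrightarrow> \<alpha> + single i 1 \<in> supp p"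
  unfolding supp_iff coef_partial by (metis Suc_eq_plus1 mult_eq_0_iff of_nat_neq_0)

lemma partial_add: "partial i (p + q) = partial i p + partial i q"
  by (rule poly_mapping_eqI) (simp add: coef_partial lookup_add algebra_simps)

lemma partial_minus: "partial i (p - q) = partial i p - partial i q"
  by (rule poly_mapping_eqI) (simp add: coef_partial lookup_minus algebra_simps)

lemma partial_zero [simp]: "partial i 0 = 0"
  by (rule poly_mapping_eqI) (simp add: coef_partial)

lemma partial_sum: "partial i (\<Sum>j\<in>A. f j) = (\<Sum>j\<in>A. partial i (f j))"
  by (induction A rule: infinite_finite_induct) (auto simp: partial_add)

lemma partial_single:
  "partial i (single \<alpha> c) = single (\<alpha> - single i 1) (of_nat (coef \<alpha> i) * c)"
  by (simp add: partial_def)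

lemma partial_commute: "partial i (partial j p) = partial j (partial i p)"
proof (cases "i = j")
  case False
  then show ?thesis
    by (intro poly_mapping_eqI)
      (simp add: coef_partial lookup_add lookup_single when_def add_ac mult_ac)
qed simp

lemma partial_mult_single:
  "partial i (single \<alpha> c * single \<beta> d) =
     partial i (single \<alpha> c) * single \<beta> d + single \<alpha> c * partial i (single \<beta> d)"
proof -
  have *: "single (\<alpha> - single i 1 + \<beta>) (of_nat (coef \<alpha> i) * c * d)
      = single (\<alpha> + \<beta> - single i 1) (of_nat (coef \<alpha> i) * c * d)" for \<alpha> \<beta> :: expo and c d :: 'a
  proof (cases "coef \<alpha> i = 0")
    case False
    then have "\<alpha> - single i 1 + \<beta> = \<alpha> + \<beta> - single i 1"
      by (intro poly_mapping_eqI) (auto simp: lookup_add lookup_minus lookup_single when_def)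
    then show ?thesis by simp
  qed simp
  show ?thesis
    using *[of \<alpha> \<beta> c d] *[of \<beta> \<alpha> d c]
    by (simp add: mult_single partial_single lookup_add distrib_right single_add) (simp add: ac_simps)
qed

lemma partial_mult: "partial i (p * q) = partial i p * q + p * partial i q"
proof (induction p rule: mpoly_induct)
  case (monomial_add \<alpha> c p)
  have "partial i (single \<alpha> c * q) = partial i (single \<alpha> c) * q + single \<alpha> c * partial i q"
    by (induction q rule: mpoly_induct)
      (simp_all add: partial_add partial_mult_single algebra_simps)
  with monomial_add show ?case
    by (simp add: partial_add algebra_simps)
qed simp

lemma polys_iff: "p \<in> polys n \<longleftrightarrow> (\<forall>\<alpha>\<in>supp p. supp \<alpha> \<subseteq> {1..n})"
  by (simp add: polys_def)

lemma polys_zero [simp]: "0 \<in> polys n" 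
  by (simp add: polys_iff)

lemma polys_add [intro]: "p \<in> polys n \<Longrightarrow> q \<in> polys n \<Longrightarrow> p + q \<in> polys n"
  using keys_add[of p q] by (auto simp: polys_iff)

lemma polys_minus [intro]: "p \<in> polys n \<Longrightarrow> q \<in> polys n \<Longrightarrow> p - q \<in> polys n"
  using keys_diff[of p q] by (fastforce simp: polys_iff)

lemma supp_expo_add: "supp (\<alpha> + \<beta> :: expo) = supp \<alpha> \<union> supp \<beta>"
  by (auto simp: supp_iff lookup_add)

lemma polys_mult [intro]:
  assumes "p \<in> polys n" "q \<in> polys n"
  shows "p * q \<in> polys n"
  unfolding polys_iff
proof
  fix \<gamma> assume "\<gamma> \<in> supp (p * q)"
  then obtain \<alpha> \<beta> where "\<gamma> = \<alpha> + \<beta>" "\<alpha> \<in> supp p" "\<beta> \<in> supp q"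
    using keys_mult[of p q] by auto
  then show "supp \<gamma> \<subseteq> {1..n}"
    using assms by (auto simp: supp_expo_add polys_iff)
qed

lemma polys_sum [intro]: "(\<And>j. j \<in> A \<Longrightarrow> f j \<in> polys n) \<Longrightarrow> (\<Sum>j\<in>A. f j) \<in> polys n"
  by (induction A rule: infinite_finite_induct) auto

lemma polys_single: "supp \<alpha> \<subseteq> {1..n} \<Longrightarrow> single \<alpha> c \<in> polys n"
  by (auto simp: polys_iff)

lemma polys_partial [intro]: "p \<in> polys n \<Longrightarrow> partial i p \<in> polys n"
  by (fastforce simp: polys_iff supp_partial supp_expo_add)

lemma polys_Const [simp]: "Const c \<in> polys n"
  by (simp add: Const_def polys_single)

lemma polys_mono: "p \<in> polys k \<Longrightarrow> k \<le> n \<Longrightarrow> p \<in> polys n"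
  by (fastforce simp: polys_iff)

lemma partial_polys_eq_0: "p \<in> polys k \<Longrightarrow> k < i \<Longrightarrow> partial i p = 0"
proof -
  assume p: "p \<in> polys k" and "k < i"
  have "\<alpha> \<notin> supp (partial i p)" for \<alpha>
  proof
    assume "\<alpha> \<in> supp (partial i p)"
    then have "supp (\<alpha> + single i 1) \<subseteq> {1..k}"
      using p unfolding supp_partial polys_iff by blast
    with \<open>k < i\<close> show False
      by (auto simp: supp_expo_add)
  qed
  then show ?thesis
    using keys_eq_empty by blast
qed

lemma Const_0 [simp]: "Const 0 = 0"
  and Const_1 [simp]: "Const 1 = 1"
  by (simp_all add: Const_def)

lemma Const_minus_1: "Const (-1) * p = - p"
  by (simp add: Const_def single_uminus)

lemma partial_Const [simp]: "partial i (Const c) = 0"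
  by (simp add: Const_def partial_single)

lemma coef_Const_mult: "coef (Const c * p) \<alpha> = c * coef p \<alpha>"
  by (simp add: Const_def flip: mult_map_scale_conv_mult) (simp add: map.rep_eq when_def)

lemma partial_Const_mult: "partial i (Const c * p) = Const c * partial i p"
  by (simp add: partial_mult)

lemma coef_single_mult: "coef (single \<alpha> c * p) (\<alpha> + \<beta>) = c * coef p \<beta>"
  for \<alpha> :: expo and c :: "'k::field_char_0"
proof (induction p rule: mpoly_induct)
  case (monomial_add \<gamma> d p)
  then show ?case
    by (auto simp: distrib_left lookup_add mult_single lookup_single when_def)
qed simp

text \<open>Integration term by term; the denominators do not vanish in characteristic zero.\<close>

lemma antiderivative:
  assumes "p \<in> polys n" "k \<in> {1..n}"
  obtains q where "q \<in> polys n" "partial k q = p"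
proof
  define q where "q = (\<Sum>\<alpha>\<in>supp p. single (\<alpha> + single k 1) (coef p \<alpha> / of_nat (coef \<alpha> k + 1)))"
  show "q \<in> polys n"
    unfolding q_def using assms
    by (intro polys_sum polys_single) (auto simp: polys_iff supp_expo_add)
  have "partial k q = (\<Sum>\<alpha>\<in>supp p. single \<alpha> (coef p \<alpha>))"
    unfolding q_def partial_sum
  proof (rule sum.cong[OF refl])
    fix \<alpha> show "partial k (single (\<alpha> + single k 1) (coef p \<alpha> / of_nat (coef \<alpha> k + 1)))
        = single \<alpha> (coef p \<alpha>)"
      using of_nat_neq_0[of "coef \<alpha> k", where 'a='a]
      by (simp add: partial_single lookup_add del: of_nat_Suc)
  qed
  then show "partial k q = p"
    using mpoly_expand[of p] by simp
qed

section \<open>The order on exponents and on the basis\<close>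

text \<open>The order on exponents in the variables \<open>x\<^sub>1, \<dots>, x\<^sub>k\<close> in which the last variable is the most
significant one. Recursion on the number of variables mirrors the recursion of \<open>omega_pow\<close>; variables
with other indices are ignored, so exponents may be compared block by block.\<close>

primrec mless :: "nat \<Rightarrow> expo \<Rightarrow> expo \<Rightarrow> bool" where
  "mless 0 \<alpha> \<beta> \<longleftrightarrow> False"
| "mless (Suc k) \<alpha> \<beta> \<longleftrightarrow> coef \<alpha> (Suc k) < coef \<beta> (Suc k) \<or>
     coef \<alpha> (Suc k) = coef \<beta> (Suc k) \<and> mless k \<alpha> \<beta>"

lemma mless_iff:
  "mless k \<alpha> \<beta> \<longleftrightarrow> (\<exists>j\<in>{1..k}. coef \<alpha> j < coef \<beta> j \<and> (\<forall>l. j < l \<and> l \<le> k \<longrightarrow> coef \<alpha> l = coef \<beta> l))"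
proof (induction k)
  case (Suc k)
  have "(\<exists>j\<in>{1..Suc k}. coef \<alpha> j < coef \<beta> j \<and> (\<forall>l. j < l \<and> l \<le> Suc k \<longrightarrow> coef \<alpha> l = coef \<beta> l)) \<longleftrightarrow>
    coef \<alpha> (Suc k) < coef \<beta> (Suc k) \<or> coef \<alpha> (Suc k) = coef \<beta> (Suc k) \<and>
      (\<exists>j\<in>{1..k}. coef \<alpha> j < coef \<beta> j \<and> (\<forall>l. j < l \<and> l \<le> k \<longrightarrow> coef \<alpha> l = coef \<beta> l))"
    (is "?L \<longleftrightarrow> ?R")
  proof
    assume ?L
    then obtain j where j: "j \<in> {1..Suc k}" "coef \<alpha> j < coef \<beta> j"
      "\<forall>l. j < l \<and> l \<le> Suc k \<longrightarrow> coef \<alpha> l = coef \<beta> l" by blast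
    then show ?R
      by (cases "j = Suc k") auto
  next
    assume ?R
    then show ?L
    proof
      assume "coef \<alpha> (Suc k) < coef \<beta> (Suc k)"
      then show ?L by (intro bexI[of _ "Suc k"]) auto
    next
      assume "coef \<alpha> (Suc k) = coef \<beta> (Suc k) \<and>
        (\<exists>j\<in>{1..k}. coef \<alpha> j < coef \<beta> j \<and> (\<forall>l. j < l \<and> l \<le> k \<longrightarrow> coef \<alpha> l = coef \<beta> l))"
      then obtain j where "j \<in> {1..k}" "coef \<alpha> j < coef \<beta> j"
        "\<forall>l. j < l \<and> l \<le> Suc k \<longrightarrow> coef \<alpha> l = coef \<beta> l"
        by (metis le_Suc_eq)
      then show ?L by (intro bexI[of _ j]) auto
    qed
  qed
  then show ?case using Suc by simp
qed simp

lemma mless_irrefl [simp]: "\<not> mless k \<alpha> \<alpha>"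
  by (induction k) auto

lemma mless_trans: "mless k \<alpha> \<beta> \<Longrightarrow> mless k \<beta> \<gamma> \<Longrightarrow> mless k \<alpha> \<gamma>"
  by (induction k) auto

lemma mless_linear: "mless k \<alpha> \<beta> \<or> mless k \<beta> \<alpha> \<or> (\<forall>j\<in>{1..k}. coef \<alpha> j = coef \<beta> j)"
  by (induction k) (auto simp: atLeastAtMostSuc_conv)

lemma expo_eqI: "supp \<alpha> \<subseteq> {1..k} \<Longrightarrow> supp \<beta> \<subseteq> {1..k} \<Longrightarrow> (\<forall>j\<in>{1..k}. coef \<alpha> j = coef \<beta> j) \<Longrightarrow> \<alpha> = \<beta>"
  by (rule poly_mapping_eqI) (metis in_keys_iff subsetD)

lemma mless_total:
  "supp \<alpha> \<subseteq> {1..k} \<Longrightarrow> supp \<beta> \<subseteq> {1..k} \<Longrightarrow> mless k \<alpha> \<beta> \<or> mless k \<beta> \<alpha> \<or> \<alpha> = \<beta>"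
  using mless_linear[of k \<alpha> \<beta>] expo_eqI by blast

lemma mless_cong:
  "(\<And>j. j \<in> {1..k} \<Longrightarrow> coef \<alpha> j = coef \<alpha>' j) \<Longrightarrow> (\<And>j. j \<in> {1..k} \<Longrightarrow> coef \<beta> j = coef \<beta>' j) \<Longrightarrow>
    mless k \<alpha> \<beta> \<longleftrightarrow> mless k \<alpha>' \<beta>'"
  by (induction k) auto

lemma mless_add_cancel [simp]: "mless k (\<alpha> + \<gamma>) (\<beta> + \<gamma>) \<longleftrightarrow> mless k \<alpha> \<beta>"
  by (induction k) (auto simp: lookup_add)

lemma not_mless_0 [simp]: "\<not> mless k \<alpha> 0"
  by (induction k) auto

text \<open>Replacing one factor \<open>x\<^sub>j\<close> by any monomial in earlier variables decreases an exponent. This is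
the effect of the operator \<open>x\<^sup>\<gamma> \<partial>\<^sub>j\<close>, and the reason why segments span ideals.\<close>

lemma mless_lower:
  assumes "j \<in> {1..k}" "supp \<gamma> \<subseteq> {1..j - 1}"
  shows "mless k (\<alpha> + \<gamma>) (\<alpha> + single j 1)"
  unfolding mless_iff
proof (rule bexI[of _ j], intro conjI allI impI)
  have g: "coef \<gamma> l = 0" if "j \<le> l" for l
    using assms that by (metis Suc_diff_1 Suc_le_eq atLeastAtMost_iff in_keys_iff less_le_trans
        not_less_eq_eq subsetD zero_less_one)
  show "coef (\<alpha> + \<gamma>) j < coef (\<alpha> + single j 1) j"
    using g[of j] by (simp add: lookup_add)
  show "coef (\<alpha> + \<gamma>) l = coef (\<alpha> + single j 1) l" if "j < l \<and> l \<le> k" for l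
    using that g[of l] by (simp add: lookup_add lookup_single)
qed (use assms in auto)

lemma wf_mless: "wf {(\<alpha>, \<beta>). mless k \<alpha> \<beta>}"
proof (induction k)
  case (Suc k)
  have "{(\<alpha>, \<beta>). mless (Suc k) \<alpha> \<beta>} =
    inv_image (less_than <*lex*> {(\<alpha>, \<beta>). mless k \<alpha> \<beta>}) (\<lambda>\<alpha>. (coef \<alpha> (Suc k), \<alpha>))"
    by auto
  then show ?case
    using Suc by (auto intro!: wf_inv_image)
qed simp

text \<open>The strict order on the indices of basis elements, smaller element first: a later block is smaller.\<close>

fun iless :: "expo \<times> nat \<Rightarrow> expo \<times> nat \<Rightarrow> bool" where
  "iless (\<alpha>, i) (\<beta>, j) \<longleftrightarrow> j < i \<or> i = j \<and> mless (i - 1) \<alpha> \<beta>"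

lemma index_greater_iff: "index_greater x y \<longleftrightarrow> iless y x"
  by (cases x; cases y) (auto simp: index_greater_def mless_iff)

lemma iless_irrefl [simp]: "\<not> iless x x"
  by (cases x) auto

lemma iless_trans: "iless x y \<Longrightarrow> iless y z \<Longrightarrow> iless x z"
  by (cases x; cases y; cases z) (auto intro: mless_trans)

lemma iless_total: "x \<in> basis_index n \<Longrightarrow> y \<in> basis_index n \<Longrightarrow> iless x y \<or> iless y x \<or> x = y"
  using mless_total[of "fst x" "snd x - 1" "fst y"]
  by (cases x; cases y) (auto simp: basis_index_def)

text \<open>The bound on the block matters: without it, later and later blocks form a descending sequence.\<close>

lemma wf_iless: "wf {(x, y). snd x \<le> n \<and> iless x y}"
proof -
  have wf: "wf (same_fst (\<lambda>_. True) (\<lambda>i. {(\<alpha>, \<beta>). mless (i - 1) \<alpha> \<beta>}))"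
    by (rule wf_same_fst) (rule wf_mless)
  have "wf (measure (\<lambda>i. n - i) <*lex*>
      (same_fst (\<lambda>_. True) (\<lambda>i. {(\<alpha>, \<beta>). mless (i - 1) \<alpha> \<beta>})))"
    using wf by auto
  moreover have "{(x, y). snd x \<le> n \<and> iless x y} \<subseteq>
     inv_image (measure (\<lambda>i. n - i) <*lex*>
      (same_fst (\<lambda>_. True) (\<lambda>i. {(\<alpha>, \<beta>). mless (i - 1) \<alpha> \<beta>}))) (\<lambda>(\<alpha>, i). (i, i, \<alpha>))"
    by (auto simp: same_fst_def)
  ultimately show ?thesis
    by (blast intro: wf_subset wf_inv_image)
qed

section \<open>Order types of initial segments\<close>

definition ile :: "(expo \<times> nat) set \<Rightarrow> (expo \<times> nat) rel" where
  "ile A = {(x, y). x \<in> A \<and> y \<in> A \<and> (x = y \<or> iless x y)}"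

lemma Field_ile [simp]: "Field (ile A) = A"
  by (auto simp: ile_def Field_def)

lemma Restr_ile: "B \<subseteq> A \<Longrightarrow> Restr (ile A) B = ile B"
  by (auto simp: ile_def)

lemma Well_order_ile: 
  assumes A: "A \<subseteq> basis_index n"
  shows "Well_order (ile A)"
proof -
  have "ile A - Id \<subseteq> {(x, y). snd x \<le> n \<and> iless x y}"
    using A by (auto simp: ile_def basis_index_def)
  then have "wf (ile A - Id)"
    by (rule wf_subset[OF wf_iless])
  moreover have "total_on A (ile A)"
    unfolding total_on_def
  proof (intro ballI impI)
    fix x y assume "x \<in> A" "y \<in> A" "x \<noteq> y"
    then show "(x, y) \<in> ile A \<or> (y, x) \<in> ile A"
      using iless_total[of x n y] A by (auto simp: ile_def simp del: iless.simps)
  qed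
  moreover have "antisym (ile A)"
    unfolding antisym_def ile_def using iless_trans iless_irrefl by blast
  moreover have "trans (ile A)"
    unfolding trans_def ile_def using iless_trans by blast
  moreover have "refl_on A (ile A)"
    by (auto simp: refl_on_def ile_def)
  ultimately show ?thesis
    by (auto simp: well_order_on_def linear_order_on_def partial_order_on_def preorder_on_def)
      (auto simp: ile_def)
qed

lemma dir_imageI: "(x, y) \<in> r \<Longrightarrow> z = (f x, f y) \<Longrightarrow> z \<in> dir_image r f"
  unfolding dir_image_def by blast

lemma dir_imageE:
  assumes "z \<in> dir_image r f"
  obtains x y where "(x, y) \<in> r" "z = (f x, f y)"
  using assms unfolding dir_image_def by blast

text \<open>An ordinal may be replaced by an isomorphic copy up to renaming its elements, which turns
questions about sums of ordinals into equations between relations.\<close>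

lemma ordIso_dir_image:
  assumes "r =o t"
  obtains f where "inj_on f (Field r)" "t = dir_image r f"
proof -
  obtain f where f: "iso r t f"
    using assms by (auto simp: ordIso_def)
  have bij: "f ` Field r = Field t" and iff: "\<And>a b. a \<in> Field r \<Longrightarrow> b \<in> Field r \<Longrightarrow> (a, b) \<in> r \<longleftrightarrow> (f a, f b) \<in> t"
    using f by (auto simp: iso_iff2 bij_betw_def)
  have "t = dir_image r f"
  proof (intro set_eqI iffI)
    fix z assume "z \<in> t"
    then have uv: "fst z \<in> f ` Field r" "snd z \<in> f ` Field r" "(fst z, snd z) \<in> t"
      unfolding bij using FieldI1[of "fst z" "snd z" t] FieldI2[of "fst z" "snd z" t] by auto
    then obtain a b where ab: "a \<in> Field r" "b \<in> Field r" "fst z = f a" "snd z = f b"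
      by blast
    then have "(a, b) \<in> r" "z = (f a, f b)"
      using uv(3) iff[of a b] by (simp_all add: prod_eq_iff)
    then show "z \<in> dir_image r f"
      unfolding dir_image_def by blast
  next
    fix z assume "z \<in> dir_image r f"
    then obtain a b where "z = (f a, f b)" "(a, b) \<in> r"
      unfolding dir_image_def by blast
    then show "z \<in> t"
      using iff[of a b] by (simp add: FieldI1 FieldI2)
  qed
  moreover have "inj_on f (Field r)"
    using f by (auto simp: iso_iff2 bij_betw_def)
  ultimately show thesis
    using that by blast
qed

lemma ordIso_ile_dir_imageI:
  assumes "A \<subseteq> basis_index n" "inj_on f A" "r = dir_image (ile A) f"
  shows "r =o ile A"
  using assms dir_image_ordIso[OF Well_order_ile[OF assms(1)], of f] ordIso_symmetric by simp

lemma ord_zero_ordIso_iff: "r =o ord_zero \<longleftrightarrow> r = {}"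
proof
  assume "r =o ord_zero"
  then obtain f where "iso r ord_zero f"
    by (auto simp: ordIso_def)
  then have "Field r = {}"
    by (auto simp: iso_iff2 bij_betw_def ord_zero_def)
  then show "r = {}"
    by (auto simp: Field_def)
next
  assume "r = {}"
  then show "r =o ord_zero"
    by (auto simp: ord_zero_def ordIso_def iso_iff2 bij_betw_def well_order_on_def linear_order_on_def
        partial_order_on_def preorder_on_def refl_on_def trans_def antisym_def total_on_def)
qed

lemma ord_zero_ile: "ord_zero =o ile {}"
  by (rule ordIso_symmetric) (simp add: ord_zero_ordIso_iff ile_def)

text \<open>Concatenating two segments adds their order types.\<close>

lemma ord_add_ile:
  assumes AB: "A \<union> B \<subseteq> basis_index n" and less: "\<And>x y. x \<in> A \<Longrightarrow> y \<in> B \<Longrightarrow> iless x y"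
    and r: "r =o ile A" and t: "t =o ile B"
  shows "r +\<^sub>o t =o ile (A \<union> B)"
proof -
  obtain f where f: "inj_on f A" "r = dir_image (ile A) f"
    using ordIso_dir_image[OF ordIso_symmetric[OF r]] by auto
  obtain g where g: "inj_on g B" "t = dir_image (ile B) g"
    using ordIso_dir_image[OF ordIso_symmetric[OF t]] by auto
  define h where "h x = (if x \<in> A then Inl (f x) else Inr (g x))" for x
  have disj: "x \<notin> A" if "x \<in> B" for x
    using less[of x x] that iless_irrefl by blast
  have nless: "\<not> iless y x" if "x \<in> A" "y \<in> B" for x y
    using less[OF that] iless_trans iless_irrefl by blast
  have F: "Field r = f ` A" "Field t = g ` B"
    by (simp_all add: f g dir_image_Field)
  have "map_prod Inl Inl ` r \<union> map_prod Inr Inr ` t \<union> (Inl ` Field r) \<times> (Inr ` Field t)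
     = dir_image (ile (A \<union> B)) h" (is "?L = ?R")
  proof
    show "?L \<subseteq> ?R"
    proof
      fix z assume "z \<in> ?L"
      then consider x y where "(x, y) \<in> ile A" "z = (Inl (f x), Inl (f y))"
        | x y where "(x, y) \<in> ile B" "z = (Inr (g x), Inr (g y))"
        | x y where "x \<in> A" "y \<in> B" "z = (Inl (f x), Inr (g y))"
        unfolding F unfolding f(2) g(2) dir_image_def by blast
      then show "z \<in> ?R"
      proof cases
        case 1
        then have "(x, y) \<in> ile (A \<union> B)" "z = (h x, h y)"
          by (auto simp: ile_def h_def)
        then show ?thesis by (rule dir_imageI)
      next
        case 2
        then have "(x, y) \<in> ile (A \<union> B)" "z = (h x, h y)"
          using disj by (auto simp: ile_def h_def)
        then show ?thesis by (rule dir_imageI)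
      next
        case 3
        then have "(x, y) \<in> ile (A \<union> B)" "z = (h x, h y)"
          using disj less by (auto simp: ile_def h_def)
        then show ?thesis by (rule dir_imageI)
      qed
    qed
    show "?R \<subseteq> ?L"
    proof
      fix z assume "z \<in> ?R"
      then obtain x y where xy: "(x, y) \<in> ile (A \<union> B)" "z = (h x, h y)"
        by (auto simp: dir_image_def)
      then consider "(x, y) \<in> ile A" | "(x, y) \<in> ile B" "x \<notin> A" "y \<notin> A" | "x \<in> A" "y \<in> B" "y \<notin> A"
        using nless disj unfolding ile_def by blast
      then show "z \<in> ?L"
      proof cases
        case 1
        then have "z = map_prod Inl Inl (f x, f y)" "(f x, f y) \<in> dir_image (ile A) f"
          using xy by (auto simp: h_def ile_def intro: dir_imageI simp del: iless.simps)
        then show ?thesis unfolding f(2) by blast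
      next
        case 2
        then have "z = map_prod Inr Inr (g x, g y)" "(g x, g y) \<in> dir_image (ile B) g"
          using xy by (auto simp: h_def ile_def intro: dir_imageI simp del: iless.simps)
        then show ?thesis unfolding g(2) by blast
      next
        case 3
        then show ?thesis
          using xy by (simp add: h_def F)
      qed
    qed
  qed
  then have "r +\<^sub>o t = dir_image (ile (A \<union> B)) (sum_encode \<circ> h)"
    unfolding ord_add_def by (auto simp: dir_image_def)
  moreover have "inj_on (sum_encode \<circ> h) (A \<union> B)"
    using f(1) g(1) disj inj_sum_encode[of UNIV]
    by (intro comp_inj_on) (auto simp: inj_on_def h_def)
  ultimately show ?thesis
    using ordIso_ile_dir_imageI[OF AB] by blast
qed

text \<open>The code of an exponent under the nested pairing used by \<open>omega_pow\<close>; the variables above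
\<open>k\<close> are ignored, as in \<open>mless\<close>.\<close>

primrec mcode :: "nat \<Rightarrow> expo \<Rightarrow> nat" where
  "mcode 0 \<alpha> = 0"
| "mcode (Suc k) \<alpha> = prod_encode (mcode k \<alpha>, coef \<alpha> (Suc k))"

lemma mcode_eq_iff: "mcode k \<alpha> = mcode k \<beta> \<longleftrightarrow> (\<forall>j\<in>{1..k}. coef \<alpha> j = coef \<beta> j)"
  by (induction k) (auto simp: atLeastAtMostSuc_conv)

text \<open>Multiplication by \<open>\<omega>\<close> adds a new most significant coordinate, exactly as the recursion for
\<open>mless\<close> does; hence the coded order is not merely isomorphic but equal to \<open>omega_pow\<close>.\<close>

lemma omega_pow_eq:
  "omega_pow k = {(mcode k \<alpha>, mcode k \<beta>) | \<alpha> \<beta>. mcode k \<alpha> = mcode k \<beta> \<or> mless k \<alpha> \<beta>}"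
proof (induction k)
  case 0
  show ?case by (simp add: ord_one_def)
next
  case (Suc k)
  have F: "Field (omega_pow k) = range (mcode k)"
    unfolding Suc by (auto simp: Field_def)
  define up :: "expo \<Rightarrow> nat \<Rightarrow> expo" where "up \<alpha> b = Poly_Mapping.update (Suc k) b \<alpha>" for \<alpha> b
  have up: "mcode k (up \<alpha> b) = mcode k \<alpha>" "coef (up \<alpha> b) (Suc k) = b" 
     "mless k (up \<alpha> b) (up \<beta> c) = mless k \<alpha> \<beta>" for \<alpha> \<beta> b c
    by (auto simp: mcode_eq_iff up_def lookup_update intro!: mless_cong)
  have upS: "mcode (Suc k) (up \<alpha> b) = prod_encode (mcode k \<alpha>, b)" for \<alpha> b
    by (simp add: up)
  show ?case (is "_ = ?R")
  proof
    show "omega_pow (Suc k) \<subseteq> ?R"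
    proof
      fix z assume "z \<in> omega_pow (Suc k)"
      then obtain a b a' b' where z: "z = (prod_encode (a, b), prod_encode (a', b'))"
        and F': "a \<in> Field (omega_pow k)" "a' \<in> Field (omega_pow k)"
        and c: "b < b' \<or> b = b' \<and> (a, a') \<in> omega_pow k"
        by (auto simp: ord_mult_def dir_image_def natLeq_def)
      from c show "z \<in> ?R"
      proof
        assume "b < b'"
        \<comment> \<open>Codes do not determine the remaining coordinates, so the new one can be set freely.\<close>
        obtain \<alpha> \<beta> where "a = mcode k \<alpha>" "a' = mcode k \<beta>"
          using F' unfolding F by auto
        then have "z = (mcode (Suc k) (up \<alpha> b), mcode (Suc k) (up \<beta> b'))"
          "mless (Suc k) (up \<alpha> b) (up \<beta> b')"
          using \<open>b < b'\<close> z by (simp_all add: up)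
        then show ?thesis by blast
      next
        assume a: "b = b' \<and> (a, a') \<in> omega_pow k"
        then obtain \<alpha> \<beta> where "a = mcode k \<alpha>" "a' = mcode k \<beta>" "a = a' \<or> mless k \<alpha> \<beta>"
          unfolding Suc by auto
        then have "z = (mcode (Suc k) (up \<alpha> b), mcode (Suc k) (up \<beta> b'))"
          "mcode (Suc k) (up \<alpha> b) = mcode (Suc k) (up \<beta> b') \<or> mless (Suc k) (up \<alpha> b) (up \<beta> b')"
          using a z by (auto simp add: up)
        then show ?thesis by blast
      qed
    qed
    show "?R \<subseteq> omega_pow (Suc k)"
    proof
      fix z assume "z \<in> ?R"
      then obtain \<alpha> \<beta> where z: "z = (mcode (Suc k) \<alpha>, mcode (Suc k) \<beta>)"
        and c: "mcode (Suc k) \<alpha> = mcode (Suc k) \<beta> \<or> mless (Suc k) \<alpha> \<beta>" by blast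
      have "(mcode k \<alpha>, mcode k \<beta>) \<in> omega_pow k" if "mcode k \<alpha> = mcode k \<beta> \<or> mless k \<alpha> \<beta>"
        unfolding Suc using that by blast
      then show "z \<in> omega_pow (Suc k)"
        using c by (auto simp: z ord_mult_def dir_image_def F natLeq_def Field_natLeq[unfolded natLeq_def])
    qed
  qed
qed

lemma omega_pow_mem_iff:
  "(mcode k \<alpha>, mcode k \<beta>) \<in> omega_pow k \<longleftrightarrow> mcode k \<alpha> = mcode k \<beta> \<or> mless k \<alpha> \<beta>"
proof -
  have "mless k \<alpha> \<beta>" if "mcode k \<alpha> = mcode k \<alpha>'" "mcode k \<beta> = mcode k \<beta>'" "mless k \<alpha>' \<beta>'" for \<alpha>' \<beta>'
    using that mless_cong[of k \<alpha> \<alpha>' \<beta> \<beta>'] by (auto simp: mcode_eq_iff)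
  then show ?thesis
    unfolding omega_pow_eq[of k] by auto
qed

lemma Field_omega_pow: "Field (omega_pow k) = range (mcode k)"
  unfolding omega_pow_eq by (auto simp: Field_def)

text \<open>The codes of \<open>A\<close> may form any part of \<open>\<omega>\<^sup>k\<close>, so this covers whole blocks, slices of blocks and
initial segments of slices alike.\<close>

lemma ile_slice_ordIso:
  assumes A: "A \<times> {l} \<subseteq> basis_index n"
    and inj: "\<And>\<alpha> \<beta>. \<alpha> \<in> A \<Longrightarrow> \<beta> \<in> A \<Longrightarrow> (\<forall>j\<in>{1..k}. coef \<alpha> j = coef \<beta> j) \<Longrightarrow> \<alpha> = \<beta>"
    and less: "\<And>\<alpha> \<beta>. \<alpha> \<in> A \<Longrightarrow> \<beta> \<in> A \<Longrightarrow> mless (l - 1) \<alpha> \<beta> \<longleftrightarrow> mless k \<alpha> \<beta>"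
  shows "Restr (omega_pow k) (mcode k ` A) =o ile (A \<times> {l})"
proof (rule ordIso_ile_dir_imageI[OF A, where f = "mcode k \<circ> fst"])
  show "inj_on (mcode k \<circ> fst) (A \<times> {l})"
    using inj by (auto simp: inj_on_def mcode_eq_iff)
  show "Restr (omega_pow k) (mcode k ` A) = dir_image (ile (A \<times> {l})) (mcode k \<circ> fst)"
  proof (intro set_eqI iffI)
    fix z assume "z \<in> Restr (omega_pow k) (mcode k ` A)"
    then obtain \<alpha> \<beta> where *: "z = (mcode k \<alpha>, mcode k \<beta>)" "\<alpha> \<in> A" "\<beta> \<in> A" 
       "(mcode k \<alpha>, mcode k \<beta>) \<in> omega_pow k" by auto
    then have "((\<alpha>, l), (\<beta>, l)) \<in> ile (A \<times> {l})"
      using inj less by (auto simp: omega_pow_mem_iff mcode_eq_iff ile_def)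
    then show "z \<in> dir_image (ile (A \<times> {l})) (mcode k \<circ> fst)"
      using * unfolding dir_image_def by force
  next
    fix z assume "z \<in> dir_image (ile (A \<times> {l})) (mcode k \<circ> fst)"
    then show "z \<in> Restr (omega_pow k) (mcode k ` A)"
      using less by (auto simp: dir_image_def ile_def omega_pow_mem_iff)
  qed
qed

text \<open>Indices in block \<open>s\<close> grouped by the exponent of \<open>x\<^sub>s\<^sub>-\<^sub>1\<close>, the most significant variable of the
block. Each single value contributes one copy of \<open>\<omega>\<^sup>s\<^sup>-\<^sup>2\<close>.\<close>

definition slice :: "nat \<Rightarrow> nat \<Rightarrow> nat \<Rightarrow> (expo \<times> nat) set" where
  "slice s a b = {(\<alpha>, l). l = s \<and> supp \<alpha> \<subseteq> {1..s - 1} \<and> a \<le> coef \<alpha> (s - 1) \<and> coef \<alpha> (s - 1) < b}"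

text \<open>The ordinal \<open>\<nu> < \<omega>\<^sup>k\<close> of the exponents smaller than \<open>\<sigma>\<close>, realized inside \<open>omega_pow\<close>.\<close>

definition initial_type :: "nat \<Rightarrow> expo \<Rightarrow> nat rel" where
  "initial_type k \<sigma> = Restr (omega_pow k) (mcode k ` {\<alpha>. mless k \<alpha> \<sigma>})"

text \<open>Dropping the variables above \<open>k\<close> does not change the code.\<close>

lemma mcode_restrict:
  obtains \<beta> where "mcode k \<beta> = mcode k \<alpha>" "supp \<beta> \<subseteq> {1..k}"
proof
  define \<beta> :: expo where "\<beta> = (\<Sum>j\<in>{1..k}. single j (coef \<alpha> j))"
  have *: "coef \<beta> j = (if j \<in> {1..k} then coef \<alpha> j else 0)" for j
    unfolding \<beta>_def lookup_sum lookup_single when_def by (simp add: sum.delta)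
  then show "mcode k \<beta> = mcode k \<alpha>"
    by (simp add: mcode_eq_iff)
  show "supp \<beta> \<subseteq> {1..k}"
    using * by (auto simp: supp_iff split: if_splits)
qed

lemma block_ordIso:
  assumes "s \<in> {1..n}"
  shows "omega_pow (s - 1) =o ile ({\<alpha>. supp \<alpha> \<subseteq> {1..s - 1}} \<times> {s})" (is "_ =o ile (?A \<times> _)")
proof -
  have "mcode (s - 1) ` ?A = Field (omega_pow (s - 1))"
  proof -
    have "mcode (s - 1) \<alpha> \<in> mcode (s - 1) ` ?A" for \<alpha>
      by (rule mcode_restrict[of "s - 1" \<alpha>]) (metis image_eqI mem_Collect_eq)
    then show ?thesis
      unfolding Field_omega_pow by blast
  qed
  moreover have "Restr (omega_pow (s - 1)) (mcode (s - 1) ` ?A) =o ile (?A \<times> {s})"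
  proof (rule ile_slice_ordIso[where n = n])
    show "?A \<times> {s} \<subseteq> basis_index n"
      using assms by (auto simp: basis_index_def)
    show "\<alpha> = \<beta>" if "\<alpha> \<in> ?A" "\<beta> \<in> ?A" "\<forall>j\<in>{1..s - 1}. coef \<alpha> j = coef \<beta> j" for \<alpha> \<beta>
      using that expo_eqI by blast
  qed simp
  ultimately show ?thesis
    by (simp add: Restr_Field)
qed

lemma Suc_diff_2: "2 \<le> s \<Longrightarrow> Suc (s - 2) = s - (1::nat)"
  by simp

lemma mless_top:
  fixes s :: nat
  assumes "2 \<le> s"
  shows "mless (s - 1) \<alpha> \<beta> \<longleftrightarrow> coef \<alpha> (s - 1) < coef \<beta> (s - 1) \<or>
     coef \<alpha> (s - 1) = coef \<beta> (s - 1) \<and> mless (s - 2) \<alpha> \<beta>"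
  using mless.simps(2)[of "s - 2" \<alpha> \<beta>] unfolding Suc_diff_2[OF assms] .

lemma slice_inj:
  fixes s :: nat
  assumes "2 \<le> s" "supp \<alpha> \<subseteq> {1..s - 1}" "supp \<beta> \<subseteq> {1..s - 1}" "coef \<alpha> (s - 1) = coef \<beta> (s - 1)"
    "\<forall>j\<in>{1..s - 2}. coef \<alpha> j = coef \<beta> j"
  shows "\<alpha> = \<beta>"
proof (rule expo_eqI[OF assms(2,3)], rule ballI)
  fix j assume "j \<in> {1..s - 1}"
  then have "j = s - 1 \<or> j \<in> {1..s - 2}" by auto
  then show "coef \<alpha> j = coef \<beta> j" using assms by auto
qed

text \<open>Fixing the exponent of \<open>x\<^sub>s\<^sub>-\<^sub>1\<close> leaves the exponents in the remaining \<open>s - 2\<close>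
variables, cut down by any condition \<open>P\<close> on them.\<close>

lemma slice1_ordIso_general:
  assumes "s \<in> {2..n}" 
    and P: "\<And>\<alpha> \<beta>. (\<forall>j\<in>{1..s - 2}. coef \<alpha> j = coef \<beta> j) \<Longrightarrow> P \<alpha> = P \<beta>"
  shows "Restr (omega_pow (s - 2)) (mcode (s - 2) ` {\<alpha>. P \<alpha>}) =o
    ile {(\<alpha>, l). l = s \<and> supp \<alpha> \<subseteq> {1..s - 1} \<and> coef \<alpha> (s - 1) = a \<and> P \<alpha>}"
proof -
  let ?A = "{\<alpha>. supp \<alpha> \<subseteq> {1..s - 1} \<and> coef \<alpha> (s - 1) = a \<and> P \<alpha>}"
  have *: "\<exists>\<beta>\<in>?A. mcode (s - 2) \<beta> = mcode (s - 2) \<alpha>" if "P \<alpha>" for \<alpha>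
  proof -
    obtain \<beta> where \<beta>: "mcode (s - 2) \<beta> = mcode (s - 2) \<alpha>" "supp \<beta> \<subseteq> {1..s - 2}"
      by (rule mcode_restrict)
    define \<gamma> where "\<gamma> = Poly_Mapping.update (s - 1) a \<beta>"
    have eq: "\<forall>j\<in>{1..s - 2}. coef \<gamma> j = coef \<alpha> j"
      using \<beta>(1) by (auto simp: \<gamma>_def lookup_update mcode_eq_iff)
    moreover have "supp \<gamma> \<subseteq> {1..s - 1}"
    proof
      fix j assume "j \<in> supp \<gamma>"
      then have "j = s - 1 \<or> j \<in> supp \<beta>"
        by (auto simp: \<gamma>_def supp_iff lookup_update split: if_splits)
      then show "j \<in> {1..s - 1}"
        using subsetD[OF \<beta>(2), of j] assms by auto
    qed
    ultimately show ?thesis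
      using P[OF eq] that by (intro bexI[of _ \<gamma>]) (auto simp: mcode_eq_iff \<gamma>_def lookup_update)
  qed
  have im: "mcode (s - 2) ` {\<alpha>. P \<alpha>} = mcode (s - 2) ` ?A"
  proof -
    have "mcode (s - 2) \<alpha> \<in> mcode (s - 2) ` ?A" if P\<alpha>: "P \<alpha>" for \<alpha>
    proof -
      obtain \<beta> where "\<beta> \<in> ?A" "mcode (s - 2) \<beta> = mcode (s - 2) \<alpha>"
        using *[OF P\<alpha>] by blast
      then show ?thesis
        using imageI[of \<beta> ?A "mcode (s - 2)"] by simp
    qed
    then show ?thesis by blast
  qed
  have "Restr (omega_pow (s - 2)) (mcode (s - 2) ` ?A) =o ile (?A \<times> {s})"
  proof (rule ile_slice_ordIso[where n = n])
    show "?A \<times> {s} \<subseteq> basis_index n"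
      using assms by (auto simp: basis_index_def)
    show "\<alpha> = \<beta>" if "\<alpha> \<in> ?A" "\<beta> \<in> ?A" "\<forall>j\<in>{1..s - 2}. coef \<alpha> j = coef \<beta> j" for \<alpha> \<beta>
      using that assms by (intro slice_inj[of s \<alpha> \<beta>]) auto
    show "mless (s - 1) \<alpha> \<beta> \<longleftrightarrow> mless (s - 2) \<alpha> \<beta>" if "\<alpha> \<in> ?A" "\<beta> \<in> ?A" for \<alpha> \<beta>
      using that assms by (simp add: mless_top del: One_nat_def)
  qed
  moreover have "?A \<times> {s} = {(\<alpha>, l). l = s \<and> supp \<alpha> \<subseteq> {1..s - 1} \<and> coef \<alpha> (s - 1) = a \<and> P \<alpha>}"
    by auto
  ultimately show ?thesis
    unfolding im by simp
qed

lemma slice1_ordIso: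
  assumes "s \<in> {2..n}"
  shows "omega_pow (s - 2) =o ile (slice s a (Suc a))"
proof -
  have "slice s a (Suc a) = {(\<alpha>, l). l = s \<and> supp \<alpha> \<subseteq> {1..s - 1} \<and> coef \<alpha> (s - 1) = a \<and> True}"
    by (auto simp: slice_def)
  moreover have "Restr (omega_pow (s - 2)) (mcode (s - 2) ` {\<alpha>. True}) = omega_pow (s - 2)"
    using Restr_Field[of "omega_pow (s - 2)"] unfolding Field_omega_pow by simp
  ultimately show ?thesis
    using slice1_ordIso_general[OF assms, of "\<lambda>_. True" a] by simp
qed

lemma initial_type_ordIso:
  assumes "s \<in> {2..n}"
  shows "initial_type (s - 2) \<sigma> =o
    ile {(\<alpha>, l). l = s \<and> supp \<alpha> \<subseteq> {1..s - 1} \<and> coef \<alpha> (s - 1) = a \<and> mless (s - 2) \<alpha> \<sigma>}"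
  unfolding initial_type_def using assms
  by (rule slice1_ordIso_general) (auto intro!: mless_cong)

lemma slice_subset: "s \<in> {1..n} \<Longrightarrow> slice s a b \<subseteq> basis_index n"
  by (auto simp: slice_def basis_index_def)

text \<open>The lower bound \<open>a\<close> is variable because \<open>omega_mult\<close> splits off its first, smallest copy, so the
induction continues with the slices that start at \<open>a + 1\<close>.\<close>

lemma omega_mult_ordIso:
  assumes "s \<in> {2..n}"
  shows "omega_mult i (s - 2) =o ile (slice s a (a + i))"
proof (induction i arbitrary: a)
  case 0
  have "slice s a (a + 0) = {}" by (auto simp: slice_def)
  then show ?case
    by (simp only: omega_mult_def replicate.simps ord_sum_def foldr.simps id_apply ord_zero_ile)
next
  case (Suc i)
  have "omega_pow (s - 2) +\<^sub>o omega_mult i (s - 2) =o ile (slice s a (Suc a) \<union> slice s (Suc a) (Suc a + i))"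
  proof (rule ord_add_ile[OF _ _ slice1_ordIso[OF assms] Suc.IH])
    show "slice s a (Suc a) \<union> slice s (Suc a) (Suc a + i) \<subseteq> basis_index n"
      using assms slice_subset by (meson Un_least atLeastAtMost_iff one_le_numeral order_trans)
    show "iless x y" if "x \<in> slice s a (Suc a)" "y \<in> slice s (Suc a) (Suc a + i)" for x y
      using that assms by (cases x; cases y) (auto simp: slice_def mless_top simp del: One_nat_def)
  qed
  moreover have "slice s a (Suc a) \<union> slice s (Suc a) (Suc a + i) = slice s a (a + Suc i)"
    by (auto simp: slice_def)
  moreover have "omega_mult (Suc i) (s - 2) = omega_pow (s - 2) +\<^sub>o omega_mult i (s - 2)"
    by (simp add: omega_mult_def ord_sum_def)
  ultimately show ?case
    by simp
qed

lemma omega_tail_ordIso: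
  assumes "s \<ge> 1"
  shows "omega_tail n s =o ile {(\<alpha>, l) \<in> basis_index n. s < l}"
proof (induction n)
  case 0
  have "{(\<alpha>, l) \<in> basis_index 0. s < l} = {}" by (auto simp: basis_index_def)
  moreover have "omega_tail 0 s = ord_zero"
    by (simp add: omega_tail_def ord_sum_def)
  ultimately show ?case
    using ord_zero_ile by (simp only:)
next
  case (Suc n)
  show ?case
  proof (cases "s \<le> n")
    case False
    then have "{(\<alpha>, l) \<in> basis_index (Suc n). s < l} = {}" by (auto simp: basis_index_def)
    moreover have "omega_tail (Suc n) s = ord_zero"
      using False by (simp add: omega_tail_def ord_sum_def)
    ultimately show ?thesis
      using ord_zero_ile by (simp only:)
  next
    case True
    let ?A = "{\<alpha>. supp \<alpha> \<subseteq> {1..Suc n - 1}} \<times> {Suc n}"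
    let ?B = "{(\<alpha>, l) \<in> basis_index n. s < l}"
    have "omega_pow (Suc n - 1) +\<^sub>o omega_tail n s =o ile (?A \<union> ?B)"
    proof (rule ord_add_ile[OF _ _ _ Suc.IH])
      show "?A \<union> ?B \<subseteq> basis_index (Suc n)"
        by (auto simp: basis_index_def)
      show "omega_pow (Suc n - 1) =o ile ?A"
        by (rule block_ordIso[of _ "Suc n"]) auto
    qed (auto simp: basis_index_def)
    moreover have "?A \<union> ?B = {(\<alpha>, l) \<in> basis_index (Suc n). s < l}"
      using True assms by (auto simp: basis_index_def le_Suc_eq)
    moreover have "omega_tail (Suc n) s = omega_pow (Suc n - 1) +\<^sub>o omega_tail n s"
      using True by (simp add: omega_tail_def ord_sum_def)
    ultimately show ?thesis by simp
  qed
qed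

definition preds :: "nat \<Rightarrow> expo \<times> nat \<Rightarrow> (expo \<times> nat) set" where
  "preds n z = {y \<in> basis_index n. iless y z}"

definition slice_top :: "nat \<Rightarrow> nat \<Rightarrow> expo \<Rightarrow> (expo \<times> nat) set" where
  "slice_top s i \<sigma> = {(\<alpha>, l). l = s \<and> supp \<alpha> \<subseteq> {1..s - 1} \<and> coef \<alpha> (s - 1) = i \<and> mless (s - 2) \<alpha> \<sigma>}"

text \<open>The three parts of a segment correspond to the three summands of its ordinal.\<close>

lemma preds_eq:
  assumes s: "s \<in> {2..n}" and \<sigma>: "supp \<sigma> \<subseteq> {1..s - 2}"
  shows "preds n (\<sigma> + single (s - 1) i, s) =
    {(\<alpha>, l) \<in> basis_index n. s < l} \<union> slice s 0 (0 + i) \<union> slice_top s i \<sigma>"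
proof -
  have [simp]: "coef \<sigma> (s - 1) = 0"
    using \<sigma> s by (metis Suc_diff_2 atLeastAtMost_iff in_keys_iff not_less_eq_eq order_refl subsetD)
  have "mless (s - 2) \<alpha> (\<sigma> + single (s - 1) i) \<longleftrightarrow> mless (s - 2) \<alpha> \<sigma>" for \<alpha>
    using s by (intro mless_cong) (auto simp: lookup_add lookup_single when_def)
  then show ?thesis
    using s unfolding preds_def
    by (auto simp: basis_index_def slice_def slice_top_def mless_top lookup_add simp del: One_nat_def)
qed

lemma slice_less_slice_top:
  "2 \<le> s \<Longrightarrow> x \<in> slice s 0 (0 + i) \<Longrightarrow> y \<in> slice_top s i \<sigma> \<Longrightarrow> iless x y"
  by (auto simp: slice_def slice_top_def mless_top simp del: One_nat_def)

lemma slice_top_ordIso: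
  "s \<in> {2..n} \<Longrightarrow> \<nu> =o initial_type (s - 2) \<sigma> \<Longrightarrow> \<nu> =o ile (slice_top s i \<sigma>)"
  unfolding slice_top_def by (rule ordIso_transitive[OF _ initial_type_ordIso])

lemma preds_ordIso:
  assumes s: "s \<in> {2..n}" and \<sigma>: "supp \<sigma> \<subseteq> {1..s - 2}"
    and \<nu>: "\<nu> =o initial_type (s - 2) \<sigma>"
  shows "omega_tail n s +\<^sub>o omega_mult i (s - 2) +\<^sub>o \<nu> =o
     ile (preds n (\<sigma> + single (s - 1) i, s))"
  unfolding preds_eq[OF s \<sigma>]
proof (rule ord_add_ile[where n = n])
  let ?A = "{(\<alpha>, l) \<in> basis_index n. s < l}"
  have sub: "?A \<subseteq> basis_index n" "slice s 0 (0 + i) \<subseteq> basis_index n" "slice_top s i \<sigma> \<subseteq> basis_index n"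
    using s by (auto simp: slice_def slice_top_def basis_index_def)
  then show "?A \<union> slice s 0 (0 + i) \<union> slice_top s i \<sigma> \<subseteq> basis_index n"
    by blast
  show "omega_tail n s +\<^sub>o omega_mult i (s - 2) =o ile (?A \<union> slice s 0 (0 + i))"
  proof (rule ord_add_ile[where n = n])
    show "omega_tail n s =o ile ?A"
      using s by (intro omega_tail_ordIso) auto
    show "omega_mult i (s - 2) =o ile (slice s 0 (0 + i))"
      using s by (rule omega_mult_ordIso)
    show "iless x y" if "x \<in> ?A" "y \<in> slice s 0 (0 + i)" for x y
      using that by (auto simp: slice_def)
  qed (use sub in blast)
  show "\<nu> =o ile (slice_top s i \<sigma>)"
    using slice_top_ordIso[OF s \<nu>] .
  show "iless x y" if x: "x \<in> ?A \<union> slice s 0 (0 + i)" and y: "y \<in> slice_top s i \<sigma>" for x y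
    using x
  proof
    assume "x \<in> ?A"
    then show ?thesis
      using y by (auto simp: slice_top_def)
  next
    assume "x \<in> slice s 0 (0 + i)"
    then show ?thesis
      using s y by (intro slice_less_slice_top[of s x i y \<sigma>]) auto
  qed
qed

text \<open>In the last block no full block lies below, and the first summand disappears.\<close>

lemma preds_last_block_ordIso:
  assumes n: "2 \<le> n" and \<sigma>: "supp \<sigma> \<subseteq> {1..n - 2}" and \<nu>: "\<nu> =o initial_type (n - 2) \<sigma>"
  shows "omega_mult i (n - 2) +\<^sub>o \<nu> =o ile (preds n (\<sigma> + single (n - 1) i, n))"
proof -
  have nn: "n \<in> {2..n}"
    using n by simp
  have "{(\<alpha>, l) \<in> basis_index n. n < l} = {}"
    by (auto simp: basis_index_def)
  then have eq: "preds n (\<sigma> + single (n - 1) i, n) = slice n 0 (0 + i) \<union> slice_top n i \<sigma>"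
    using preds_eq[OF nn \<sigma>, of i] by (simp only: Un_empty_left)
  show ?thesis
    unfolding eq
  proof (rule ord_add_ile[where n = n])
    show "slice n 0 (0 + i) \<union> slice_top n i \<sigma> \<subseteq> basis_index n"
      using n by (auto simp: slice_def slice_top_def basis_index_def)
    show "omega_mult i (n - 2) =o ile (slice n 0 (0 + i))"
      using nn by (rule omega_mult_ordIso)
    show "\<nu> =o ile (slice_top n i \<sigma>)"
      using slice_top_ordIso[OF nn \<nu>] .
  qed (rule slice_less_slice_top[OF n])
qed

lemma omega_pow_Well_order: "Well_order (omega_pow k)"
  using block_ordIso[of "Suc k" "Suc k"] by (auto simp: ordIso_def)

text \<open>Every ordinal below \<open>\<omega>\<^sup>k\<close> is the type of a proper initial segment, and these are given by the
exponents in \<open>k\<close> variables; the ordinal zero belongs to the exponent \<open>0\<close>.\<close>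

lemma below_omega_pow_iff:
  "below_omega_pow k \<nu> \<longleftrightarrow> (\<exists>\<sigma>. supp \<sigma> \<subseteq> {1..k} \<and> \<nu> =o initial_type k \<sigma>)"
proof
  have uS: "Restr (omega_pow k) (underS (omega_pow k) (mcode k \<sigma>)) = initial_type k \<sigma>" for \<sigma>
  proof -
    have "underS (omega_pow k) (mcode k \<sigma>) = mcode k ` {\<alpha>. mless k \<alpha> \<sigma>}"
    proof -
      have neq: "mcode k \<alpha> \<noteq> mcode k \<sigma>" if "mless k \<alpha> \<sigma>" for \<alpha>
        using that mless_cong[of k \<alpha> \<sigma> \<sigma> \<sigma>] mless_irrefl unfolding mcode_eq_iff by blast
      show ?thesis
      proof (intro set_eqI iffI)
        fix x assume x: "x \<in> underS (omega_pow k) (mcode k \<sigma>)"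
        then have "x \<in> Field (omega_pow k)"
          by (auto simp: underS_def intro: FieldI1)
        then obtain \<alpha> where "x = mcode k \<alpha>"
          unfolding Field_omega_pow by blast
        then show "x \<in> mcode k ` {\<alpha>. mless k \<alpha> \<sigma>}"
          using x by (auto simp: underS_def omega_pow_mem_iff)
      next
        fix x assume "x \<in> mcode k ` {\<alpha>. mless k \<alpha> \<sigma>}"
        then show "x \<in> underS (omega_pow k) (mcode k \<sigma>)"
          using neq by (auto simp: underS_def omega_pow_mem_iff)
      qed
    qed
    then show ?thesis by (simp add: initial_type_def)
  qed
  show "\<exists>\<sigma>. supp \<sigma> \<subseteq> {1..k} \<and> \<nu> =o initial_type k \<sigma>" if \<nu>: "below_omega_pow k \<nu>"
  proof (cases "\<nu> =o ord_zero")
    case True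
    moreover have "initial_type k 0 = ord_zero"
      by (simp add: initial_type_def ord_zero_def)
    ultimately have "\<nu> =o initial_type k 0"
      by simp
    then show ?thesis by (intro exI[of _ 0]) auto
  next
    case False
    then have "\<nu> <o omega_pow k"
      using \<nu> by (auto simp: below_omega_pow_def)
    moreover from this have "Well_order \<nu>"
      by (simp add: ordLess_def)
    ultimately obtain a where "a \<in> Field (omega_pow k)" "\<nu> =o Restr (omega_pow k) (underS (omega_pow k) a)"
      using ordLess_iff_ordIso_Restr[OF omega_pow_Well_order, of \<nu>] by blast
    then obtain \<alpha> where "\<nu> =o Restr (omega_pow k) (underS (omega_pow k) (mcode k \<alpha>))"
      by (auto simp: Field_omega_pow)
    moreover obtain \<sigma> where "mcode k \<sigma> = mcode k \<alpha>" "supp \<sigma> \<subseteq> {1..k}"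
      by (rule mcode_restrict)
    ultimately show ?thesis
      using uS[of \<sigma>] by auto
  qed
  show "below_omega_pow k \<nu>" if ex: "\<exists>\<sigma>. supp \<sigma> \<subseteq> {1..k} \<and> \<nu> =o initial_type k \<sigma>"
  proof -
    obtain \<sigma> where "\<nu> =o initial_type k \<sigma>" using ex by blast
    then have wo: "Well_order \<nu>" and "\<nu> =o Restr (omega_pow k) (underS (omega_pow k) (mcode k \<sigma>))"
      unfolding uS by (auto simp: ordIso_def)
    then have less: "\<nu> <o omega_pow k"
      using ordLess_iff_ordIso_Restr[OF omega_pow_Well_order[of k] wo] by (auto simp: Field_omega_pow)
    show ?thesis
    proof (cases "ord_one \<le>o \<nu>")
      case True
      then show ?thesis using less by (simp add: below_omega_pow_def)
    next
      case False
      have wo1: "Well_order ord_one"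
        using omega_pow_Well_order[of 0] by simp
      then have "\<nu> <o ord_one"
        using False not_ordLeq_iff_ordLess wo by blast
      then obtain a where "a \<in> Field ord_one" "\<nu> =o Restr ord_one (underS ord_one a)"
        using ordLess_iff_ordIso_Restr[OF wo1 wo] by blast
      moreover have "Restr ord_one (underS ord_one a) = ord_zero"
        by (auto simp: ord_one_def underS_def ord_zero_def)
      ultimately show ?thesis
        by (simp add: below_omega_pow_def)
    qed
  qed
qed

section \<open>Triangular derivations through their components\<close>

definition var :: "nat \<Rightarrow> 'k::field_char_0 mpoly" where
  "var l = single (single l 1) 1"

definition vf :: "nat \<Rightarrow> (nat \<Rightarrow> 'k::field_char_0 mpoly) \<Rightarrow> 'k oper" where
  "vf n f = (\<lambda>p\<in>polys n. \<Sum>i=1..n. f i * partial i p)"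

text \<open>A derivation in \<open>u_alg n\<close> is determined by its values at the variables.\<close>

definition component :: "'k::field_char_0 oper \<Rightarrow> nat \<Rightarrow> 'k mpoly" where
  "component D l = D (var l)"

abbreviation u_set :: "nat \<Rightarrow> 'k::field_char_0 oper set" where
  "u_set n \<equiv> lie_carrier (u_alg n)"

lemma var_polys: "l \<in> {1..n} \<Longrightarrow> var l \<in> polys n"
  by (simp add: var_def polys_single)

lemma partial_var: "partial i (var l) = (if i = l then 1 else 0)"
  by (auto simp: var_def partial_single lookup_single simp flip: single_one)

lemma comp_vf: "l \<in> {1..n} \<Longrightarrow> component (vf n f) l = f l"
  by (simp add: component_def vf_def var_polys partial_var if_distrib[of "\<lambda>x. _ * x"] sum.delta cong: if_cong)

lemma vf_cong: "(\<And>l. l \<in> {1..n} \<Longrightarrow> f l = g l) \<Longrightarrow> vf n f = vf n g"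
  by (simp add: vf_def)

lemma u_set_eq: "u_set n = {vf n f | f. \<forall>i\<in>{1..n}. f i \<in> polys (i - 1)}"
  by (simp add: u_alg_def vf_def)

lemma vf_mem: "(\<And>i. i \<in> {1..n} \<Longrightarrow> f i \<in> polys (i - 1)) \<Longrightarrow> vf n f \<in> u_set n"
  unfolding u_set_eq by blast

lemma vf_comp: "D \<in> u_set n \<Longrightarrow> vf n (component D) = D"
  unfolding u_set_eq by (auto intro!: vf_cong simp: comp_vf)

lemma comp_polys: "D \<in> u_set n \<Longrightarrow> l \<in> {1..n} \<Longrightarrow> component D l \<in> polys (l - 1)"
  unfolding u_set_eq by (auto simp: comp_vf)

lemma u_eqI: "D \<in> u_set n \<Longrightarrow> E \<in> u_set n \<Longrightarrow> (\<And>l. l \<in> {1..n} \<Longrightarrow> component D l = component E l) \<Longrightarrow> D = E"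
  using vf_comp vf_cong by metis

lemma vf_add: "lie_add (u_alg n) (vf n f) (vf n g) = vf n (\<lambda>l. f l + g l)"
  by (auto simp: u_alg_def Der_def vf_def restrict_def fun_eq_iff distrib_right sum.distrib)

lemma vf_zero: "lie_zero (u_alg n) = vf n (\<lambda>l. 0)"
  by (simp add: u_alg_def Der_def vf_def)

lemma vf_scale: "lie_scale (u_alg n) c (vf n f) = vf n (\<lambda>l. Const c * f l)"
  by (auto simp: u_alg_def Der_def vf_def restrict_def fun_eq_iff sum_distrib_left mult.assoc)

lemma vf_apply_polys:
  "(\<And>i. i \<in> {1..n} \<Longrightarrow> f i \<in> polys n) \<Longrightarrow> p \<in> polys n \<Longrightarrow> (\<Sum>i=1..n. f i * partial i p) \<in> polys n"
  by (intro polys_sum polys_mult polys_partial) auto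

text \<open>In the composition of two first-order operators the second-order part is symmetric in the
operators, so it cancels in a bracket.\<close>

lemma sum_partial_sum:
  fixes f g :: "nat \<Rightarrow> 'k::field_char_0 mpoly"
  shows "(\<Sum>i\<in>A. f i * partial i (\<Sum>j\<in>A. g j * partial j p)) =
     (\<Sum>j\<in>A. (\<Sum>i\<in>A. f i * partial i (g j)) * partial j p) +
     (\<Sum>i\<in>A. \<Sum>j\<in>A. f i * g j * partial i (partial j p))"
proof -
  have "(\<Sum>i\<in>A. f i * partial i (\<Sum>j\<in>A. g j * partial j p)) =
     (\<Sum>i\<in>A. \<Sum>j\<in>A. f i * partial i (g j) * partial j p + f i * g j * partial i (partial j p))"
    by (simp add: partial_sum partial_mult sum_distrib_left algebra_simps)
  also have "\<dots> = (\<Sum>i\<in>A. \<Sum>j\<in>A. f i * partial i (g j) * partial j p) +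
     (\<Sum>i\<in>A. \<Sum>j\<in>A. f i * g j * partial i (partial j p))"
    by (simp add: sum.distrib)
  also have "(\<Sum>i\<in>A. \<Sum>j\<in>A. f i * partial i (g j) * partial j p) =
     (\<Sum>j\<in>A. (\<Sum>i\<in>A. f i * partial i (g j)) * partial j p)"
    by (subst sum.swap) (simp add: sum_distrib_right)
  finally show ?thesis .
qed

lemma vf_bracket:
  fixes f g :: "nat \<Rightarrow> 'k::field_char_0 mpoly"
  assumes "\<And>i. i \<in> {1..n} \<Longrightarrow> f i \<in> polys n" "\<And>i. i \<in> {1..n} \<Longrightarrow> g i \<in> polys n"
  shows "lie_bracket (u_alg n) (vf n f) (vf n g) =
     vf n (\<lambda>l. \<Sum>i=1..n. f i * partial i (g l) - g i * partial i (f l))"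
proof
  fix p :: "'k mpoly"
  show "lie_bracket (u_alg n) (vf n f) (vf n g) p =
     vf n (\<lambda>l. \<Sum>i=1..n. f i * partial i (g l) - g i * partial i (f l)) p"
  proof (cases "p \<in> polys n")
    case True
    have "(\<Sum>i=1..n. \<Sum>j=1..n. f i * g j * partial i (partial j p)) =
      (\<Sum>i=1..n. \<Sum>j=1..n. g i * f j * partial i (partial j p))"
      by (subst sum.swap) (simp add: partial_commute mult.commute)
    then show ?thesis
      using True vf_apply_polys[OF assms(1) True] vf_apply_polys[OF assms(2) True]
      by (simp add: u_alg_def Der_def vf_def sum_partial_sum sum_subtractf left_diff_distrib)
  qed (simp add: u_alg_def Der_def vf_def)
qed

lemma polys_pred: "l \<in> {1..n} \<Longrightarrow> p \<in> polys (l - 1) \<Longrightarrow> p \<in> polys n"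
  by (rule polys_mono[of p "l - 1"]) auto

text \<open>The derivation with components \<open>f\<close>, truncated to its first \<open>l - 1\<close> terms. On polynomials in
\<open>x\<^sub>1, \<dots>, x\<^sub>l\<^sub>-\<^sub>1\<close> the other terms vanish, so this is what brackets do to the \<open>l\<close>-th component.\<close>

definition act :: "nat \<Rightarrow> (nat \<Rightarrow> 'k::field_char_0 mpoly) \<Rightarrow> 'k oper" where
  "act l f p = (\<Sum>i=1..<l. f i * partial i p)"

lemma sum_partial_eq_act:
  assumes "p \<in> polys (l - 1)" "l \<in> {1..n}"
  shows "(\<Sum>i=1..n. f i * partial i p) = act l f p"
  unfolding act_def using assms
  by (intro sum.mono_neutral_right) (auto simp: partial_polys_eq_0[OF assms(1)])

lemma act_polys:
  assumes "\<And>i. i \<in> {1..<l} \<Longrightarrow> f i \<in> polys (i - 1)" "p \<in> polys (l - 1)"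
  shows "act l f p \<in> polys (l - 1)"
  unfolding act_def
proof (intro polys_sum polys_mult polys_partial)
  fix i assume "i \<in> {1..<l}"
  then show "f i \<in> polys (l - 1)"
    using assms(1)[of i] by (auto intro: polys_mono)
qed (use assms in auto)

lemma bracket_eq_vf:
  assumes D: "D \<in> u_set n" and E: "E \<in> u_set n"
  shows "lie_bracket (u_alg n) D E =
    vf n (\<lambda>l. act l (component D) (component E l) - act l (component E) (component D l))"
proof -
  have "lie_bracket (u_alg n) D E = lie_bracket (u_alg n) (vf n (component D)) (vf n (component E))"
    by (simp only: vf_comp D E)
  also have "\<dots> = vf n (\<lambda>l. \<Sum>i=1..n. component D i * partial i (component E l) - component E i * partial i (component D l))"
    using D E comp_polys polys_pred by (intro vf_bracket) blast+
  also have "\<dots> = vf n (\<lambda>l. act l (component D) (component E l) - act l (component E) (component D l))"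
  proof (rule vf_cong)
    fix l assume l: "l \<in> {1..n}"
    show "(\<Sum>i=1..n. component D i * partial i (component E l) - component E i * partial i (component D l)) =
      act l (component D) (component E l) - act l (component E) (component D l)"
      unfolding sum_subtractf
      by (simp only: sum_partial_eq_act[OF comp_polys[OF D l] l] sum_partial_eq_act[OF comp_polys[OF E l] l])
  qed
  finally show ?thesis .
qed

lemma comp_bracket:
  assumes "D \<in> u_set n" "E \<in> u_set n" "l \<in> {1..n}"
  shows "component (lie_bracket (u_alg n) D E) l = act l (component D) (component E l) - act l (component E) (component D l)"
  using assms by (simp add: bracket_eq_vf comp_vf)

lemma comp_add:
  assumes "D \<in> u_set n" "E \<in> u_set n" "l \<in> {1..n}"
  shows "component (lie_add (u_alg n) D E) l = component D l + component E l"
  using vf_add[of n "component D" "component E"] assms by (simp add: vf_comp comp_vf)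

lemma comp_scale:
  assumes "D \<in> u_set n" "l \<in> {1..n}"
  shows "component (lie_scale (u_alg n) c D) l = Const c * component D l"
  using vf_scale[of n c "component D"] assms by (simp add: vf_comp comp_vf)

lemma comp_zero: "l \<in> {1..n} \<Longrightarrow> component (lie_zero (u_alg n)) l = 0"
  by (simp add: vf_zero comp_vf)

lemma u_zero: "lie_zero (u_alg n) \<in> u_set n"
  unfolding vf_zero by (rule vf_mem) simp

lemma u_add: "D \<in> u_set n \<Longrightarrow> E \<in> u_set n \<Longrightarrow> lie_add (u_alg n) D E \<in> u_set n"
  using vf_add[of n "component D" "component E"]
  by (simp add: vf_comp) (auto intro!: vf_mem comp_polys polys_add)

lemma u_scale: "D \<in> u_set n \<Longrightarrow> lie_scale (u_alg n) c D \<in> u_set n"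
  using vf_scale[of n c "component D"]
  by (simp add: vf_comp) (auto intro!: vf_mem comp_polys polys_mult polys_Const)

lemma u_bracket: 
  assumes D: "D \<in> u_set n" and E: "E \<in> u_set n"
  shows "lie_bracket (u_alg n) D E \<in> u_set n"
  unfolding bracket_eq_vf[OF assms]
proof (intro vf_mem polys_minus act_polys)
  fix i l assume "l \<in> {1..n}" "i \<in> {1..<l}"
  then have "i \<in> {1..n}" by auto
  then show "component D i \<in> polys (i - 1)" "component E i \<in> polys (i - 1)"
    by (rule comp_polys[OF D] comp_polys[OF E])+
qed (rule comp_polys[OF D] comp_polys[OF E], assumption)+

lemma act_add: "act l f (p + q) = act l f p + act l f q"
  and act_add_fun: "act l (\<lambda>i. f i + g i) p = act l f p + act l g p"
  and act_zero [simp]: "act l f 0 = 0"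
  and act_minus: "act l f (p - q) = act l f p - act l f q"
  by (simp_all add: act_def partial_add partial_minus algebra_simps sum.distrib sum_subtractf)

lemma act_Const [simp]: "act l f (Const c) = 0"
  by (simp add: act_def)

lemma act_cong: "(\<And>i. i \<in> {1..<l} \<Longrightarrow> f i = g i) \<Longrightarrow> act l f p = act l g p"
  by (simp add: act_def)

lemma act_single_term:
  assumes "\<And>i. i \<in> {1..<l} \<Longrightarrow> i \<noteq> k \<Longrightarrow> f i * partial i p = 0" "k \<in> {1..<l}"
  shows "act l f p = f k * partial k p"
proof -
  have "act l f p = (\<Sum>i\<in>{k}. f i * partial i p)"
    unfolding act_def using assms by (intro sum.mono_neutral_right) auto
  then show ?thesis by simp
qed

lemma act_eq_0: "(\<And>i. i \<in> {1..<l} \<Longrightarrow> f i = 0) \<Longrightarrow> act l f p = 0"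
  by (simp add: act_def)

definition vf_single :: "nat \<Rightarrow> 'k::field_char_0 mpoly \<Rightarrow> nat \<Rightarrow> 'k oper" where
  "vf_single n g k = vf n (\<lambda>l. if l = k then g else 0)"

lemma vf_single_mem: "g \<in> polys (k - 1) \<Longrightarrow> vf_single n g k \<in> u_set n"
  unfolding vf_single_def by (rule vf_mem) auto

lemma comp_vf_single: "l \<in> {1..n} \<Longrightarrow> component (vf_single n g k) l = (if l = k then g else 0)"
  by (simp add: vf_single_def comp_vf)

lemma act_vf_single: 
  assumes "l \<le> n" "k \<ge> 1"
  shows "act l (component (vf_single n g k)) p = (if k < l then g * partial k p else 0)"
proof (cases "k < l")
  case True
  then show ?thesis
    using assms by (subst act_single_term[of l k]) (auto simp: comp_vf_single)
next
  case False
  then show ?thesis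
    using assms by (auto intro!: act_eq_0 simp: comp_vf_single)
qed

text \<open>Bracketing with \<open>g \<partial>\<^sub>k\<close> differentiates the components beyond \<open>k\<close>, and in component \<open>k\<close> it lets
\<open>D\<close> act on \<open>g\<close>.\<close>

lemma comp_bracket_vf_single:
  assumes "g \<in> polys (k - 1)" "D \<in> u_set n" "l \<in> {1..n}" "k \<in> {1..n}"
  shows "component (lie_bracket (u_alg n) (vf_single n g k) D) l =
    (if k < l then g * partial k (component D l) else 0) - (if l = k then act k (component D) g else 0)"
  using assms by (auto simp: comp_bracket vf_single_mem act_vf_single comp_vf_single)

section \<open>Isomorphic quotients as correspondences\<close>

text \<open>The laws of a Lie algebra on which computations with cosets rest.\<close>

locale lie_alg =
  fixes L :: "('k::comm_ring_1, 'a) lie_struct"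
  assumes zero_closed: "lie_zero L \<in> lie_carrier L"
    and add_closed: "x \<in> lie_carrier L \<Longrightarrow> y \<in> lie_carrier L \<Longrightarrow> lie_add L x y \<in> lie_carrier L"
    and scale_closed: "x \<in> lie_carrier L \<Longrightarrow> lie_scale L c x \<in> lie_carrier L"
    and bracket_closed: "x \<in> lie_carrier L \<Longrightarrow> y \<in> lie_carrier L \<Longrightarrow> lie_bracket L x y \<in> lie_carrier L"
    and add_assoc: "x \<in> lie_carrier L \<Longrightarrow> y \<in> lie_carrier L \<Longrightarrow> z \<in> lie_carrier L \<Longrightarrow>
      lie_add L (lie_add L x y) z = lie_add L x (lie_add L y z)"
    and add_comm: "x \<in> lie_carrier L \<Longrightarrow> y \<in> lie_carrier L \<Longrightarrow> lie_add L x y = lie_add L y x"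
    and add_zero: "x \<in> lie_carrier L \<Longrightarrow> lie_add L x (lie_zero L) = x"
    and add_neg: "x \<in> lie_carrier L \<Longrightarrow> lie_add L x (lie_scale L (-1) x) = lie_zero L"
    and scale_0: "x \<in> lie_carrier L \<Longrightarrow> lie_scale L 0 x = lie_zero L"
    and scale_add: "x \<in> lie_carrier L \<Longrightarrow> y \<in> lie_carrier L \<Longrightarrow>
      lie_scale L c (lie_add L x y) = lie_add L (lie_scale L c x) (lie_scale L c y)"
    and bracket_add_left: "x \<in> lie_carrier L \<Longrightarrow> y \<in> lie_carrier L \<Longrightarrow> z \<in> lie_carrier L \<Longrightarrow>
      lie_bracket L (lie_add L x y) z = lie_add L (lie_bracket L x z) (lie_bracket L y z)"
    and bracket_add_right: "x \<in> lie_carrier L \<Longrightarrow> y \<in> lie_carrier L \<Longrightarrow> z \<in> lie_carrier L \<Longrightarrow>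
      lie_bracket L z (lie_add L x y) = lie_add L (lie_bracket L z x) (lie_bracket L z y)"
    and bracket_antisym: "x \<in> lie_carrier L \<Longrightarrow> y \<in> lie_carrier L \<Longrightarrow>
      lie_bracket L x y = lie_scale L (-1) (lie_bracket L y x)"
begin

definition sub :: "'a \<Rightarrow> 'a \<Rightarrow> 'a" where
  "sub x y = lie_add L x (lie_scale L (-1) y)"

lemma sub_closed: "x \<in> lie_carrier L \<Longrightarrow> y \<in> lie_carrier L \<Longrightarrow> sub x y \<in> lie_carrier L"
  by (simp add: sub_def add_closed scale_closed)

lemma sub_self: "x \<in> lie_carrier L \<Longrightarrow> sub x x = lie_zero L"
  by (simp add: sub_def add_neg)

lemma sub_zero: "x \<in> lie_carrier L \<Longrightarrow> sub x (lie_zero L) = x"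
  using add_neg[OF zero_closed] add_comm[OF zero_closed scale_closed[OF zero_closed, of "-1"]]
    add_zero[OF scale_closed[OF zero_closed, of "-1"]]
  by (simp add: sub_def add_zero)

lemma add_sub_cancel:
  assumes "x \<in> lie_carrier L" "y \<in> lie_carrier L"
  shows "lie_add L y (sub x y) = x"
proof -
  have "lie_add L y (sub x y) = lie_add L (sub x y) y"
    using assms by (intro add_comm sub_closed)
  also have "\<dots> = lie_add L x (lie_add L (lie_scale L (-1) y) y)"
    unfolding sub_def using assms by (intro add_assoc scale_closed)
  also have "lie_add L (lie_scale L (-1) y) y = lie_zero L"
    using assms add_neg add_comm scale_closed by metis
  finally show ?thesis
    using assms by (simp add: add_zero)
qed

lemma sub_add_cancel:
  assumes "x \<in> lie_carrier L" "y \<in> lie_carrier L"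
  shows "sub (lie_add L y x) y = x"
proof -
  have "sub (lie_add L y x) y = lie_add L (lie_add L x y) (lie_scale L (-1) y)"
    using assms add_comm[of y x] by (simp add: sub_def)
  also have "\<dots> = lie_add L x (lie_add L y (lie_scale L (-1) y))"
    using assms by (intro add_assoc scale_closed)
  finally show ?thesis
    using assms by (simp add: add_zero add_neg)
qed

lemma add_add_swap:
  assumes "a \<in> lie_carrier L" "b \<in> lie_carrier L" "c \<in> lie_carrier L" "d \<in> lie_carrier L"
  shows "lie_add L (lie_add L a b) (lie_add L c d) = lie_add L (lie_add L a c) (lie_add L b d)"
proof -
  have "lie_add L (lie_add L a b) (lie_add L c d) = lie_add L a (lie_add L b (lie_add L c d))"
    using assms by (simp add: add_assoc add_closed)
  also have "lie_add L b (lie_add L c d) = lie_add L c (lie_add L b d)"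
    using assms add_assoc[of b c d] add_assoc[of c b d] add_comm[of b c] by simp
  finally show ?thesis
    using assms by (simp add: add_assoc add_closed)
qed

end

lemma lie_alg_u: "lie_alg (u_alg n)"
proof
  fix x y z :: "'k::field_char_0 oper" and c :: 'k
  show "lie_zero (u_alg n) \<in> (u_set n :: 'k oper set)"
    by (rule u_zero)
  assume x: "x \<in> u_set n"
  show "lie_scale (u_alg n) c x \<in> u_set n"
    using x by (rule u_scale)
  show "lie_add (u_alg n) x (lie_zero (u_alg n)) = x"
    using x by (intro u_eqI[of _ n]) (simp_all add: u_add u_zero u_scale u_bracket comp_add comp_zero comp_scale comp_bracket)
  show "lie_add (u_alg n) x (lie_scale (u_alg n) (- 1) x) = lie_zero (u_alg n)"
    using x
    by (intro u_eqI[of _ n]) (simp_all add: u_add u_zero u_scale u_bracket comp_add comp_zero comp_scale comp_bracket Const_minus_1)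
  show "lie_scale (u_alg n) 0 x = lie_zero (u_alg n)"
    using x by (intro u_eqI[of _ n]) (simp_all add: u_add u_zero u_scale u_bracket comp_add comp_zero comp_scale comp_bracket)
  assume y: "y \<in> u_set n"
  show "lie_add (u_alg n) x y \<in> u_set n" "lie_bracket (u_alg n) x y \<in> u_set n"
    using x y by (rule u_add u_bracket)+
  show "lie_add (u_alg n) x y = lie_add (u_alg n) y x"
    using x y by (intro u_eqI[of _ n]) (simp_all add: u_add u_zero u_scale u_bracket comp_add comp_zero comp_scale comp_bracket add.commute)
  show "lie_scale (u_alg n) c (lie_add (u_alg n) x y) =
      lie_add (u_alg n) (lie_scale (u_alg n) c x) (lie_scale (u_alg n) c y)"
    using x y by (intro u_eqI[of _ n]) (simp_all add: u_add u_zero u_scale u_bracket comp_add comp_zero comp_scale comp_bracket distrib_left)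
  show "lie_bracket (u_alg n) x y = lie_scale (u_alg n) (- 1) (lie_bracket (u_alg n) y x)"
    using x y by (intro u_eqI[of _ n]) (simp_all add: u_add u_zero u_scale u_bracket comp_add comp_zero comp_scale comp_bracket Const_minus_1)
  assume z: "z \<in> u_set n"
  show "lie_add (u_alg n) (lie_add (u_alg n) x y) z = lie_add (u_alg n) x (lie_add (u_alg n) y z)"
    using x y z by (intro u_eqI[of _ n]) (simp_all add: u_add u_zero u_scale u_bracket comp_add comp_zero comp_scale comp_bracket add.assoc)
  have act: "act l (component (lie_add (u_alg n) x y)) p = act l (component x) p + act l (component y) p"
    if "l \<in> {1..n}" for l p
    using x y that by (subst act_add_fun[symmetric], intro act_cong) (simp add: comp_add)
  show "lie_bracket (u_alg n) (lie_add (u_alg n) x y) z =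
      lie_add (u_alg n) (lie_bracket (u_alg n) x z) (lie_bracket (u_alg n) y z)"
    using x y z by (intro u_eqI[of _ n]) (simp_all add: u_add u_zero u_scale u_bracket comp_add comp_zero comp_scale comp_bracket act act_add)
  show "lie_bracket (u_alg n) z (lie_add (u_alg n) x y) =
      lie_add (u_alg n) (lie_bracket (u_alg n) z x) (lie_bracket (u_alg n) z y)"
    using x y z by (intro u_eqI[of _ n]) (simp_all add: u_add u_zero u_scale u_bracket comp_add comp_zero comp_scale comp_bracket act act_add)
qed

locale lie_alg_ideal = lie_alg L for L :: "('k::comm_ring_1, 'a) lie_struct" +
  fixes I :: "'a set"
  assumes ideal: "lie_ideal L I"
begin

lemma ideal_carrier: "x \<in> I \<Longrightarrow> x \<in> lie_carrier L"
  and ideal_zero: "lie_zero L \<in> I"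
  and ideal_add: "x \<in> I \<Longrightarrow> y \<in> I \<Longrightarrow> lie_add L x y \<in> I"
  and ideal_scale: "x \<in> I \<Longrightarrow> lie_scale L c x \<in> I"
  and ideal_bracket: "x \<in> lie_carrier L \<Longrightarrow> y \<in> I \<Longrightarrow> lie_bracket L x y \<in> I"
  using ideal by (auto simp: lie_ideal_def)

lemma ideal_bracket': "x \<in> I \<Longrightarrow> y \<in> lie_carrier L \<Longrightarrow> lie_bracket L x y \<in> I"
  by (subst bracket_antisym) (auto intro: ideal_scale ideal_bracket ideal_carrier)

lemma ideal_sub: "x \<in> I \<Longrightarrow> y \<in> I \<Longrightarrow> sub x y \<in> I"
  by (simp add: sub_def ideal_add ideal_scale)

abbreviation coset :: "'a \<Rightarrow> 'a set" where
  "coset \<equiv> lie_coset L I"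

text \<open>Well-definedness of all quotient operations reduces to this equation.\<close>

lemma coset_add_ideal:
  assumes x: "x \<in> lie_carrier L" and y: "y \<in> I"
  shows "coset (lie_add L x y) = coset x"
proof (intro set_eqI iffI)
  fix z assume "z \<in> coset (lie_add L x y)"
  then obtain w where "w \<in> I" "z = lie_add L (lie_add L x y) w"
    by (auto simp: lie_coset_def)
  then have "z = lie_add L x (lie_add L y w)" "lie_add L y w \<in> I"
    using x y ideal_carrier ideal_add add_assoc by auto
  then show "z \<in> coset x"
    by (auto simp: lie_coset_def)
next
  fix z assume "z \<in> coset x"
  then obtain w where w: "w \<in> I" "z = lie_add L x w"
    by (auto simp: lie_coset_def)
  then have "z = lie_add L x (lie_add L y (sub w y))"
    using y by (simp add: add_sub_cancel ideal_carrier)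
  then have "z = lie_add L (lie_add L x y) (sub w y)"
    using x y w by (simp add: add_assoc ideal_carrier ideal_sub)
  then show "z \<in> coset (lie_add L x y)"
    using w y ideal_sub by (auto simp: lie_coset_def)
qed

lemma mem_coset_self: "x \<in> lie_carrier L \<Longrightarrow> x \<in> coset x"
  using add_zero[of x] ideal_zero by (force simp: lie_coset_def)

lemma coset_carrier: "x \<in> lie_carrier L \<Longrightarrow> a \<in> coset x \<Longrightarrow> a \<in> lie_carrier L"
  using ideal_carrier add_closed by (auto simp: lie_coset_def)

lemma mem_cosetE:
  assumes "a \<in> coset x"
  obtains z where "z \<in> I" "a = lie_add L x z"
  using assms by (auto simp: lie_coset_def)

lemma coset_eq: "x \<in> lie_carrier L \<Longrightarrow> a \<in> coset x \<Longrightarrow> coset a = coset x"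
  using coset_add_ideal by (metis mem_cosetE)

lemma coset_nonempty: "x \<in> lie_carrier L \<Longrightarrow> coset x \<noteq> {}"
  using mem_coset_self by blast

lemma coset_eq_iff:
  assumes "x \<in> lie_carrier L" "y \<in> lie_carrier L"
  shows "coset x = coset y \<longleftrightarrow> sub x y \<in> I"
proof
  assume "coset x = coset y"
  then have "x \<in> coset y"
    using mem_coset_self assms by blast
  then obtain z where "z \<in> I" "x = lie_add L y z"
    by (auto simp: lie_coset_def)
  then show "sub x y \<in> I"
    using assms by (simp add: sub_add_cancel ideal_carrier)
next
  assume "sub x y \<in> I"
  then show "coset x = coset y"
    using coset_add_ideal[of y "sub x y"] assms by (simp add: add_sub_cancel)
qed

lemma coset_zero: "coset (lie_zero L) = I"
proof -
  have "lie_add L (lie_zero L) y = y" if "y \<in> I" for y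
    using that add_comm[of y "lie_zero L"] add_zero[of y] ideal_carrier zero_closed by simp
  then show ?thesis
    by (force simp: lie_coset_def)
qed

lemma quotient_carrier: "lie_carrier (lie_quotient L I) = coset ` lie_carrier L"
  by (simp add: lie_quotient_def)

lemma quotient_add:
  assumes "x \<in> lie_carrier L" "y \<in> lie_carrier L"
  shows "lie_add (lie_quotient L I) (coset x) (coset y) = coset (lie_add L x y)"
proof -
  have "coset (lie_add L a b) = coset (lie_add L x y)" if ab: "a \<in> coset x" "b \<in> coset y" for a b
  proof -
    obtain z w where "z \<in> I" "w \<in> I" "a = lie_add L x z" "b = lie_add L y w"
      using ab by (auto simp: lie_coset_def)
    then show ?thesis
      using assms by (simp add: add_add_swap ideal_carrier coset_add_ideal add_closed ideal_add)
  qed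
  then show ?thesis
    using assms by (simp add: lie_quotient_def coset_nonempty)
qed

lemma quotient_scale:
  assumes "x \<in> lie_carrier L"
  shows "lie_scale (lie_quotient L I) c (coset x) = coset (lie_scale L c x)"
proof -
  have "coset (lie_scale L c a) = coset (lie_scale L c x)" if a: "a \<in> coset x" for a
  proof -
    obtain z where "z \<in> I" "a = lie_add L x z"
      using a by (auto simp: lie_coset_def)
    then show ?thesis
      using assms by (simp add: scale_add ideal_carrier coset_add_ideal scale_closed ideal_scale)
  qed
  then show ?thesis
    using assms by (simp add: lie_quotient_def coset_nonempty)
qed

lemma quotient_bracket:
  assumes "x \<in> lie_carrier L" "y \<in> lie_carrier L"
  shows "lie_bracket (lie_quotient L I) (coset x) (coset y) = coset (lie_bracket L x y)"
proof -
  have "coset (lie_bracket L a b) = coset (lie_bracket L x y)"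
    if ab: "a \<in> coset x" "b \<in> coset y" for a b
  proof -
    obtain z w where zw: "z \<in> I" "w \<in> I" "a = lie_add L x z" "b = lie_add L y w"
      using ab by (auto simp: lie_coset_def)
    have "lie_bracket L a b = lie_add L (lie_bracket L x b) (lie_bracket L z b)"
      unfolding zw(3) using zw assms
      by (intro bracket_add_left) (auto intro: ideal_carrier add_closed)
    moreover have "lie_bracket L x b = lie_add L (lie_bracket L x y) (lie_bracket L x w)"
      unfolding zw(4) using zw assms by (intro bracket_add_right) (auto intro: ideal_carrier)
    moreover have "lie_bracket L z b \<in> I" "lie_bracket L x w \<in> I"
      using ab zw assms coset_carrier by (auto intro: ideal_bracket ideal_bracket')
    ultimately show ?thesis
      using assms by (simp add: coset_add_ideal bracket_closed add_closed ideal_carrier)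
  qed
  then show ?thesis
    using assms by (simp add: lie_quotient_def coset_nonempty)
qed

end

text \<open>By Goursat's lemma, isomorphisms \<open>L/I \<cong> M/J\<close> correspond to subalgebras of \<open>L \<times> M\<close> that project
onto both factors and whose intersections with the factors are \<open>I\<close> and \<open>J\<close>. Such a relation carries
ideals, derived algebras and centralizers from \<open>L\<close> to \<open>M\<close> without any choice of representatives, and
it is symmetric in the two sides.\<close>

definition lie_corr :: "('k, 'a) lie_struct \<Rightarrow> 'a set \<Rightarrow> ('k, 'b) lie_struct \<Rightarrow> 'b set \<Rightarrow> ('a \<times> 'b) set \<Rightarrow> bool"
  where "lie_corr L I M J \<rho> \<longleftrightarrow>
    \<rho> \<subseteq> lie_carrier L \<times> lie_carrier M \<and>
    (\<forall>x\<in>lie_carrier L. \<exists>y. (x, y) \<in> \<rho>) \<and> (\<forall>y\<in>lie_carrier M. \<exists>x. (x, y) \<in> \<rho>) \<and>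
    (\<forall>(x, y)\<in>\<rho>. \<forall>(x', y')\<in>\<rho>. (lie_add L x x', lie_add M y y') \<in> \<rho>) \<and>
    (\<forall>c. \<forall>(x, y)\<in>\<rho>. (lie_scale L c x, lie_scale M c y) \<in> \<rho>) \<and>
    (\<forall>(x, y)\<in>\<rho>. \<forall>(x', y')\<in>\<rho>. (lie_bracket L x x', lie_bracket M y y') \<in> \<rho>) \<and>
    (\<forall>x\<in>lie_carrier L. (x, lie_zero M) \<in> \<rho> \<longleftrightarrow> x \<in> I) \<and>
    (\<forall>y\<in>lie_carrier M. (lie_zero L, y) \<in> \<rho> \<longleftrightarrow> y \<in> J)"

lemma lie_corrI:
  assumes "\<And>x y. (x, y) \<in> \<rho> \<Longrightarrow> x \<in> lie_carrier L \<and> y \<in> lie_carrier M"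
    and "\<And>x. x \<in> lie_carrier L \<Longrightarrow> \<exists>y. (x, y) \<in> \<rho>"
    and "\<And>y. y \<in> lie_carrier M \<Longrightarrow> \<exists>x. (x, y) \<in> \<rho>"
    and "\<And>x y x' y'. (x, y) \<in> \<rho> \<Longrightarrow> (x', y') \<in> \<rho> \<Longrightarrow> (lie_add L x x', lie_add M y y') \<in> \<rho>"
    and "\<And>c x y. (x, y) \<in> \<rho> \<Longrightarrow> (lie_scale L c x, lie_scale M c y) \<in> \<rho>"
    and "\<And>x y x' y'. (x, y) \<in> \<rho> \<Longrightarrow> (x', y') \<in> \<rho> \<Longrightarrow> (lie_bracket L x x', lie_bracket M y y') \<in> \<rho>"
    and "\<And>x. x \<in> lie_carrier L \<Longrightarrow> (x, lie_zero M) \<in> \<rho> \<longleftrightarrow> x \<in> I"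
    and "\<And>y. y \<in> lie_carrier M \<Longrightarrow> (lie_zero L, y) \<in> \<rho> \<longleftrightarrow> y \<in> J"
  shows "lie_corr L I M J \<rho>"
  unfolding lie_corr_def using assms by (intro conjI ballI allI) auto

lemma lie_corr_converse: "lie_corr L I M J \<rho> \<Longrightarrow> lie_corr M J L I (\<rho>\<inverse>)"
  unfolding lie_corr_def by blast

locale lie_correspondence = L: lie_alg_ideal L I + M: lie_alg_ideal M J
  for L :: "('k::comm_ring_1, 'a) lie_struct" and I
    and M :: "('k::comm_ring_1, 'b) lie_struct" and J +
  fixes \<rho>
  assumes corr: "lie_corr L I M J \<rho>"
begin

lemma corr_carrier: "(x, y) \<in> \<rho> \<Longrightarrow> x \<in> lie_carrier L" "(x, y) \<in> \<rho> \<Longrightarrow> y \<in> lie_carrier M"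
  and corr_left: "x \<in> lie_carrier L \<Longrightarrow> \<exists>y. (x, y) \<in> \<rho>"
  and corr_right: "y \<in> lie_carrier M \<Longrightarrow> \<exists>x. (x, y) \<in> \<rho>"
  and corr_add: "(x, y) \<in> \<rho> \<Longrightarrow> (x', y') \<in> \<rho> \<Longrightarrow> (lie_add L x x', lie_add M y y') \<in> \<rho>"
  and corr_scale: "(x, y) \<in> \<rho> \<Longrightarrow> (lie_scale L c x, lie_scale M c y) \<in> \<rho>"
  and corr_bracket: "(x, y) \<in> \<rho> \<Longrightarrow> (x', y') \<in> \<rho> \<Longrightarrow> (lie_bracket L x x', lie_bracket M y y') \<in> \<rho>"
  and corr_zero_right: "x \<in> I \<Longrightarrow> (x, lie_zero M) \<in> \<rho>"
  and corr_zero_left: "(lie_zero L, y) \<in> \<rho> \<Longrightarrow> y \<in> J"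
  using corr L.ideal_carrier M.ideal_carrier unfolding lie_corr_def by blast+

lemma corr_sub: "(x, y) \<in> \<rho> \<Longrightarrow> (x', y') \<in> \<rho> \<Longrightarrow> (L.sub x x', M.sub y y') \<in> \<rho>"
  unfolding L.sub_def M.sub_def by (intro corr_add corr_scale)

lemma converse: "lie_correspondence M J L I (\<rho>\<inverse>)"
  by unfold_locales (rule lie_corr_converse[OF corr])

lemma corr_ideal_imp: 
  assumes "(x, y) \<in> \<rho>" "x \<in> I"
  shows "y \<in> J"
  using corr_sub[OF assms(1) corr_zero_right[OF assms(2)]] corr_carrier[OF assms(1)]
  by (simp add: L.sub_self M.sub_zero corr_zero_left)

lemma corr_ideal_iff: 
  assumes "(x, y) \<in> \<rho>"
  shows "x \<in> I \<longleftrightarrow> y \<in> J"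
  using corr_ideal_imp lie_correspondence.corr_ideal_imp[OF converse] assms by blast

lemma corr_coset_iff:
  assumes "(x, y) \<in> \<rho>" "(x', y') \<in> \<rho>"
  shows "L.coset x = L.coset x' \<longleftrightarrow> M.coset y = M.coset y'"
  using assms corr_carrier corr_ideal_iff[OF corr_sub[OF assms]]
  by (simp add: L.coset_eq_iff M.coset_eq_iff)

text \<open>The relation sends a coset of \<open>I\<close> to a single coset of \<open>J\<close>, and conversely.\<close>

lemma quotients_isomorphic: "lie_isomorphic (lie_quotient L I) (lie_quotient M J)"
proof -
  define \<phi> where "\<phi> A = M.coset (SOME y. \<exists>x\<in>A. (x, y) \<in> \<rho>)" for A
  have \<phi>: "\<phi> (L.coset x) = M.coset y" if "(x, y) \<in> \<rho>" for x y
  proof -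
    have "\<exists>y. \<exists>x'\<in>L.coset x. (x', y) \<in> \<rho>"
      using that L.mem_coset_self corr_carrier by blast
    from someI_ex[OF this] obtain x' where x': "x' \<in> L.coset x"
      "(x', SOME y. \<exists>x'\<in>L.coset x. (x', y) \<in> \<rho>) \<in> \<rho>" by blast
    then show ?thesis
      using corr_coset_iff[OF x'(2) that] L.coset_eq[OF corr_carrier(1)[OF that] x'(1)]
      by (simp add: \<phi>_def)
  qed
  show ?thesis
    unfolding lie_isomorphic_def L.quotient_carrier M.quotient_carrier
  proof (intro exI[of _ \<phi>] conjI ballI allI)
    show "bij_betw \<phi> (L.coset ` lie_carrier L) (M.coset ` lie_carrier M)"
      unfolding bij_betw_def
    proof
      show "inj_on \<phi> (L.coset ` lie_carrier L)"
      proof (rule inj_onI)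
        fix A B assume "A \<in> L.coset ` lie_carrier L" "B \<in> L.coset ` lie_carrier L" "\<phi> A = \<phi> B"
        then obtain x x' y y' where "A = L.coset x" "B = L.coset x'" "(x, y) \<in> \<rho>" "(x', y') \<in> \<rho>"
          using corr_left by blast
        then show "A = B"
          using \<phi> corr_coset_iff \<open>\<phi> A = \<phi> B\<close> by simp
      qed
      show "\<phi> ` L.coset ` lie_carrier L = M.coset ` lie_carrier M"
      proof (intro set_eqI iffI)
        fix B assume "B \<in> \<phi> ` L.coset ` lie_carrier L"
        then show "B \<in> M.coset ` lie_carrier M"
          using \<phi> corr_left corr_carrier by blast
      next
        fix B assume "B \<in> M.coset ` lie_carrier M"
        then obtain y where y: "y \<in> lie_carrier M" "B = M.coset y" by blast
        obtain x where "(x, y) \<in> \<rho>" using corr_right[OF y(1)] by blast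
        then show "B \<in> \<phi> ` L.coset ` lie_carrier L"
          using \<phi> y corr_carrier by blast
      qed
    qed
  next
    fix A B assume "A \<in> L.coset ` lie_carrier L" "B \<in> L.coset ` lie_carrier L"
    then obtain x x' y y' where "A = L.coset x" "B = L.coset x'" "(x, y) \<in> \<rho>" "(x', y') \<in> \<rho>"
      using corr_left by blast
    then show "\<phi> (lie_add (lie_quotient L I) A B) = lie_add (lie_quotient M J) (\<phi> A) (\<phi> B)"
      "\<phi> (lie_bracket (lie_quotient L I) A B) = lie_bracket (lie_quotient M J) (\<phi> A) (\<phi> B)"
      using corr_carrier \<phi> corr_add corr_bracket
      by (simp_all add: L.quotient_add M.quotient_add L.quotient_bracket M.quotient_bracket)
  next
    fix c A assume "A \<in> L.coset ` lie_carrier L"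
    then obtain x y where "A = L.coset x" "(x, y) \<in> \<rho>"
      using corr_left by blast
    then show "\<phi> (lie_scale (lie_quotient L I) c A) = lie_scale (lie_quotient M J) c (\<phi> A)"
      using corr_carrier \<phi> corr_scale by (simp add: L.quotient_scale M.quotient_scale)
  qed
qed

end

text \<open>The relation consists of the pairs of elements whose cosets correspond to each other.\<close>

lemma quotients_isomorphic_imp_corr:
  assumes "lie_alg_ideal L I" "lie_alg_ideal M J"
    and "lie_isomorphic (lie_quotient L I) (lie_quotient M J)"
  shows "\<exists>\<rho>. lie_corr L I M J \<rho>"
proof -
  interpret L: lie_alg_ideal L I by fact
  interpret M: lie_alg_ideal M J by fact
  obtain \<phi> where bij: "bij_betw \<phi> (L.coset ` lie_carrier L) (M.coset ` lie_carrier M)"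
    and add: "\<And>A B. A \<in> L.coset ` lie_carrier L \<Longrightarrow> B \<in> L.coset ` lie_carrier L \<Longrightarrow>
      \<phi> (lie_add (lie_quotient L I) A B) = lie_add (lie_quotient M J) (\<phi> A) (\<phi> B)"
    and scale: "\<And>c A. A \<in> L.coset ` lie_carrier L \<Longrightarrow>
      \<phi> (lie_scale (lie_quotient L I) c A) = lie_scale (lie_quotient M J) c (\<phi> A)"
    and bracket: "\<And>A B. A \<in> L.coset ` lie_carrier L \<Longrightarrow> B \<in> L.coset ` lie_carrier L \<Longrightarrow>
      \<phi> (lie_bracket (lie_quotient L I) A B) = lie_bracket (lie_quotient M J) (\<phi> A) (\<phi> B)"
    using assms(3) unfolding lie_isomorphic_def L.quotient_carrier M.quotient_carrier by blast
  define \<rho> where "\<rho> = {(x, y). x \<in> lie_carrier L \<and> y \<in> lie_carrier M \<and> \<phi> (L.coset x) = M.coset y}"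
  have left: "\<exists>y. (x, y) \<in> \<rho>" if "x \<in> lie_carrier L" for x
    using bij that unfolding \<rho>_def bij_betw_def by blast
  have right: "\<exists>x. (x, y) \<in> \<rho>" if "y \<in> lie_carrier M" for y
  proof -
    have "M.coset y \<in> \<phi> ` L.coset ` lie_carrier L"
      using bij that unfolding bij_betw_def by blast
    then obtain x where "x \<in> lie_carrier L" "\<phi> (L.coset x) = M.coset y" by force
    then show ?thesis using that unfolding \<rho>_def by blast
  qed
  have zero: "\<phi> I = J"
  proof -
    obtain y where y: "(lie_zero L, y) \<in> \<rho>"
      using left L.zero_closed by blast
    \<comment> \<open>Compatibility with scaling by \<open>0\<close> forces the zero coset to be mapped to the zero coset.\<close>
    have "\<phi> (lie_scale (lie_quotient L I) 0 (L.coset (lie_zero L))) = M.coset (lie_zero M)"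
      using y scale L.zero_closed by (simp add: \<rho>_def M.quotient_scale M.scale_0)
    then show ?thesis
      using L.quotient_scale[OF L.zero_closed, of 0] L.zero_closed
      by (simp add: L.scale_0 L.coset_zero M.coset_zero)
  qed
  have inj: "L.coset x = L.coset x'"
    if "x \<in> lie_carrier L" "x' \<in> lie_carrier L" "\<phi> (L.coset x) = \<phi> (L.coset x')" for x x'
    using that bij by (auto simp: bij_betw_def inj_on_def)
  have 1: "(x, lie_zero M) \<in> \<rho> \<longleftrightarrow> x \<in> I" if "x \<in> lie_carrier L" for x
  proof -
    have "(x, lie_zero M) \<in> \<rho> \<longleftrightarrow> \<phi> (L.coset x) = \<phi> (L.coset (lie_zero L))"
      using that M.zero_closed by (simp add: \<rho>_def M.coset_zero L.coset_zero zero)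
    also have "\<dots> \<longleftrightarrow> L.coset x = L.coset (lie_zero L)"
      using inj[OF that L.zero_closed] by auto
    finally show ?thesis
      using that L.zero_closed by (simp add: L.coset_eq_iff L.sub_zero)
  qed
  have 2: "(lie_zero L, y) \<in> \<rho> \<longleftrightarrow> y \<in> J" if "y \<in> lie_carrier M" for y
  proof -
    have "(lie_zero L, y) \<in> \<rho> \<longleftrightarrow> M.coset y = M.coset (lie_zero M)"
      using that L.zero_closed by (auto simp add: \<rho>_def M.coset_zero L.coset_zero zero)
    then show ?thesis
      using that M.zero_closed by (simp add: M.coset_eq_iff M.sub_zero)
  qed
  have 3: "(lie_add L x x', lie_add M y y') \<in> \<rho>" "(lie_bracket L x x', lie_bracket M y y') \<in> \<rho>"
    if "(x, y) \<in> \<rho>" "(x', y') \<in> \<rho>" for x y x' y'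
    using that add[of "L.coset x" "L.coset x'"] bracket[of "L.coset x" "L.coset x'"]
    by (auto simp: \<rho>_def L.add_closed M.add_closed L.bracket_closed M.bracket_closed
        L.quotient_add M.quotient_add L.quotient_bracket M.quotient_bracket)
  have 4: "(lie_scale L c x, lie_scale M c y) \<in> \<rho>" if "(x, y) \<in> \<rho>" for x y c
    using that scale[of "L.coset x" c]
    by (auto simp: \<rho>_def L.scale_closed M.scale_closed L.quotient_scale M.quotient_scale)
  have "lie_corr L I M J \<rho>"
    using left right by (intro lie_corrI 1 2 3 4) (auto simp: \<rho>_def)
  then show ?thesis by blast
qed

text \<open>Single brackets are used instead of their span. For \<open>u_alg n\<close> the two agree, since there every
element of a derived algebra is itself a bracket, and single brackets are preserved by
correspondences for trivial reasons.\<close>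

primrec derived :: "('k, 'a) lie_struct \<Rightarrow> nat \<Rightarrow> 'a set" where
  "derived L 0 = lie_carrier L"
| "derived L (Suc k) = {lie_bracket L a b | a b. a \<in> derived L k \<and> b \<in> derived L k}"

text \<open>The preimage in \<open>L\<close> of the centralizer in \<open>L/I\<close> of the image of \<open>Y\<close>.\<close>

definition centralizer :: "('k, 'a) lie_struct \<Rightarrow> 'a set \<Rightarrow> 'a set \<Rightarrow> 'a set" where
  "centralizer L I Y = {x \<in> lie_carrier L. \<forall>q\<in>Y. lie_bracket L q x \<in> I}"

text \<open>The elements of a derived algebra that are central modulo the next one.\<close>

definition derived_center :: "('k, 'a) lie_struct \<Rightarrow> nat \<Rightarrow> 'a set" where
  "derived_center L k = {q \<in> derived L k. \<forall>z\<in>lie_carrier L. lie_bracket L z q \<in> derived L (Suc k)}"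

context lie_correspondence
begin

lemma corr_derived: "x \<in> derived L k \<Longrightarrow> \<exists>y\<in>derived M k. (x, y) \<in> \<rho>"
proof (induction k arbitrary: x)
  case 0
  then show ?case using corr_left corr_carrier by simp blast
next
  case (Suc k)
  then obtain a b where ab: "a \<in> derived L k" "b \<in> derived L k" "x = lie_bracket L a b" by auto
  obtain a' b' where "a' \<in> derived M k" "b' \<in> derived M k" "(a, a') \<in> \<rho>" "(b, b') \<in> \<rho>"
    using Suc.IH ab by meson
  then show ?case
    unfolding ab(3) by (intro bexI[of _ "lie_bracket M a' b'"] corr_bracket) auto
qed

lemma corr_derived_subset:
  assumes "derived L k \<subseteq> I"
  shows "derived M k \<subseteq> J"
proof
  fix y assume "y \<in> derived M k"
  then obtain x where "x \<in> derived L k" "(x, y) \<in> \<rho>"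
    using lie_correspondence.corr_derived[OF converse] by blast
  then show "y \<in> J"
    using assms corr_ideal_imp by blast
qed

text \<open>A set that contains \<open>J\<close> and is closed under addition is a union of cosets, so membership does
not depend on the choice of a partner of \<open>x\<close>.\<close>

lemma corr_image_mem:
  assumes xy: "(x, y) \<in> \<rho>" "(x, y') \<in> \<rho>" "y' \<in> B" "J \<subseteq> B"
    and add: "\<And>a b. a \<in> B \<Longrightarrow> b \<in> B \<Longrightarrow> lie_add M a b \<in> B"
  shows "y \<in> B"
proof -
  have "M.sub y y' \<in> J"
    using corr_sub[OF xy(1,2)] corr_carrier[OF xy(1)] by (simp add: L.sub_self corr_zero_left)
  then have "lie_add M y' (M.sub y y') \<in> B"
    using assms by blast
  then show ?thesis
    using corr_carrier(2)[OF xy(1)] corr_carrier(2)[OF xy(2)] by (simp add: M.add_sub_cancel)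
qed

lemma corr_derived_center:
  assumes "J \<subseteq> derived M (Suc k)"
    and "\<And>a b. a \<in> derived M (Suc k) \<Longrightarrow> b \<in> derived M (Suc k) \<Longrightarrow> lie_add M a b \<in> derived M (Suc k)"
    and q: "q \<in> derived_center L k"
  shows "\<exists>q'\<in>derived_center M k. (q, q') \<in> \<rho>"
proof -
  obtain q' where q': "q' \<in> derived M k" "(q, q') \<in> \<rho>"
    using q corr_derived unfolding derived_center_def by blast
  have "lie_bracket M z' q' \<in> derived M (Suc k)" if z': "z' \<in> lie_carrier M" for z'
  proof -
    obtain z where z: "(z, z') \<in> \<rho>"
      using corr_right z' by blast
    have "lie_bracket L z q \<in> derived L (Suc k)"
      using q corr_carrier(1)[OF z] unfolding derived_center_def by blast
    then obtain y where "y \<in> derived M (Suc k)" "(lie_bracket L z q, y) \<in> \<rho>"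
      using corr_derived by blast
    then show ?thesis
      using corr_image_mem[OF corr_bracket[OF z q'(2)]] assms(1,2) by blast
  qed
  then show ?thesis
    using q' by (auto simp: derived_center_def)
qed

lemma corr_centralizer:
  assumes "\<And>q'. q' \<in> Y' \<Longrightarrow> \<exists>q\<in>Y. (q, q') \<in> \<rho>"
    and "(x, y) \<in> \<rho>" "x \<in> centralizer L I Y"
  shows "y \<in> centralizer M J Y'"
proof -
  have "lie_bracket M q' y \<in> J" if q': "q' \<in> Y'" for q'
  proof -
    obtain q where "q \<in> Y" "(q, q') \<in> \<rho>"
      using assms(1) q' by blast
    then show ?thesis
      using corr_ideal_imp[OF corr_bracket] assms(2,3) by (auto simp: centralizer_def)
  qed
  then show ?thesis
    using assms(2) corr_carrier by (auto simp: centralizer_def)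
qed

lemma corr_image_ideal:
  assumes "lie_ideal L A"
  shows "lie_ideal M (\<rho> `` A)"
  unfolding lie_ideal_def
proof (intro conjI ballI allI)
  have A: "lie_zero L \<in> A" "\<And>x y. x \<in> A \<Longrightarrow> y \<in> A \<Longrightarrow> lie_add L x y \<in> A"
     "\<And>c x. x \<in> A \<Longrightarrow> lie_scale L c x \<in> A"
     "\<And>x y. x \<in> lie_carrier L \<Longrightarrow> y \<in> A \<Longrightarrow> lie_bracket L x y \<in> A"
    using assms unfolding lie_ideal_def by blast+
  show "\<rho> `` A \<subseteq> lie_carrier M"
    using corr_carrier by blast
  show "lie_zero M \<in> \<rho> `` A"
    using corr_zero_right L.ideal_zero A(1) by blast
  show "lie_add M x y \<in> \<rho> `` A" if "x \<in> \<rho> `` A" "y \<in> \<rho> `` A" for x y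
    using that A(2) corr_add by blast
  show "lie_scale M c x \<in> \<rho> `` A" if "x \<in> \<rho> `` A" for c x
    using that A(3) corr_scale by blast
  show "lie_bracket M x y \<in> \<rho> `` A" if xy: "x \<in> lie_carrier M" "y \<in> \<rho> `` A" for x y
  proof -
    obtain a where a: "(a, x) \<in> \<rho>"
      using xy(1) corr_right by blast
    obtain b where b: "(b, y) \<in> \<rho>" "b \<in> A"
      using xy(2) by blast
    show ?thesis
      using corr_bracket[OF a b(1)] A(4)[OF corr_carrier(1)[OF a] b(2)] by blast
  qed
qed

text \<open>For ideals containing \<open>I\<close> passing to the image loses no information.\<close>

lemma corr_image_inverse:
  assumes "lie_ideal L A" "I \<subseteq> A" "(x, y) \<in> \<rho>" "y \<in> \<rho> `` A"
  shows "x \<in> A"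
proof -
  obtain x' where "x' \<in> A" "(x', y) \<in> \<rho>"
    using assms by blast
  then show ?thesis
    using lie_correspondence.corr_image_mem[OF converse, of y x x' A] assms
    by (auto simp: lie_ideal_def)
qed

end

section \<open>Classification of the ideals\<close>

lemma supp_single_mult: "\<gamma> \<in> supp (single \<alpha> (1 :: 'k::field_char_0) * p) \<longleftrightarrow> (\<exists>\<beta>\<in>supp p. \<gamma> = \<alpha> + \<beta>)"
  for \<alpha> :: expo
proof
  assume "\<gamma> \<in> supp (single \<alpha> 1 * p)"
  then show "\<exists>\<beta>\<in>supp p. \<gamma> = \<alpha> + \<beta>"
    using keys_mult[of "single \<alpha> (1::'k)" p] by auto
next
  assume "\<exists>\<beta>\<in>supp p. \<gamma> = \<alpha> + \<beta>"
  then show "\<gamma> \<in> supp (single \<alpha> 1 * p)"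
    by (auto simp: supp_iff coef_single_mult)
qed

lemma supp_mult_partialE:
  assumes "\<gamma> \<in> supp (f * partial k p)"
  obtains \<delta> \<beta> where "\<delta> \<in> supp f" "\<beta> + single k 1 \<in> supp p" "\<gamma> = \<delta> + \<beta>"
  using keys_mult[of f "partial k p"] assms by (auto simp: supp_partial)

text \<open>Every monomial of \<open>act l f p\<close> comes from a monomial of \<open>p\<close> by replacing one factor \<open>x\<^sub>k\<close> by a
monomial of \<open>f k\<close>.\<close>

lemma supp_actE:
  assumes "\<gamma> \<in> supp (act l f p)"
  obtains k \<delta> \<beta> where "k \<in> {1..<l}" "\<delta> \<in> supp (f k)" "\<beta> + single k 1 \<in> supp p" "\<gamma> = \<delta> + \<beta>"
proof -
  have "\<exists>k\<in>{1..<l}. \<gamma> \<in> supp (f k * partial k p)"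
  proof (rule ccontr)
    assume "\<not> ?thesis"
    then have "coef (act l f p) \<gamma> = 0"
      by (simp add: act_def lookup_sum supp_iff del: One_nat_def)
    with assms show False
      by (simp add: supp_iff)
  qed
  then show thesis
    using supp_mult_partialE that by metis
qed

lemma supp_minusE: "\<gamma> \<in> supp (p - q :: 'k::field_char_0 mpoly) \<Longrightarrow> \<gamma> \<in> supp p \<or> \<gamma> \<in> supp q"
  using keys_diff[of p q] by blast

definition support :: "nat \<Rightarrow> 'k::field_char_0 oper \<Rightarrow> (expo \<times> nat) set" where
  "support n D = {(\<alpha>, l). l \<in> {1..n} \<and> \<alpha> \<in> supp (component D l)}"

lemma support_basis: "D \<in> u_set n \<Longrightarrow> support n D \<subseteq> basis_index n"
  using comp_polys by (fastforce simp: support_def basis_index_def polys_iff)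

lemma finite_support: "finite (support n D)"
proof -
  have "support n D = (\<Union>l\<in>{1..n}. (\<lambda>\<alpha>. (\<alpha>, l)) ` supp (component D l))"
    by (auto simp: support_def)
  then show ?thesis by simp
qed

lemma support_empty: "D \<in> u_set n \<Longrightarrow> support n D = {} \<Longrightarrow> D = lie_zero (u_alg n)"
proof (rule u_eqI)
  fix l assume "support n D = {}" "l \<in> {1..n}"
  then have "supp (component D l) = {}"
    unfolding support_def by blast
  then show "component D l = component (lie_zero (u_alg n)) l"
    using \<open>l \<in> {1..n}\<close> by (simp only: comp_zero keys_eq_empty)
qed (auto intro: u_zero)

definition seg :: "nat \<Rightarrow> (expo \<times> nat) set \<Rightarrow> 'k::field_char_0 oper set" where
  "seg n S = {D \<in> u_set n. support n D \<subseteq> S}"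

definition down_closed :: "nat \<Rightarrow> (expo \<times> nat) set \<Rightarrow> bool" where
  "down_closed n S \<longleftrightarrow> S \<subseteq> basis_index n \<and> (\<forall>x\<in>S. \<forall>y\<in>basis_index n. iless y x \<longrightarrow> y \<in> S)"

lemma down_closed_preds: "down_closed n (preds n z)"
  unfolding down_closed_def preds_def using iless_trans by blast

lemma support_add: 
  "D \<in> u_set n \<Longrightarrow> E \<in> u_set n \<Longrightarrow> support n (lie_add (u_alg n) D E) \<subseteq> support n D \<union> support n E"
  using keys_add by (fastforce simp: support_def comp_add simp del: One_nat_def)

lemma support_scale: "D \<in> u_set n \<Longrightarrow> support n (lie_scale (u_alg n) c D) \<subseteq> support n D"
  by (auto simp: support_def comp_scale supp_iff coef_Const_mult simp del: One_nat_def)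

text \<open>A monomial of a bracket with \<open>y\<close> arises in two ways: either a monomial of \<open>y\<close> is differentiated,
which decreases it within its block, or \<open>y\<close> differentiates a polynomial of a later block, which is
smaller altogether.\<close>

lemma seg_ideal:
  assumes S: "down_closed n S"
  shows "lie_ideal (u_alg n) (seg n S)"
  unfolding lie_ideal_def
proof (intro conjI ballI allI)
  show "seg n S \<subseteq> u_set n"
    by (auto simp: seg_def)
  show "lie_zero (u_alg n) \<in> seg n S"
    by (auto simp: seg_def u_zero support_def comp_zero simp del: One_nat_def)
  show "lie_add (u_alg n) x y \<in> seg n S" if "x \<in> seg n S" "y \<in> seg n S" for x y
    using that support_add[of x n y] by (auto simp: seg_def u_add)
  show "lie_scale (u_alg n) c x \<in> seg n S" if "x \<in> seg n S" for c x
    using that support_scale[of x n c] by (auto simp: seg_def u_scale)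
  show "lie_bracket (u_alg n) x y \<in> seg n S" if x: "x \<in> u_set n" and y: "y \<in> seg n S" for x y
  proof -
    have y': "y \<in> u_set n" and yS: "support n y \<subseteq> S"
      using y by (auto simp: seg_def)
    have B: "lie_bracket (u_alg n) x y \<in> u_set n"
      using x y' by (rule u_bracket)
    have "z \<in> S" if z: "z \<in> support n (lie_bracket (u_alg n) x y)" for z
    proof -
      obtain \<gamma> l where zl: "z = (\<gamma>, l)" "l \<in> {1..n}" 
        "\<gamma> \<in> supp (act l (component x) (component y l) - act l (component y) (component x l))"
        using z x y' by (auto simp: support_def comp_bracket simp del: One_nat_def)
      have zB: "z \<in> basis_index n"
        using support_basis[OF B] z by blast
      from supp_minusE[OF zl(3)] have "\<exists>w\<in>S. iless z w"
      proof
        assume "\<gamma> \<in> supp (act l (component x) (component y l))"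
        then obtain k \<delta> \<beta> where k: "k \<in> {1..<l}" "\<delta> \<in> supp (component x k)" 
          "\<beta> + single k 1 \<in> supp (component y l)" "\<gamma> = \<delta> + \<beta>"
          by (rule supp_actE)
        have "supp \<delta> \<subseteq> {1..k - 1}"
          using comp_polys[OF x, of k] k zl(2) by (auto simp: polys_iff)
        then have "mless (l - 1) \<gamma> (\<beta> + single k 1)"
          using mless_lower[of k "l - 1" \<delta> \<beta>] k by (auto simp: add.commute)
        moreover have "(\<beta> + single k 1, l) \<in> S"
          using k(3) zl(2) yS by (auto simp: support_def)
        ultimately show ?thesis
          using zl(1) by (metis iless.simps)
      next
        assume "\<gamma> \<in> supp (act l (component y) (component x l))"
        then obtain k \<delta> \<beta> where k: "k \<in> {1..<l}" "\<delta> \<in> supp (component y k)" 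
          by (rule supp_actE)
        then have "(\<delta>, k) \<in> S"
          using zl(2) yS by (auto simp: support_def)
        moreover have "iless z (\<delta>, k)"
          using k zl(1) by simp
        ultimately show ?thesis by blast
      qed
      then show ?thesis
        using S zB by (auto simp: down_closed_def)
    qed
    then show ?thesis
      using B by (auto simp: seg_def)
  qed
qed

definition leads :: "nat \<Rightarrow> 'k::field_char_0 oper \<Rightarrow> expo \<times> nat \<Rightarrow> bool" where
  "leads n D z \<longleftrightarrow> z \<in> support n D \<and> (\<forall>y\<in>support n D. y = z \<or> iless y z)"

lemma leads_iff:
  "leads n D (\<alpha>, i) \<longleftrightarrow> i \<in> {1..n} \<and> (\<forall>l\<in>{1..<i}. component D l = 0) \<and> \<alpha> \<in> supp (component D i) \<and>
     (\<forall>\<beta>\<in>supp (component D i). \<beta> = \<alpha> \<or> mless (i - 1) \<beta> \<alpha>)" (is "_ \<longleftrightarrow> ?R")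
proof
  assume L: "leads n D (\<alpha>, i)"
  have "supp (component D l) = {}" if "l \<in> {1..<i}" for l
  proof (rule ccontr)
    assume "supp (component D l) \<noteq> {}"
    then obtain \<beta> where "\<beta> \<in> supp (component D l)" by blast
    then have "(\<beta>, l) \<in> support n D"
      using that L by (auto simp: support_def leads_def)
    then show False
      using L that by (fastforce simp: leads_def)
  qed
  then show ?R
    using L by (fastforce simp: leads_def support_def keys_eq_empty)
next
  assume R: ?R
  have "y = (\<alpha>, i) \<or> iless y (\<alpha>, i)" if "y \<in> support n D" for y
  proof -
    obtain \<beta> l where y: "y = (\<beta>, l)" "l \<in> {1..n}" "\<beta> \<in> supp (component D l)"
      using \<open>y \<in> support n D\<close> by (auto simp: support_def)
    then have "\<not> l < i"
      using R by (metis atLeastAtMost_iff atLeastLessThan_iff empty_iff keys_eq_empty)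
    then show ?thesis
      using R y by (cases "l = i") auto
  qed
  then show "leads n D (\<alpha>, i)"
    using R by (auto simp: leads_def support_def)
qed

lemma ex_leads:
  assumes "D \<in> u_set n" "support n D \<noteq> {}"
  shows "\<exists>z. leads n D z"
proof -
  have "transp_on (support n D) iless" "totalp_on (support n D) iless"
    using iless_trans iless_total[of _ n] support_basis[OF assms(1)]
    unfolding transp_on_def totalp_on_def by blast+
  then show ?thesis
    using Finite_Set.bex_greatest_element[OF finite_support assms(2), of iless]
    unfolding leads_def by blast
qed

text \<open>Bracketing with \<open>x\<^sup>\<gamma> \<partial>\<^sub>k\<close> replaces one factor \<open>x\<^sub>k\<close> of the leading monomial by \<open>x\<^sup>\<gamma>\<close>; the order of
the monomials containing \<open>x\<^sub>k\<close> is preserved, since it is invariant under translation.\<close>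

lemma ideal_lead_lower:
  fixes A :: "'k::field_char_0 oper set"
  assumes A: "lie_ideal (u_alg n) A" and D: "D \<in> A" "leads n D (\<beta> + single k 1, i)"
    and k: "k \<in> {1..<i}" and \<gamma>: "supp \<gamma> \<subseteq> {1..k - 1}"
  shows "\<exists>E\<in>A. leads n E (\<gamma> + \<beta>, i)"
proof
  let ?g = "single \<gamma> 1 :: 'k mpoly"
  let ?E = "lie_bracket (u_alg n) (vf_single n ?g k) D"
  have g: "?g \<in> polys (k - 1)"
    using \<gamma> by (rule polys_single)
  show "?E \<in> A"
    using A D(1) vf_single_mem[OF g] by (auto simp: lie_ideal_def)
  have Dn: "D \<in> u_set n"
    using A D(1) by (auto simp: lie_ideal_def)
  note L = D(2)[unfolded leads_iff]
  have comp: "component ?E l = (if k < l then ?g * partial k (component D l) else 0)" if "l \<in> {1..n}" for l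
  proof -
    have "act k (component D) ?g = 0"
      using L k by (intro act_eq_0) auto
    then show ?thesis
      using comp_bracket_vf_single[OF g Dn that] L k by auto
  qed
  show "leads n ?E (\<gamma> + \<beta>, i)"
    unfolding leads_iff
  proof (intro conjI ballI)
    show i: "i \<in> {1..n}"
      using L by blast
    show "component ?E l = 0" if "l \<in> {1..<i}" for l
      using comp[of l] L that by auto
    show "\<gamma> + \<beta> \<in> supp (component ?E i)"
      using comp[OF i] L k by (auto simp: supp_single_mult supp_partial)
    show "\<delta> = \<gamma> + \<beta> \<or> mless (i - 1) \<delta> (\<gamma> + \<beta>)" if \<delta>: "\<delta> \<in> supp (component ?E i)" for \<delta>
    proof -
      obtain \<beta>' where \<beta>': "\<delta> = \<gamma> + \<beta>'" "\<beta>' + single k 1 \<in> supp (component D i)"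
        using \<delta> comp[OF i] k by (auto simp: supp_single_mult supp_partial)
      then have "\<beta>' = \<beta> \<or> mless (i - 1) \<beta>' \<beta>"
        using L mless_add_cancel[of "i - 1" \<beta>' "single k 1" \<beta>] by fastforce
      then show ?thesis
        using \<beta>'(1) mless_add_cancel[of "i - 1" \<beta>' \<gamma> \<beta>] by (auto simp: add.commute)
    qed
  qed
qed

text \<open>If \<open>D\<close> leads with \<open>\<partial>\<^sub>i\<close>, then it acts on \<open>x\<^sub>i x\<^sup>\<beta>\<close> with leading monomial \<open>x\<^sup>\<beta>\<close>: the summand for \<open>\<partial>\<^sub>i\<close>
is a nonzero multiple of \<open>x\<^sup>\<beta>\<close>, and every other summand lowers the exponent of a later variable.\<close>

lemma ideal_lead_next:
  fixes A :: "'k::field_char_0 oper set"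
  assumes A: "lie_ideal (u_alg n) A" and D: "D \<in> A" "leads n D (0, i)"
    and j: "i < j" "j \<le> n" and \<beta>: "supp \<beta> \<subseteq> {1..j - 1}"
  shows "\<exists>E\<in>A. leads n E (\<beta>, j)"
proof
  let ?g = "single (\<beta> + single i 1) 1 :: 'k mpoly"
  let ?E = "lie_bracket (u_alg n) (vf_single n ?g j) D"
  note L = D(2)[unfolded leads_iff]
  have g: "?g \<in> polys (j - 1)"
    using \<beta> L j by (intro polys_single) (auto simp: supp_expo_add)
  show "?E \<in> A"
    using A D(1) vf_single_mem[OF g] by (auto simp: lie_ideal_def)
  have Dn: "D \<in> u_set n"
    using A D(1) by (auto simp: lie_ideal_def)
  have jn: "j \<in> {1..n}"
    using j by auto
  have comp_less: "component ?E l = 0" if "l \<in> {1..<j}" for l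
    using comp_bracket_vf_single[OF g Dn _ jn, of l] that j by auto
  have comp_j: "component ?E j = - act j (component D) ?g"
    using comp_bracket_vf_single[OF g Dn jn jn] by auto
  have zero: "component D i = Const (coef (component D i) 0)"
    using L by (intro poly_mapping_eqI) (auto simp: Const_def lookup_single when_def supp_iff)
  have c: "coef (component D i) 0 \<noteq> 0"
    using L by (auto simp: supp_iff)
  have low: "mless (j - 1) \<gamma> \<beta>" 
    if k: "k \<in> {1..<j}" "k \<noteq> i" "\<gamma> \<in> supp (component D k * partial k ?g)" for k \<gamma>
  proof -
    obtain \<delta> \<beta>' where *: "\<delta> \<in> supp (component D k)" "\<beta>' + single k 1 = \<beta> + single i 1" "\<gamma> = \<delta> + \<beta>'"
      using k(3) by (rule supp_mult_partialE) (auto split: if_splits)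
    have "i < k"
      using L * k by (metis atLeastLessThan_iff empty_iff linorder_neqE_nat keys_eq_empty)
    have "supp \<delta> \<subseteq> {1..k - 1}"
      using comp_polys[OF Dn, of k] * k(1) j by (auto simp: polys_iff)
    then have \<delta>0: "coef \<delta> l = 0" if "k \<le> l" for l
      using that \<open>i < k\<close> by (metis Suc_diff_1 atLeastAtMost_iff in_keys_iff not_less_eq_eq subsetD gr0I not_less0 order_trans le_refl)
    have co: "coef \<beta>' l + (if l = k then 1 else 0) = coef \<beta> l + (if l = i then 1 else 0)" for l
      using arg_cong[OF *(2), of "\<lambda>\<alpha>. coef \<alpha> l"] by (auto simp: lookup_add lookup_single when_def split: if_splits)
    show ?thesis
      unfolding mless_iff
    proof (rule bexI[of _ k], intro conjI allI impI)
      show "coef \<gamma> k < coef \<beta> k"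
        using co[of k] \<delta>0[of k] \<open>i < k\<close> by (simp add: *(3) lookup_add)
      show "coef \<gamma> l = coef \<beta> l" if "k < l \<and> l \<le> j - 1" for l
        using co[of l] \<delta>0[of l] \<open>i < k\<close> that by (simp add: *(3) lookup_add)
    qed (use k in auto)
  qed
  have pi: "component D i * partial i ?g = single \<beta> (coef (component D i) 0 * of_nat (coef \<beta> i + 1))"
    by (subst zero) (simp add: partial_single Const_def mult_single lookup_add)
  show "leads n ?E (\<beta>, j)"
    unfolding leads_iff
  proof (intro conjI ballI)
    show "j \<in> {1..n}" by fact
    show "component ?E l = 0" if "l \<in> {1..<j}" for l
      using that by (rule comp_less)
    have "coef (act j (component D) ?g) \<beta> = (\<Sum>k=1..<j. coef (component D k * partial k ?g) \<beta>)"
      by (simp add: act_def lookup_sum)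
    also have "\<dots> = (\<Sum>k\<in>{i}. coef (component D k * partial k ?g) \<beta>)"
    proof (rule sum.mono_neutral_right)
      show "\<forall>k\<in>{1..<j} - {i}. coef (component D k * partial k ?g) \<beta> = 0"
      proof
        fix k assume "k \<in> {1..<j} - {i}"
        then have "\<beta> \<notin> supp (component D k * partial k ?g)"
          using low[of k \<beta>] by auto
        then show "coef (component D k * partial k ?g) \<beta> = 0"
          by (simp add: supp_iff)
      qed
    qed (use L j in auto)
    also have "\<dots> = coef (component D i) 0 * of_nat (coef \<beta> i + 1)"
      using pi by simp
    finally show "\<beta> \<in> supp (component ?E j)"
      using c of_nat_neq_0[of "coef \<beta> i", where 'a='k] unfolding comp_j by (simp add: supp_iff)
    show "\<delta> = \<beta> \<or> mless (j - 1) \<delta> \<beta>" if "\<delta> \<in> supp (component ?E j)" for \<delta>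
    proof -
      have "\<exists>k\<in>{1..<j}. \<delta> \<in> supp (component D k * partial k ?g)"
      proof (rule ccontr)
        assume "\<not> ?thesis"
        then have "coef (act j (component D) ?g) \<delta> = 0"
          by (simp add: act_def lookup_sum supp_iff del: One_nat_def)
        with that show False
          unfolding comp_j by (simp add: supp_iff)
      qed
      then obtain k where k: "k \<in> {1..<j}" "\<delta> \<in> supp (component D k * partial k ?g)" by blast
      show ?thesis
      proof (cases "k = i")
        case True
        then show ?thesis
          using k(2) pi by (auto split: if_splits)
      next
        case False
        then show ?thesis
          using low k by blast
      qed
    qed
  qed
qed

lemma not_mless_le: "(\<And>j. j \<in> {1..k} \<Longrightarrow> coef \<beta> j \<le> coef \<alpha> j) \<Longrightarrow> \<not> mless k \<alpha> \<beta>"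
  unfolding mless_iff by fastforce

definition lead_set :: "nat \<Rightarrow> 'k::field_char_0 oper set \<Rightarrow> (expo \<times> nat) set" where
  "lead_set n A = {z. \<exists>D\<in>A. leads n D z}"

text \<open>Let \<open>k\<close> be the most significant variable at which \<open>\<beta>\<close> and \<open>\<alpha>\<close> differ. One lowering step
replaces a factor \<open>x\<^sub>k\<close> of \<open>x\<^sup>\<alpha>\<close> by the part of \<open>x\<^sup>\<beta>\<close> in the variables before \<open>x\<^sub>k\<close>. The result is
smaller than \<open>\<alpha>\<close> and still at least \<open>\<beta>\<close>, so well-founded induction on \<open>\<alpha>\<close> applies.\<close>

lemma lead_set_same_block:
  assumes A: "lie_ideal (u_alg n) A" and \<beta>: "supp \<beta> \<subseteq> {1..i - 1}"
    and "(\<alpha>, i) \<in> lead_set n A" "mless (i - 1) \<beta> \<alpha>"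
  shows "(\<beta>, i) \<in> lead_set n A"
  using wf_mless[of "i - 1"] assms(3,4)
proof (induction \<alpha> rule: wf_induct_rule)
  case (less \<alpha>)
  obtain k where k: "k \<in> {1..i - 1}" "coef \<beta> k < coef \<alpha> k"
    "\<And>l. k < l \<Longrightarrow> l \<le> i - 1 \<Longrightarrow> coef \<beta> l = coef \<alpha> l"
    using less.prems(2) unfolding mless_iff by blast
  define \<gamma> where "\<gamma> = (\<Sum>j\<in>{1..<k}. single j (coef \<beta> j))"
  have \<gamma>: "coef \<gamma> j = (if j \<in> {1..<k} then coef \<beta> j else 0)" for j
    unfolding \<gamma>_def lookup_sum lookup_single when_def by (simp add: sum.delta)
  have supp_\<gamma>: "supp \<gamma> \<subseteq> {1..k - 1}"
    by (auto simp: supp_iff \<gamma> split: if_splits)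
  define \<alpha>' where "\<alpha>' = \<alpha> - single k 1"
  have \<alpha>: "\<alpha> = \<alpha>' + single k 1"
    using k(2) expo_diff_add_single[of \<alpha> k] unfolding \<alpha>'_def by simp
  obtain D where "D \<in> A" "leads n D (\<alpha>' + single k 1, i)"
    using less.prems(1) unfolding lead_set_def \<alpha>[symmetric] by blast
  then have new: "(\<gamma> + \<alpha>', i) \<in> lead_set n A"
    using ideal_lead_lower[OF A, of D \<alpha>' k i \<gamma>] k(1) supp_\<gamma> by (auto simp: lead_set_def)
  then have "supp (\<gamma> + \<alpha>') \<subseteq> {1..i - 1}"
    using A support_basis[of _ n] by (auto simp: lead_set_def leads_def lie_ideal_def basis_index_def)
  moreover have "\<not> mless (i - 1) (\<gamma> + \<alpha>') \<beta>"
  proof (rule not_mless_le)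
    fix j assume "j \<in> {1..i - 1}"
    then show "coef \<beta> j \<le> coef (\<gamma> + \<alpha>') j"
      using k(2) k(3)[of j] arg_cong[OF \<alpha>, of "\<lambda>\<alpha>. coef \<alpha> j"]
      by (cases j k rule: linorder_cases) (auto simp: lookup_add \<gamma> lookup_single when_def)
  qed
  ultimately consider "\<beta> = \<gamma> + \<alpha>'" | "mless (i - 1) \<beta> (\<gamma> + \<alpha>')"
    using mless_total[OF \<beta>] by blast
  then show ?case
  proof cases
    case 2
    have "mless (i - 1) (\<gamma> + \<alpha>') \<alpha>"
      using mless_lower[OF k(1) supp_\<gamma>, of \<alpha>'] \<alpha> by (simp add: add.commute)
    then show ?thesis
      using less.IH[of "\<gamma> + \<alpha>'"] new 2 by blast
  qed (use new in simp)
qed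

text \<open>To pass to a later block, the leading exponent is first lowered to \<open>0\<close>.\<close>

lemma lead_set_down_closed:
  assumes A: "lie_ideal (u_alg n) A"
  shows "down_closed n (lead_set n A)"
  unfolding down_closed_def
proof (intro conjI ballI impI)
  show sub: "lead_set n A \<subseteq> basis_index n"
    using A support_basis[of _ n] by (auto simp: lead_set_def leads_def lie_ideal_def)
  fix x y assume x: "x \<in> lead_set n A" and y: "y \<in> basis_index n" and less: "iless y x"
  obtain \<alpha> i \<beta> j where xy: "x = (\<alpha>, i)" "y = (\<beta>, j)"
    by (cases x; cases y)
  have \<beta>: "supp \<beta> \<subseteq> {1..j - 1}" "j \<le> n"
    using y by (auto simp: xy basis_index_def)
  show "y \<in> lead_set n A"
  proof (cases "i = j")
    case True
    then show ?thesis
      using lead_set_same_block[OF A \<beta>(1), of \<alpha>] x less by (simp add: xy)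
  next
    case False
    then have "i < j"
      using less by (simp add: xy)
    have "(0, i) \<in> lead_set n A"
    proof (cases "\<alpha> = 0")
      case False
      moreover have "supp \<alpha> \<subseteq> {1..i - 1}"
        using x sub by (auto simp: xy basis_index_def)
      ultimately have "mless (i - 1) 0 \<alpha>"
        using mless_total[of 0 "i - 1" \<alpha>] by auto
      then show ?thesis
        using lead_set_same_block[OF A, of 0 i \<alpha>] x by (simp add: xy)
    qed (use x xy in simp)
    then obtain D where "D \<in> A" "leads n D (0, i)"
      by (auto simp: lead_set_def)
    from ideal_lead_next[OF A this \<open>i < j\<close> \<beta>(2,1)] show ?thesis
      by (auto simp: lead_set_def xy)
  qed
qed

text \<open>Leading terms are eliminated one after the other, which terminates because the order is well
founded.\<close>

lemma ideal_eq_seg: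
  fixes A :: "'k::field_char_0 oper set"
  assumes A: "lie_ideal (u_alg n) A"
  shows "A = seg n (lead_set n A)"
proof
  interpret lie_alg_ideal "u_alg n" A
    using A lie_alg_u by (simp add: lie_alg_ideal_def lie_alg_ideal_axioms_def)
  show sub: "A \<subseteq> seg n (lead_set n A)"
  proof
    fix D assume D: "D \<in> A"
    have "y \<in> lead_set n A" if y: "y \<in> support n D" for y
    proof -
      obtain z where z: "leads n D z"
        using ex_leads[OF ideal_carrier[OF D]] y by blast
      then have "z \<in> lead_set n A"
        using D by (auto simp: lead_set_def)
      moreover have "y = z \<or> iless y z" "y \<in> basis_index n"
        using z y support_basis[OF ideal_carrier[OF D]] by (auto simp: leads_def)
      ultimately show ?thesis
        using lead_set_down_closed[OF A] by (auto simp: down_closed_def)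
    qed
    then show "D \<in> seg n (lead_set n A)"
      using ideal_carrier[OF D] by (auto simp: seg_def)
  qed
  have ind: "D \<in> A" if "leads n D z" "D \<in> seg n (lead_set n A)" for D :: "'k oper" and z
    using wf_iless[of n] that
  proof (induction z arbitrary: D rule: wf_induct_rule)
    case (less z)
    have D: "D \<in> u_set n" "support n D \<subseteq> lead_set n A"
      using less.prems(2) by (auto simp: seg_def)
    obtain \<alpha> l where z: "z = (\<alpha>, l)" by (cases z)
    have zD: "z \<in> support n D"
      using less.prems(1) by (simp add: leads_def)
    then obtain E where E: "E \<in> A" "leads n E z"
      using D by (auto simp: lead_set_def)
    have En: "E \<in> u_set n" and Es: "support n E \<subseteq> lead_set n A"
      using sub E(1) by (auto simp: seg_def)
    have zE: "z \<in> support n E"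
      using E(2) by (simp add: leads_def)
    have l: "l \<in> {1..n}"
      using zD by (auto simp: support_def z)
    \<comment> \<open>The multiple of \<open>E\<close> that cancels the leading term of \<open>D\<close>.\<close>
    define c where "c = coef (component D l) \<alpha> / coef (component E l) \<alpha>"
    define F where "F = sub D (lie_scale (u_alg n) c E)"
    have F: "F \<in> u_set n"
      unfolding F_def using D En by (intro sub_closed scale_closed)
    have compF: "component F i = component D i - Const c * component E i" if "i \<in> {1..n}" for i
      using that D En
      by (simp add: F_def sub_def comp_add comp_scale u_scale Const_minus_1 del: One_nat_def)
    have "coef (component F l) \<alpha> = 0"
      using zE unfolding compF[OF l] c_def
      by (simp add: lookup_minus coef_Const_mult support_def z supp_iff)
    then have zF: "z \<notin> support n F"
      by (simp add: support_def z supp_iff)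
    have sF: "support n F \<subseteq> support n D \<union> support n E"
    proof
      fix y assume "y \<in> support n F"
      then obtain \<beta> i where "y = (\<beta>, i)" "i \<in> {1..n}" "coef (component F i) \<beta> \<noteq> 0"
        by (auto simp: support_def supp_iff)
      then show "y \<in> support n D \<union> support n E"
        by (auto simp: support_def supp_iff compF lookup_minus coef_Const_mult simp del: One_nat_def)
    qed
    have "F \<in> A"
    proof (cases "support n F = {}")
      case True
      then show ?thesis
        using support_empty[OF F] ideal_zero by simp
    next
      case False
      then obtain z' where z': "leads n F z'"
        using ex_leads[OF F] by blast
      then have "z' \<in> support n F"
        by (simp add: leads_def)
      then have "z' \<noteq> z" "z' \<in> support n D \<or> z' \<in> support n E" "snd z' \<le> n"
        using zF sF by (auto simp: support_def)
      then have "iless z' z" "snd z' \<le> n"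
        using less.prems(1) E(2) by (auto simp: leads_def)
      moreover have "F \<in> seg n (lead_set n A)"
        using F sF D Es by (auto simp: seg_def)
      ultimately show ?thesis
        using less.IH[of z' F] z' by blast
    qed
    then have "lie_add (u_alg n) (lie_scale (u_alg n) c E) F \<in> A"
      using E by (intro ideal_add ideal_scale)
    then show ?case
      using D En by (simp add: F_def add_sub_cancel scale_closed)
  qed
  show "seg n (lead_set n A) \<subseteq> A"
  proof
    fix D :: "'k oper" assume D: "D \<in> seg n (lead_set n A)"
    then have Dn: "D \<in> u_set n"
      by (simp add: seg_def)
    show "D \<in> A"
    proof (cases "support n D = {}")
      case True
      then show ?thesis
        using support_empty[OF Dn] ideal_zero by simp
    next
      case False
      then show ?thesis
        using ex_leads[OF Dn] ind D by blast
    qed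
  qed
qed

lemma down_closed_cases:
  assumes "down_closed n S"
  obtains "S = basis_index n" | z where "z \<in> basis_index n" "S = preds n z"
proof (cases "S = basis_index n")
  case False
  then obtain z0 where "z0 \<in> basis_index n - S"
    using assms by (auto simp: down_closed_def)
  then obtain z where z: "z \<in> basis_index n - S"
    and min: "\<And>y. snd y \<le> n \<Longrightarrow> iless y z \<Longrightarrow> y \<notin> basis_index n - S"
    by (rule wfE_min[OF wf_iless[of n], of z0 "basis_index n - S"]) blast+
  have "S = preds n z"
  proof (intro set_eqI iffI)
    fix y assume y: "y \<in> S"
    then have "y \<in> basis_index n" "\<not> iless z y" "y \<noteq> z"
      using assms z by (auto simp: down_closed_def)
    then show "y \<in> preds n z"
      using iless_total[of y n z] z by (auto simp: preds_def)
  next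
    fix y assume "y \<in> preds n z"
    then show "y \<in> S"
      using min[of y] by (auto simp: preds_def basis_index_def)
  qed
  then show thesis
    using that z by blast
qed (use that in blast)

lemma seg_basis_index: "seg n (basis_index n) = u_set n"
  using support_basis by (auto simp: seg_def)

abbreviation below :: "nat \<Rightarrow> expo \<times> nat \<Rightarrow> 'k::field_char_0 oper set" where
  "below n z \<equiv> seg n (preds n z)"

text \<open>A proper initial segment of a well-order consists of the predecessors of the least element
outside it.\<close>

theorem ideal_cases:
  assumes "lie_ideal (u_alg n) A"
  obtains "A = u_set n" | z where "z \<in> basis_index n" "A = below n z"
  using down_closed_cases[OF lead_set_down_closed[OF assms]] ideal_eq_seg[OF assms] seg_basis_index
  by metis

section \<open>Spans of initial segments and ordinals\<close>

lemma basis_elt_eq: "i \<in> {1..n} \<Longrightarrow> basis_elt n \<alpha> i = vf_single n (single \<alpha> 1) i"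
  by (auto simp: basis_elt_def vf_single_def vf_def if_distrib[of "\<lambda>x. x * _"] sum.delta
      restrict_def fun_eq_iff cong: if_cong simp del: One_nat_def)

lemma component_basis_elt: 
  "i \<in> {1..n} \<Longrightarrow> l \<in> {1..n} \<Longrightarrow> component (basis_elt n \<alpha> i) l = (if l = i then single \<alpha> 1 else 0)"
  by (simp only: basis_elt_eq comp_vf_single)

lemma basis_index_range: "(\<alpha>, i) \<in> basis_index n \<Longrightarrow> i \<in> {1..n}"
  by (simp add: basis_index_def)

abbreviation basis_at :: "nat \<Rightarrow> expo \<times> nat \<Rightarrow> 'k::field_char_0 oper" where
  "basis_at n z \<equiv> basis_elt n (fst z) (snd z)"

lemma basis_at_mem: "z \<in> basis_index n \<Longrightarrow> basis_at n z \<in> u_set n"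
  by (cases z) (auto simp: basis_elt_eq basis_index_def intro!: vf_single_mem polys_single)

lemma inj_basis_at: "inj_on (basis_at n :: _ \<Rightarrow> 'k::field_char_0 oper) (basis_index n)"
proof (rule inj_onI)
  fix y z assume y: "y \<in> basis_index n" and z: "z \<in> basis_index n"
    and eq: "basis_at n y = (basis_at n z :: 'k oper)"
  obtain \<alpha> i \<beta> j where yz: "y = (\<alpha>, i)" "z = (\<beta>, j)"
    by (cases y; cases z)
  have ij: "i \<in> {1..n}" "j \<in> {1..n}"
    using y z basis_index_range unfolding yz by blast+
  have "component (basis_at n y :: 'k oper) i = component (basis_at n z) i"
    using eq by simp
  then have *: "(single \<alpha> 1 :: 'k mpoly) = (if i = j then single \<beta> 1 else 0)"
    using ij by (simp add: yz component_basis_elt del: One_nat_def)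
  then have "coef (if i = j then single \<beta> 1 else 0 :: 'k mpoly) \<alpha> = 1"
    by (metis lookup_single_eq)
  then show "y = z"
    by (auto simp: yz lookup_single when_def split: if_splits)
qed

lemma u_basis_eq: "u_basis n = basis_at n ` basis_index n"
  by (force simp: u_basis_def)

lemma basis_order_iff:
  assumes "y \<in> basis_index n" "z \<in> basis_index n"
  shows "(basis_at n y, basis_at n z) \<in> (basis_order n :: 'k::field_char_0 oper rel) \<longleftrightarrow> y = z \<or> iless y z"
proof -
  have *: "basis_order n = {(basis_at n y, basis_at n z :: 'k oper) | y z.
      y \<in> basis_index n \<and> z \<in> basis_index n \<and> (y = z \<or> iless y z)}"
    unfolding basis_order_def index_greater_iff by (auto simp del: iless.simps)
  show ?thesis
  proof
    assume "(basis_at n y, basis_at n z :: 'k oper) \<in> basis_order n"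
    then obtain y' z' where "basis_at n y = (basis_at n y' :: 'k oper)"
      "basis_at n z = (basis_at n z' :: 'k oper)"
      "y' \<in> basis_index n" "z' \<in> basis_index n" "y' = z' \<or> iless y' z'"
      unfolding * by blast
    then show "y = z \<or> iless y z"
      using inj_onD[OF inj_basis_at[of n, where 'k='k]] assms by metis
  qed (use assms * in blast)
qed

lemma ord_type_ordIso:
  assumes z: "z \<in> basis_index n"
  shows "ord_type n (basis_at n z :: 'k::field_char_0 oper) =o ile (insert z (preds n z))"
proof (rule ordIso_symmetric)
  let ?S = "insert z (preds n z)"
  let ?b = "basis_at n :: _ \<Rightarrow> 'k oper"
  have S: "?S \<subseteq> basis_index n"
    using z by (auto simp: preds_def)
  have im: "{Y \<in> u_basis n. (Y, ?b z) \<in> basis_order n} = ?b ` ?S"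
  proof (intro set_eqI iffI)
    fix Y assume "Y \<in> {Y \<in> u_basis n. (Y, ?b z) \<in> basis_order n}"
    then obtain y where y: "y \<in> basis_index n" "Y = ?b y" "(?b y, ?b z) \<in> basis_order n"
      unfolding u_basis_eq by blast
    then have "y \<in> ?S"
      using basis_order_iff[OF y(1) z] by (auto simp: preds_def)
    then show "Y \<in> ?b ` ?S"
      using y(2) by blast
  next
    fix Y assume "Y \<in> ?b ` ?S"
    then obtain y where y: "y \<in> ?S" "Y = ?b y"
      by blast
    then have "y \<in> basis_index n"
      using S by blast
    then show "Y \<in> {Y \<in> u_basis n. (Y, ?b z) \<in> basis_order n}"
      using y z basis_order_iff[of y n z] unfolding u_basis_eq preds_def by blast
  qed
  have "ord_type n (?b z) = dir_image (ile ?S) ?b"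
    unfolding ord_type_def im
  proof (intro set_eqI iffI)
    fix p assume "p \<in> Restr (basis_order n) (?b ` ?S)"
    then obtain x y where xy: "p = (?b x, ?b y)" "x \<in> ?S" "y \<in> ?S" "(?b x, ?b y) \<in> basis_order n"
      by blast
    then have "(x, y) \<in> ile ?S"
      using basis_order_iff[of x n y] S by (auto simp: ile_def simp del: iless.simps)
    then show "p \<in> dir_image (ile ?S) ?b"
      using xy(1) by (rule dir_imageI)
  next
    fix p assume "p \<in> dir_image (ile ?S) ?b"
    then obtain x y where xy: "(x, y) \<in> ile ?S" "p = (?b x, ?b y)"
      by (rule dir_imageE)
    then have "x \<in> ?S" "y \<in> ?S" "x = y \<or> iless x y"
      by (auto simp: ile_def simp del: iless.simps)
    then show "p \<in> Restr (basis_order n) (?b ` ?S)"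
      using basis_order_iff[of x n y] S xy(2) by blast
  qed
  moreover have "inj_on ?b (Field (ile ?S))"
    using inj_on_subset[OF inj_basis_at S] by simp
  ultimately show "ile ?S =o ord_type n (?b z)"
    using dir_image_ordIso[OF Well_order_ile[OF S]] by metis
qed

text \<open>Initial segments of a well-order are ordered by inclusion just as their types are; so the basis
elements whose ordinal is at most the type of \<open>S\<close> are those in \<open>S\<close>.\<close>

lemma ile_ordLeq_iff:
  assumes S: "down_closed n S" and z: "z \<in> basis_index n"
  shows "ile (insert z (preds n z)) \<le>o ile S \<longleftrightarrow> z \<in> S"
proof -
  let ?R = "ile (basis_index n)"
  let ?Z = "insert z (preds n z)"
  have wo: "Well_order ?R"
    by (rule Well_order_ile[OF order_refl])
  then have wr: "wo_rel ?R"
    by (simp add: wo_rel_def)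
  have ofilter: "wo_rel.ofilter ?R A" if "down_closed n A" for A
    using that unfolding wo_rel.ofilter_def[OF wr] under_def Field_ile down_closed_def
    by (auto simp: ile_def simp del: iless.simps)
  have Z: "down_closed n ?Z"
    using z iless_trans unfolding down_closed_def preds_def by blast
  have sub: "?Z \<subseteq> basis_index n" "S \<subseteq> basis_index n"
    using Z S by (auto simp: down_closed_def)
  show ?thesis
  proof
    assume "z \<in> S"
    then have "?Z \<subseteq> S"
      using S unfolding down_closed_def preds_def by blast
    then show "ile ?Z \<le>o ile S"
      using ofilter_subset_ordLeq[OF wo ofilter[OF Z] ofilter[OF S]]
      unfolding Restr_ile[OF sub(1)] Restr_ile[OF sub(2)] by blast
  next
    assume le: "ile ?Z \<le>o ile S"
    show "z \<in> S"
    proof (rule ccontr)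
      assume "z \<notin> S"
      then have "S \<subset> ?Z"
        using S z iless_total[of _ n z] unfolding down_closed_def preds_def by blast
      then have "ile S <o ile ?Z"
        using ofilter_subset_ordLess[OF wo ofilter[OF S] ofilter[OF Z]]
        unfolding Restr_ile[OF sub(1)] Restr_ile[OF sub(2)] by blast
      then show False
        using le not_ordLess_ordLeq by blast
    qed
  qed
qed

lemma lin_span_basis_at:
  assumes S: "S \<subseteq> basis_index n"
  shows "lin_span n (basis_at n ` S) = (seg n S :: 'k::field_char_0 oper set)"
proof (intro set_eqI iffI)
  fix D :: "'k oper" assume "D \<in> lin_span n (basis_at n ` S)"
  then obtain F c where F: "finite F" "F \<subseteq> basis_at n ` S" and D: "D = (\<lambda>p\<in>polys n. \<Sum>Z\<in>F. Const (c Z) * Z p)"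
    by (auto simp: lin_span_def)
  have Fu: "Z \<in> u_set n" if "Z \<in> F" for Z
    using that F(2) S basis_at_mem by blast
  have "D = vf n (\<lambda>l. \<Sum>Z\<in>F. Const (c Z) * component Z l)"
  proof
    fix p show "D p = vf n (\<lambda>l. \<Sum>Z\<in>F. Const (c Z) * component Z l) p"
    proof (cases "p \<in> polys n")
      case True
      have "Z p = (\<Sum>l=1..n. component Z l * partial l p)" if "Z \<in> F" for Z
        using True fun_cong[OF vf_comp[OF Fu[OF that]], of p] by (simp add: vf_def)
      then have "(\<Sum>Z\<in>F. Const (c Z) * Z p) = (\<Sum>Z\<in>F. Const (c Z) * (\<Sum>l=1..n. component Z l * partial l p))"
        by (intro sum.cong) simp_all
      then have "D p = (\<Sum>Z\<in>F. \<Sum>l=1..n. Const (c Z) * component Z l * partial l p)"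
        using True by (simp add: D sum_distrib_left mult.assoc)
      also have "\<dots> = (\<Sum>l=1..n. \<Sum>Z\<in>F. Const (c Z) * component Z l * partial l p)"
        by (rule sum.swap)
      finally show ?thesis
        using True by (simp add: vf_def sum_distrib_right)
    qed (simp add: D vf_def)
  qed
  moreover have "vf n (\<lambda>l. \<Sum>Z\<in>F. Const (c Z) * component Z l) \<in> u_set n"
    by (intro vf_mem polys_sum polys_mult polys_Const) (rule comp_polys[OF Fu])
  moreover have "(\<gamma>, l) \<in> S" if l: "l \<in> {1..n}" and \<gamma>: "\<gamma> \<in> supp (\<Sum>Z\<in>F. Const (c Z) * component Z l)" for \<gamma> l
  proof -
    have "\<exists>Z\<in>F. coef (component Z l) \<gamma> \<noteq> 0"
    proof (rule ccontr)
      assume "\<not> ?thesis"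
      then have "coef (\<Sum>Z\<in>F. Const (c Z) * component Z l) \<gamma> = 0"
        by (simp add: lookup_sum coef_Const_mult)
      with \<gamma> show False by (simp add: supp_iff)
    qed
    then obtain \<alpha> i where z: "(\<alpha>, i) \<in> S" "coef (component (basis_elt n \<alpha> i :: 'k oper) l) \<gamma> \<noteq> 0"
      using F(2) by fastforce
    then show ?thesis
      using l basis_index_range[of \<alpha> i n] S
      by (auto simp: component_basis_elt lookup_single when_def split: if_splits simp del: One_nat_def)
  qed
  ultimately show "D \<in> seg n S"
    by (auto simp: seg_def support_def comp_vf simp del: One_nat_def)
next
  fix D :: "'k oper" assume "D \<in> seg n S"
  then have D: "D \<in> u_set n" "support n D \<subseteq> S"
    by (auto simp: seg_def)
  let ?G = "support n D"
  define c where "c Z = (case inv_into ?G (basis_at n) Z of (\<alpha>, l) \<Rightarrow> coef (component D l) \<alpha>)" for Z :: "'k oper"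
  have inj: "inj_on (basis_at n :: _ \<Rightarrow> 'k oper) ?G"
    using inj_on_subset[OF inj_basis_at] D S by blast
  have c: "c (basis_at n z) = coef (component D (snd z)) (fst z)" if "z \<in> ?G" for z
    using inv_into_f_f[OF inj that] by (simp add: c_def split: prod.split)
  have "D = (\<lambda>p\<in>polys n. \<Sum>Z\<in>basis_at n ` ?G. Const (c Z) * Z p)"
  proof
    fix p show "D p = (\<lambda>p\<in>polys n. \<Sum>Z\<in>basis_at n ` ?G. Const (c Z) * Z p) p"
    proof (cases "p \<in> polys n")
      case True
      have "(\<Sum>Z\<in>basis_at n ` ?G. Const (c Z) * Z p) = (\<Sum>z\<in>?G. Const (c (basis_at n z)) * basis_at n z p)"
        using sum.reindex[OF inj, of "\<lambda>Z. Const (c Z) * Z p"] by simp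
      also have "\<dots> = (\<Sum>(\<alpha>, l)\<in>?G. single \<alpha> (coef (component D l) \<alpha>) * partial l p)"
      proof (rule sum.cong[OF refl])
        fix z assume z: "z \<in> ?G"
        have "Const (c (basis_at n z)) * basis_at n z p =
            Const (coef (component D (snd z)) (fst z)) * (single (fst z) 1 * partial (snd z) p)"
          unfolding c[OF z] using True by (simp add: basis_elt_def)
        then show "Const (c (basis_at n z)) * basis_at n z p =
            (case z of (\<alpha>, l) \<Rightarrow> single \<alpha> (coef (component D l) \<alpha>) * partial l p)"
          by (simp add: Const_def mult_single mult.assoc[symmetric] split: prod.split)
      qed
      also have "\<dots> = (\<Sum>(l, \<alpha>)\<in>Sigma {1..n} (\<lambda>l. supp (component D l)).
          single \<alpha> (coef (component D l) \<alpha>) * partial l p)"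
        by (rule sum.reindex_bij_witness[of _ prod.swap prod.swap]) (auto simp: support_def)
      also have "\<dots> = (\<Sum>l=1..n. \<Sum>\<alpha>\<in>supp (component D l). single \<alpha> (coef (component D l) \<alpha>) * partial l p)"
        by (rule sum.Sigma[symmetric]) auto
      also have "\<dots> = (\<Sum>l=1..n. component D l * partial l p)"
        by (simp add: sum_distrib_right[symmetric] mpoly_expand[symmetric])
      also have "\<dots> = D p"
        using True fun_cong[OF vf_comp[OF D(1)], of p] by (simp add: vf_def)
      finally show ?thesis
        using True by simp
    next
      case False
      then show ?thesis
        using fun_cong[OF vf_comp[OF D(1)], of p] by (simp add: vf_def)
    qed
  qed
  then show "D \<in> lin_span n (basis_at n ` S)"
    using D(2) finite_support[of n D] unfolding lin_span_def by blast
qed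

lemma I_ideal_eq_seg:
  assumes S: "down_closed n S" and r: "r =o ile S"
  shows "I_ideal n r = (seg n S :: 'k::field_char_0 oper set)"
proof -
  have "ord_type n (basis_at n z :: 'k oper) \<le>o r \<longleftrightarrow> z \<in> S" if z: "z \<in> basis_index n" for z
    using ord_type_ordIso[OF z, where 'k='k] r ile_ordLeq_iff[OF S z]
    by (meson ordIso_ordLeq_trans ordIso_symmetric ordLeq_ordIso_trans)
  then have "{Z \<in> u_basis n. ord_type n Z \<le>o r} = (basis_at n ` S :: 'k oper set)"
    using S unfolding u_basis_eq down_closed_def by blast
  then show ?thesis
    using lin_span_basis_at[of S n] S by (simp add: I_ideal_def down_closed_def)
qed

section \<open>Membership in ideals and the derived series\<close>

lemma mem_below_iff:
  assumes "D \<in> u_set n" "(\<alpha>, s) \<in> basis_index n"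
  shows "D \<in> below n (\<alpha>, s) \<longleftrightarrow>
    (\<forall>l\<in>{1..<s}. component D l = 0) \<and> (\<forall>\<beta>\<in>supp (component D s). mless (s - 1) \<beta> \<alpha>)"
proof
  assume D: "D \<in> below n (\<alpha>, s)"
  have *: "iless (\<beta>, l) (\<alpha>, s)" if "l \<in> {1..n}" "\<beta> \<in> supp (component D l)" for \<beta> l
    using D that unfolding seg_def preds_def support_def by blast
  have "component D l = 0" if "l \<in> {1..<s}" for l
  proof (rule ccontr)
    assume "component D l \<noteq> 0"
    then obtain \<beta> where "\<beta> \<in> supp (component D l)"
      using keys_eq_empty by blast
    then show False
      using *[of l \<beta>] that assms(2) by (auto simp: basis_index_def)
  qed
  then show "(\<forall>l\<in>{1..<s}. component D l = 0) \<and> (\<forall>\<beta>\<in>supp (component D s). mless (s - 1) \<beta> \<alpha>)"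
    using *[of s] assms(2) by (auto simp: basis_index_def)
next
  assume R: "(\<forall>l\<in>{1..<s}. component D l = 0) \<and> (\<forall>\<beta>\<in>supp (component D s). mless (s - 1) \<beta> \<alpha>)"
  have "z \<in> preds n (\<alpha>, s)" if z: "z \<in> support n D" for z
  proof -
    obtain \<beta> l where bl: "z = (\<beta>, l)" "l \<in> {1..n}" "\<beta> \<in> supp (component D l)"
      using z by (auto simp: support_def)
    then have "\<not> l < s"
      using R by (metis atLeastAtMost_iff atLeastLessThan_iff empty_iff keys_eq_empty)
    then have "iless z (\<alpha>, s)"
      using R bl by (cases "l = s") auto
    then show ?thesis
      using support_basis[OF assms(1)] z by (auto simp: preds_def)
  qed
  then show "D \<in> below n (\<alpha>, s)"
    using assms(1) by (auto simp: seg_def)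
qed

text \<open>The basis element \<open>z\<close> itself separates \<open>below n y\<close> from \<open>below n z\<close> if \<open>z < y\<close>.\<close>

lemma below_subset_iff:
  assumes y: "y \<in> basis_index n" and z: "z \<in> basis_index n"
  shows "below n y \<subseteq> (below n z :: 'k::field_char_0 oper set) \<longleftrightarrow> y = z \<or> iless y z"
proof
  assume "y = z \<or> iless y z"
  then show "below n y \<subseteq> (below n z :: 'k oper set)"
    using iless_trans unfolding seg_def preds_def by blast
next
  assume sub: "below n y \<subseteq> (below n z :: 'k oper set)"
  show "y = z \<or> iless y z"
  proof (rule ccontr)
    assume "\<not> ?thesis"
    then have "iless z y"
      using iless_total[OF y z] by blast
    moreover obtain \<alpha> i where zi: "z = (\<alpha>, i)" by (cases z)
    moreover have i: "i \<in> {1..n}"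
      using z basis_index_range unfolding zi by blast
    have "support n (basis_at n z :: 'k oper) = {z}"
      using i by (auto simp: support_def zi component_basis_elt split: if_splits simp del: One_nat_def)
    ultimately have "(basis_at n z :: 'k oper) \<in> below n y"
      using basis_at_mem[OF z] z by (auto simp: seg_def preds_def)
    then have "z \<in> preds n z"
      using sub \<open>support n (basis_at n z :: 'k oper) = {z}\<close> by (auto simp: seg_def)
    then show False
      by (simp add: preds_def)
  qed
qed

text \<open>An element whose first \<open>k + 1\<close> components vanish is the bracket of \<open>\<partial>\<^sub>k\<^sub>+\<^sub>1\<close> with the derivation
obtained by integrating all its components with respect to \<open>x\<^sub>k\<^sub>+\<^sub>1\<close>.\<close>

lemma mem_derived_iff:
  fixes D :: "'k::field_char_0 oper"
  shows "k \<le> n \<Longrightarrow> D \<in> derived (u_alg n) k \<longleftrightarrow> D \<in> u_set n \<and> (\<forall>l\<in>{1..k}. component D l = 0)"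
proof (induction k arbitrary: D)
  case 0
  then show ?case by auto
next
  case (Suc k)
  have IH: "D \<in> derived (u_alg n) k \<longleftrightarrow> D \<in> u_set n \<and> (\<forall>l\<in>{1..k}. component D l = 0)"
    for D :: "'k oper"
    using Suc by simp
  show ?case
  proof
    assume "D \<in> derived (u_alg n) (Suc k)"
    then obtain E F where EF: "E \<in> derived (u_alg n) k" "F \<in> derived (u_alg n) k"
      and D: "D = lie_bracket (u_alg n) E F" by auto
    have E: "E \<in> u_set n" "\<And>l. l \<in> {1..k} \<Longrightarrow> component E l = 0"
      and F: "F \<in> u_set n" "\<And>l. l \<in> {1..k} \<Longrightarrow> component F l = 0"
      using EF unfolding IH by blast+
    have "component D l = 0" if "l \<in> {1..Suc k}" for l
    proof -
      have "act l (component E) p = 0" "act l (component F) p = 0" for p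
        using that by (auto intro!: act_eq_0 E(2) F(2))
      then show ?thesis
        using that Suc.prems E(1) F(1) by (simp add: D comp_bracket)
    qed
    then show "D \<in> u_set n \<and> (\<forall>l\<in>{1..Suc k}. component D l = 0)"
      using E F u_bracket D by blast
  next
    assume "D \<in> u_set n \<and> (\<forall>l\<in>{1..Suc k}. component D l = 0)"
    then have D: "D \<in> u_set n" "\<And>l. l \<in> {1..Suc k} \<Longrightarrow> component D l = 0"
      by blast+
    have k: "Suc k \<in> {1..n}"
      using Suc.prems by auto
    have "\<exists>q. q \<in> polys (l - 1) \<and> partial (Suc k) q = component D l" if l: "l \<in> {Suc k<..n}" for l
    proof -
      have "component D l \<in> polys (l - 1)" "Suc k \<in> {1..l - 1}"
        using l comp_polys[OF D(1), of l] by auto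
      then show ?thesis
        by (rule antiderivative) blast
    qed
    then obtain q where q: "\<And>l. l \<in> {Suc k<..n} \<Longrightarrow> q l \<in> polys (l - 1) \<and> partial (Suc k) (q l) = component D l"
      by metis
    define E where "E = vf n (\<lambda>l. if l \<le> Suc k then 0 else q l)"
    have E: "E \<in> u_set n"
      unfolding E_def using q by (intro vf_mem) auto
    have compE: "component E l = (if l \<le> Suc k then 0 else q l)" if "l \<in> {1..n}" for l
      using that unfolding E_def by (rule comp_vf)
    have one: "(1 :: 'k mpoly) \<in> polys (Suc k - 1)"
      using polys_Const[of 1] by simp
    note mem = vf_single_mem[OF one, of n]
    have "D = lie_bracket (u_alg n) (vf_single n 1 (Suc k)) E"
    proof (rule u_eqI[OF D(1) u_bracket[OF mem E]])
      fix l assume l: "l \<in> {1..n}"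
      have "component (lie_bracket (u_alg n) (vf_single n 1 (Suc k)) E) l =
         (if Suc k < l then partial (Suc k) (component E l) else 0)"
        using comp_bracket_vf_single[OF one E l k] act_Const[of "Suc k" "component E" 1] by auto
      then show "component D l = component (lie_bracket (u_alg n) (vf_single n 1 (Suc k)) E) l"
        using compE[OF l] q[of l] D(2)[of l] l by auto
    qed
    moreover have "vf_single n (1 :: 'k mpoly) (Suc k) \<in> derived (u_alg n) k"
      unfolding IH using mem k comp_vf_single[of _ n "1 :: 'k mpoly" "Suc k"] by auto
    moreover have "E \<in> derived (u_alg n) k"
      unfolding IH using E k compE by auto
    ultimately show "D \<in> derived (u_alg n) (Suc k)"
      by auto
  qed
qed

section \<open>Correspondences between quotients of different algebras\<close>

abbreviation ipartial :: "nat \<Rightarrow> nat \<Rightarrow> 'k::field_char_0 oper" where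
  "ipartial k i \<equiv> partial k ^^ i"

lemma ipartial_add: "ipartial k i (p + q) = ipartial k i p + ipartial k i q"
  and ipartial_minus: "ipartial k i (p - q) = ipartial k i p - ipartial k i q"
  and ipartial_zero: "ipartial k i 0 = 0"
  and ipartial_Const_mult: "ipartial k i (Const c * p) = Const c * ipartial k i p"
  by (induction i) (simp_all add: partial_add partial_minus partial_Const_mult)

lemma supp_ipartial: "\<beta> \<in> supp (ipartial k i p) \<longleftrightarrow> \<beta> + single k i \<in> supp p"
proof (induction i arbitrary: \<beta>)
  case (Suc i)
  then show ?case
    by (simp add: supp_partial add.assoc flip: single_add)
qed simp

lemma iterated_antiderivative:
  assumes "k \<in> {1..n}"
  shows "p \<in> polys n \<Longrightarrow> \<exists>q\<in>polys n. ipartial k j q = p"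
proof (induction j arbitrary: p)
  case (Suc j)
  obtain p' where "p' \<in> polys n" "partial k p' = p"
    using antiderivative[OF Suc.prems assms] by blast
  then show ?case
    using Suc.IH[of p'] by auto
qed auto

text \<open>The coefficients \<open>f k\<close> with \<open>k < s\<close> do not contain \<open>x\<^sub>s\<^sub>-\<^sub>1\<close>, so they are constants for
\<open>\<partial>\<^sub>s\<^sub>-\<^sub>1\<close>.\<close>

lemma partial_act:
  assumes "\<And>k. k \<in> {1..<s} \<Longrightarrow> f k \<in> polys (k - 1)" "s \<ge> 2"
  shows "partial (s - 1) (act s f p) = act s f (partial (s - 1) p)"
  unfolding act_def partial_sum
proof (rule sum.cong[OF refl])
  fix k assume k: "k \<in> {1..<s}"
  then have "partial (s - 1) (f k) = 0"
    using assms(1)[OF k] by (intro partial_polys_eq_0[of _ "k - 1"]) auto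
  then show "partial (s - 1) (f k * partial k p) = f k * partial k (partial (s - 1) p)"
    by (simp only: partial_mult partial_commute[of "s - 1" k p]) simp
qed

lemma ipartial_act:
  assumes "\<And>k. k \<in> {1..<s} \<Longrightarrow> f k \<in> polys (k - 1)" "s \<ge> 2"
  shows "ipartial (s - 1) i (act s f p) = act s f (ipartial (s - 1) i p)"
proof (induction i)
  case (Suc i)
  have "ipartial (s - 1) (Suc i) (act s f p) = partial (s - 1) (ipartial (s - 1) i (act s f p))"
    by simp
  also have "\<dots> = partial (s - 1) (act s f (ipartial (s - 1) i p))"
    unfolding Suc.IH ..
  also have "\<dots> = act s f (partial (s - 1) (ipartial (s - 1) i p))"
    using assms by (rule partial_act)
  finally show ?case
    by simp
qed simp

text \<open>Among the polynomials in \<open>x\<^sub>1, \<dots>, x\<^sub>s\<^sub>-\<^sub>1\<close>, these are the \<open>s\<close>-th components of the elements of the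
ideal \<open>below s (\<sigma>, s)\<close> of \<open>u_alg s\<close>.\<close>

definition lower :: "nat \<Rightarrow> expo \<Rightarrow> 'k::field_char_0 mpoly set" where
  "lower s \<sigma> = {p. \<forall>\<beta>\<in>supp p. mless (s - 1) \<beta> \<sigma>}"

lemma lower_zero: "0 \<in> lower s \<sigma>"
  by (simp add: lower_def)

lemma lower_add: "p \<in> lower s \<sigma> \<Longrightarrow> q \<in> lower s \<sigma> \<Longrightarrow> p + q \<in> lower s \<sigma>"
  using keys_add[of p q] by (auto simp: lower_def)

lemma lower_minus: "p \<in> lower s \<sigma> \<Longrightarrow> q \<in> lower s \<sigma> \<Longrightarrow> p - q \<in> lower s \<sigma>"
  using keys_diff[of p q] by (auto simp: lower_def)

lemma lower_uminus_iff: "0 - p \<in> lower s \<sigma> \<longleftrightarrow> p \<in> lower s \<sigma>"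
  by (simp add: lower_def supp_iff)

lemma lower_Const_mult: "p \<in> lower s \<sigma> \<Longrightarrow> Const c * p \<in> lower s \<sigma>"
  by (auto simp: lower_def supp_iff coef_Const_mult)

lemma lower_act:
  assumes "\<And>k. k \<in> {1..<s} \<Longrightarrow> f k \<in> polys (k - 1)" "p \<in> lower s \<sigma>"
  shows "act s f p \<in> lower s \<sigma>"
  unfolding lower_def
proof (intro CollectI ballI)
  fix \<gamma> assume "\<gamma> \<in> supp (act s f p)"
  then obtain k \<delta> \<beta> where k: "k \<in> {1..<s}" "\<delta> \<in> supp (f k)" "\<beta> + single k 1 \<in> supp p" "\<gamma> = \<delta> + \<beta>"
    by (rule supp_actE)
  then have "supp \<delta> \<subseteq> {1..k - 1}" "k \<in> {1..s - 1}"
    using assms(1)[OF k(1)] by (auto simp: polys_iff)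
  then have "mless (s - 1) \<gamma> (\<beta> + single k 1)"
    using mless_lower[of k "s - 1" \<delta> \<beta>] k(4) by (simp only: add.commute[of \<delta>])
  then show "mless (s - 1) \<gamma> \<sigma>"
    using assms(2) k(3) mless_trans unfolding lower_def by blast
qed

text \<open>Differentiating \<open>i\<close> times with respect to \<open>x\<^sub>s\<^sub>-\<^sub>1\<close> kills the first \<open>i\<close> slices and shifts the others
down by \<open>i\<close>.\<close>

lemma ipartial_lower_iff:
  assumes "s \<ge> 2"
  shows "ipartial (s - 1) i p \<in> lower s \<sigma> \<longleftrightarrow> (\<forall>\<beta>\<in>supp p. mless (s - 1) \<beta> (\<sigma> + single (s - 1) i))"
proof
  assume L: "ipartial (s - 1) i p \<in> lower s \<sigma>"
  show "\<forall>\<beta>\<in>supp p. mless (s - 1) \<beta> (\<sigma> + single (s - 1) i)"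
  proof
    fix \<beta> assume \<beta>: "\<beta> \<in> supp p"
    show "mless (s - 1) \<beta> (\<sigma> + single (s - 1) i)"
    proof (cases "i \<le> coef \<beta> (s - 1)")
      case True
      define \<gamma> where "\<gamma> = \<beta> - single (s - 1) i"
      have \<gamma>: "\<beta> = \<gamma> + single (s - 1) i"
        unfolding \<gamma>_def using True
        by (intro poly_mapping_eqI) (auto simp: lookup_add lookup_minus lookup_single when_def)
      then have "\<gamma> \<in> supp (ipartial (s - 1) i p)"
        using \<beta> unfolding supp_ipartial by simp
      then show ?thesis
        using L unfolding lower_def \<gamma> mless_add_cancel by blast
    next
      case False
      then show ?thesis
        using assms by (simp add: mless_top lookup_add del: One_nat_def)
    qed
  qed
next
  assume less: "\<forall>\<beta>\<in>supp p. mless (s - 1) \<beta> (\<sigma> + single (s - 1) i)"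
  have "mless (s - 1) \<beta> \<sigma>" if "\<beta> \<in> supp (ipartial (s - 1) i p)" for \<beta>
  proof -
    have "mless (s - 1) (\<beta> + single (s - 1) i) (\<sigma> + single (s - 1) i)"
      using less that unfolding supp_ipartial by blast
    then show ?thesis
      by (simp only: mless_add_cancel)
  qed
  then show "ipartial (s - 1) i p \<in> lower s \<sigma>"
    unfolding lower_def by blast
qed

text \<open>The fibre product of the two homomorphisms \<open>D \<mapsto> (D\<^sub>1, \<dots>, D\<^sub>s\<^sub>-\<^sub>1, \<partial>\<^sub>s\<^sub>-\<^sub>1\<^sup>i D\<^sub>s)\<close> and
\<open>D \<mapsto> (D\<^sub>1, \<dots>, D\<^sub>s\<^sub>-\<^sub>1, \<partial>\<^sub>s\<^sub>-\<^sub>1\<^sup>j D\<^sub>s)\<close> over the quotient of \<open>u_alg s\<close> by \<open>below s (\<sigma>, s)\<close>.\<close>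

definition shift_corr ::
  "nat \<Rightarrow> nat \<Rightarrow> nat \<Rightarrow> expo \<Rightarrow> nat \<Rightarrow> nat \<Rightarrow> ('k::field_char_0 oper \<times> 'k oper) set"
  where "shift_corr n m s \<sigma> i j = {(x, y). x \<in> u_set n \<and> y \<in> u_set m \<and>
    (\<forall>l\<in>{1..<s}. component x l = component y l) \<and>
    ipartial (s - 1) i (component x s) - ipartial (s - 1) j (component y s) \<in> lower s \<sigma>}"

lemma shift_corr_swap:
  assumes "(x, y) \<in> shift_corr n m s \<sigma> i j"
  shows "(y, x) \<in> shift_corr m n s \<sigma> j i"
proof -
  have xy: "x \<in> u_set n" "y \<in> u_set m" "\<And>l. l \<in> {1..<s} \<Longrightarrow> component x l = component y l"
    and low: "ipartial (s - 1) i (component x s) - ipartial (s - 1) j (component y s) \<in> lower s \<sigma>"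
    using assms by (simp_all add: shift_corr_def)
  have "ipartial (s - 1) j (component y s) - ipartial (s - 1) i (component x s) \<in> lower s \<sigma>"
    using low lower_uminus_iff[of "ipartial (s - 1) i (component x s) - ipartial (s - 1) j (component y s)" s \<sigma>]
    by simp
  with xy show ?thesis
    unfolding shift_corr_def by simp
qed

lemma shift_corr_sym: "(x, y) \<in> shift_corr n m s \<sigma> i j \<longleftrightarrow> (y, x) \<in> shift_corr m n s \<sigma> j i"
  using shift_corr_swap by blast

text \<open>Surjectivity of \<open>\<partial>\<^sub>s\<^sub>-\<^sub>1\<close> provides a partner whose \<open>s\<close>-th component is an iterated integral.\<close>

lemma shift_corr_total:
  assumes s: "s \<in> {2..n}" "s \<in> {2..m}" and x: "x \<in> u_set n"
  shows "\<exists>y. (x, y) \<in> shift_corr n m s \<sigma> i j"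
proof -
  have "ipartial (s - 1) i (component x s) \<in> polys (s - 1)"
    using comp_polys[OF x, of s] s by (induction i) (auto simp del: One_nat_def)
  then obtain q where q: "q \<in> polys (s - 1)" "ipartial (s - 1) j q = ipartial (s - 1) i (component x s)"
    using iterated_antiderivative[of "s - 1" "s - 1"] s by fastforce
  define f where "f l = (if l < s then component x l else if l = s then q else 0)" for l
  have "vf m f \<in> u_set m"
    unfolding f_def using q(1) s comp_polys[OF x] by (intro vf_mem) auto
  moreover have "component (vf m f) l = f l" if "l \<in> {1..s}" for l
    using that s by (intro comp_vf) auto
  ultimately have "(x, vf m f) \<in> shift_corr n m s \<sigma> i j"
    using x s q(2) by (auto simp: shift_corr_def f_def lower_zero)
  then show ?thesis by blast
qed

lemma shift_corr_zero:
  fixes x :: "'k::field_char_0 oper"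
  assumes s: "s \<in> {2..n}" "s \<in> {2..m}" and \<sigma>: "supp \<sigma> \<subseteq> {1..s - 2}" and x: "x \<in> u_set n"
  shows "(x, lie_zero (u_alg m)) \<in> shift_corr n m s \<sigma> i j \<longleftrightarrow> x \<in> below n (\<sigma> + single (s - 1) i, s)"
proof -
  have "(\<sigma> + single (s - 1) i, s) \<in> basis_index n"
    using s \<sigma> by (fastforce simp: basis_index_def supp_expo_add split: if_splits)
  then have "x \<in> below n (\<sigma> + single (s - 1) i, s) \<longleftrightarrow>
      (\<forall>l\<in>{1..<s}. component x l = 0) \<and> ipartial (s - 1) i (component x s) \<in> lower s \<sigma>"
    using s by (simp only: mem_below_iff[OF x] ipartial_lower_iff atLeastAtMost_iff)
  moreover have zero: "component (lie_zero (u_alg m)) l = (0 :: 'k mpoly)" if "l \<in> {1..s}" for l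
    using that s by (intro comp_zero) auto
  ultimately show ?thesis
    using s x zero[of s] by (simp add: shift_corr_def ipartial_zero u_zero)
qed

lemma shift_corr_lie_corr:
  fixes n m s :: nat
  assumes s: "s \<in> {2..n}" "s \<in> {2..m}" and \<sigma>: "supp \<sigma> \<subseteq> {1..s - 2}"
  shows "lie_corr (u_alg n :: ('k::field_char_0, 'k oper) lie_struct) (below n (\<sigma> + single (s - 1) i, s))
    (u_alg m) (below m (\<sigma> + single (s - 1) j, s)) (shift_corr n m s \<sigma> i j)"
proof (rule lie_corrI)
  let ?R = "shift_corr n m s \<sigma> i j :: ('k oper \<times> 'k oper) set"
  show "x \<in> u_set n \<and> y \<in> u_set m" if "(x, y) \<in> ?R" for x y
    using that by (auto simp: shift_corr_def)
  show "\<exists>y. (x, y) \<in> ?R" if "x \<in> u_set n" for x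
    using shift_corr_total[OF s that] .
  show "\<exists>x. (x, y) \<in> ?R" if "y \<in> u_set m" for y
    using shift_corr_total[OF s(2,1) that] shift_corr_sym by blast
  show "(x, lie_zero (u_alg m)) \<in> ?R \<longleftrightarrow> x \<in> below n (\<sigma> + single (s - 1) i, s)" if "x \<in> u_set n" for x
    using shift_corr_zero[OF s \<sigma> that] .
  show "(lie_zero (u_alg n), y) \<in> ?R \<longleftrightarrow> y \<in> below m (\<sigma> + single (s - 1) j, s)" if "y \<in> u_set m" for y
    using shift_corr_zero[OF s(2,1) \<sigma> that] shift_corr_sym by blast
  have ln: "l \<in> {1..n} \<and> l \<in> {1..m}" if "l \<in> {1..s}" for l
    using that s by auto
  show "(lie_scale (u_alg n) c x, lie_scale (u_alg m) c y) \<in> ?R" if xy: "(x, y) \<in> ?R" for c x y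
  proof -
    have "component (lie_scale (u_alg n) c x) l = Const c * component x l"
      "component (lie_scale (u_alg m) c y) l = Const c * component y l" if "l \<in> {1..s}" for l
      using ln[OF that] xy by (auto simp: shift_corr_def comp_scale simp del: One_nat_def)
    then show ?thesis
      using xy s by (auto simp: shift_corr_def u_scale ipartial_Const_mult lower_Const_mult
          right_diff_distrib[symmetric])
  qed
  fix x y x' y' :: "'k oper" assume R: "(x, y) \<in> ?R" "(x', y') \<in> ?R"
  have un: "x \<in> u_set n" "y \<in> u_set m" "x' \<in> u_set n" "y' \<in> u_set m"
    and eq: "\<And>l. l \<in> {1..<s} \<Longrightarrow> component x l = component y l"
      "\<And>l. l \<in> {1..<s} \<Longrightarrow> component x' l = component y' l"
    and low: "ipartial (s - 1) i (component x s) - ipartial (s - 1) j (component y s) \<in> lower s \<sigma>"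
      "ipartial (s - 1) i (component x' s) - ipartial (s - 1) j (component y' s) \<in> lower s \<sigma>"
    using R by (auto simp: shift_corr_def)
  have ss: "s \<in> {1..n}" "s \<in> {1..m}" "2 \<le> s"
    using s by auto
  show "(lie_add (u_alg n) x x', lie_add (u_alg m) y y') \<in> ?R"
  proof -
    have "component (lie_add (u_alg n) x x') l = component x l + component x' l"
      "component (lie_add (u_alg m) y y') l = component y l + component y' l" if "l \<in> {1..s}" for l
      using ln[OF that] un by (auto simp: comp_add simp del: One_nat_def)
    then show ?thesis
      using un eq s lower_add[OF low]
      by (auto simp: shift_corr_def u_add ipartial_add algebra_simps)
  qed
  show "(lie_bracket (u_alg n) x x', lie_bracket (u_alg m) y y') \<in> ?R"
  proof -
    have act_eq: "act l (component x) p = act l (component y) p" 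
      "act l (component x') p = act l (component y') p" if "l \<in> {1..s}" for l p
      using that eq by (auto intro!: act_cong)
    have polys: "component x k \<in> polys (k - 1)" "component x' k \<in> polys (k - 1)" 
       if "k \<in> {1..<s}" for k
      using comp_polys[OF un(1), of k] comp_polys[OF un(3), of k] that ss by auto
    have "component (lie_bracket (u_alg n) x x') l = component (lie_bracket (u_alg m) y y') l"
      if "l \<in> {1..<s}" for l
      using ln[of l] that un eq[OF that] by (simp add: comp_bracket act_eq del: One_nat_def)
    moreover have "ipartial (s - 1) i (component (lie_bracket (u_alg n) x x') s) -
         ipartial (s - 1) j (component (lie_bracket (u_alg m) y y') s) \<in> lower s \<sigma>"
    proof -
      let ?p = "ipartial (s - 1) i (component x s) - ipartial (s - 1) j (component y s)"
      let ?p' = "ipartial (s - 1) i (component x' s) - ipartial (s - 1) j (component y' s)"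
      have polys': "component y k \<in> polys (k - 1)" "component y' k \<in> polys (k - 1)"
        if "k \<in> {1..<s}" for k
        using polys[OF that] eq[OF that] by simp_all
      have x: "ipartial (s - 1) i (component (lie_bracket (u_alg n) x x') s) =
          act s (component x) (ipartial (s - 1) i (component x' s)) -
          act s (component x') (ipartial (s - 1) i (component x s))"
        by (simp only: comp_bracket[OF un(1,3) ss(1)] ipartial_minus
            ipartial_act[OF polys(1) ss(3)] ipartial_act[OF polys(2) ss(3)])
      have y: "ipartial (s - 1) j (component (lie_bracket (u_alg m) y y') s) =
          act s (component y) (ipartial (s - 1) j (component y' s)) -
          act s (component y') (ipartial (s - 1) j (component y s))"
        by (simp only: comp_bracket[OF un(2,4) ss(2)] ipartial_minus
            ipartial_act[OF polys'(1) ss(3)] ipartial_act[OF polys'(2) ss(3)])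
      have "act s (component y) p = act s (component x) p" "act s (component y') p = act s (component x') p" for p
        using act_eq[of s p] ss by auto
      then have "ipartial (s - 1) i (component (lie_bracket (u_alg n) x x') s) -
         ipartial (s - 1) j (component (lie_bracket (u_alg m) y y') s) =
         act s (component x) ?p' - act s (component x') ?p"
        unfolding x y by (simp add: act_minus)
      then show ?thesis
        using lower_minus[OF lower_act[OF polys(1) low(2)] lower_act[OF polys(2) low(1)]] by simp
    qed
    ultimately show ?thesis
      using un by (simp add: shift_corr_def u_bracket)
  qed
qed

lemma mem_below_1_iff: 
  assumes "n \<ge> 1" "D \<in> u_set n"
  shows "D \<in> below n (0, 1) \<longleftrightarrow> component D 1 = 0"
proof -
  have "(0, 1) \<in> basis_index n"
    using assms by (simp add: basis_index_def)
  then have "D \<in> below n (0, 1) \<longleftrightarrow> supp (component D 1) = {}"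
    using assms by (subst mem_below_iff) auto
  then show ?thesis
    by simp
qed

text \<open>Both quotients are one-dimensional; the first component is a constant and vanishes on brackets.\<close>

lemma first_component_lie_corr:
  assumes nm: "n \<ge> 1" "m \<ge> 1"
  shows "lie_corr (u_alg n :: ('k::field_char_0, 'k oper) lie_struct) (below n (0, 1)) (u_alg m) (below m (0, 1))
    {(x, y). x \<in> u_set n \<and> y \<in> u_set m \<and> component x 1 = component y 1}"
proof -
  have ex: "\<exists>y. y \<in> u_set m \<and> component x 1 = component y 1"
    if "n \<ge> 1" "m \<ge> 1" "x \<in> u_set n" for n m and x :: "'k oper"
  proof (intro exI conjI)
    show "vf m (\<lambda>l. if l = 1 then component x 1 else 0) \<in> u_set m"
      using that comp_polys[OF that(3), of 1] by (intro vf_mem) auto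
    show "component x 1 = component (vf m (\<lambda>l. if l = 1 then component x 1 else 0)) 1"
      using that by (simp add: comp_vf)
  qed
  have br: "component (lie_bracket (u_alg n) x y) 1 = 0" if "n \<ge> 1" "x \<in> u_set n" "y \<in> u_set n" 
    for n and x y :: "'k oper"
    using that comp_bracket[of x n y 1] by (simp add: act_def)
  have one: "1 \<in> {1..n}" "1 \<in> {1..m}"
    using nm by auto
  show ?thesis
  proof (rule lie_corrI)
    fix x :: "'k oper" assume "x \<in> u_set n"
    then show "\<exists>y. (x, y) \<in> {(x, y). x \<in> u_set n \<and> y \<in> u_set m \<and> component x 1 = component y 1}"
      "(x, lie_zero (u_alg m)) \<in> {(x, y). x \<in> u_set n \<and> y \<in> u_set m \<and> component x 1 = component y 1}
        \<longleftrightarrow> x \<in> below n (0, 1)"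
      using ex[OF nm, of x] nm one(2) u_zero[of m]
      by (simp_all only: mem_below_1_iff comp_zero mem_Collect_eq prod.case) auto
  next
    fix y :: "'k oper" assume "y \<in> u_set m"
    then show "\<exists>x. (x, y) \<in> {(x, y). x \<in> u_set n \<and> y \<in> u_set m \<and> component x 1 = component y 1}"
      "(lie_zero (u_alg n), y) \<in> {(x, y). x \<in> u_set n \<and> y \<in> u_set m \<and> component x 1 = component y 1}
        \<longleftrightarrow> y \<in> below m (0, 1)"
      using ex[OF nm(2,1), of y] nm one(1) u_zero[of n]
      by (simp_all only: mem_below_1_iff comp_zero mem_Collect_eq prod.case) auto
  qed (use one in \<open>auto simp: u_add u_scale u_bracket br[OF nm(1)] br[OF nm(2)] comp_add comp_scale
      simp del: One_nat_def\<close>)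
qed

lemma trivial_lie_corr: "lie_corr (u_alg n) (u_set n) (u_alg m) (u_set m) (u_set n \<times> u_set m)"
  using u_zero by (intro lie_corrI) (auto simp: u_add u_scale u_bracket)

section \<open>Centralizers\<close>

lemma shift_index:
  fixes s :: nat
  assumes "s \<in> {2..n}" "supp \<sigma> \<subseteq> {1..s - 2}"
  shows "(\<sigma> + single (s - 1) i, s) \<in> basis_index n"
  using assms by (fastforce simp: basis_index_def supp_expo_add split: if_splits)

lemma lower_coord:
  fixes s :: nat
  assumes "2 \<le> s" "supp \<sigma> \<subseteq> {1..s - 2}"
  shows "coef \<sigma> (s - 1) = 0"
proof -
  have "s - 1 \<notin> {1..s - 2}"
    using assms(1) by auto
  then show ?thesis
    using assms(2) unfolding supp_iff[of "s - 1" \<sigma>, symmetric] by (auto simp: in_keys_iff)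
qed

lemma eq_Const_if_partials_zero:
  assumes "p \<in> polys r" "\<And>k. k \<in> {1..r} \<Longrightarrow> partial k p = 0"
  shows "p = Const (coef p 0)"
proof (rule poly_mapping_eqI)
  fix \<alpha>
  have "coef p \<alpha> = 0" if "\<alpha> \<noteq> 0"
  proof (rule ccontr)
    assume "coef p \<alpha> \<noteq> 0"
    then have \<alpha>: "\<alpha> \<in> supp p"
      by (simp add: supp_iff)
    obtain k where k: "k \<in> supp \<alpha>"
      using \<open>\<alpha> \<noteq> 0\<close> keys_eq_empty by blast
    then have "\<alpha> - single k 1 \<in> supp (partial k p)"
      using \<alpha> expo_diff_add_single[of \<alpha> k] unfolding supp_partial by (simp add: supp_iff)
    moreover have "k \<in> {1..r}"
      using assms(1) k \<alpha> unfolding polys_iff by blast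
    then have "partial k p = 0"
      by (rule assms(2))
    ultimately show False
      by simp
  qed
  then show "coef p \<alpha> = coef (Const (coef p 0)) \<alpha>"
    by (auto simp: Const_def lookup_single when_def)
qed

text \<open>When the components of \<open>x\<close> before \<open>s\<close> vanish, the \<open>s\<close>-th component of a bracket only sees the
action of \<open>q\<close> on that of \<open>x\<close>.\<close>

lemma bracket_vanishing:
  assumes x: "x \<in> u_set n" "\<And>k. k \<in> {1..<s} \<Longrightarrow> component x k = 0" and q: "q \<in> u_set n" and s: "s \<le> n"
  shows "l \<in> {1..<s} \<Longrightarrow> component (lie_bracket (u_alg n) q x) l = 0"
    and "1 \<le> s \<Longrightarrow> component (lie_bracket (u_alg n) q x) s = act s (component q) (component x s)"
proof -
  assume l: "l \<in> {1..<s}"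
  have "act l (component x) p = 0" for p
    using l x(2) by (intro act_eq_0) auto
  then show "component (lie_bracket (u_alg n) q x) l = 0"
    using comp_bracket[OF q x(1), of l] l s x(2)[OF l] by auto
next
  assume "1 \<le> s"
  have "act s (component x) p = 0" for p
    using x(2) by (intro act_eq_0) auto
  then show "component (lie_bracket (u_alg n) q x) s = act s (component q) (component x s)"
    using comp_bracket[OF q x(1), of s] \<open>1 \<le> s\<close> s by auto
qed

locale shifted_ideal =
  fixes n s :: nat and \<sigma> :: expo and i :: nat and I :: "'k::field_char_0 oper set"
  assumes s: "s \<in> {2..n}" and \<sigma>: "supp \<sigma> \<subseteq> {1..s - 2}"
  defines "I \<equiv> below n (\<sigma> + single (s - 1) i, s)"
begin

lemma s2: "2 \<le> s" and sn: "s \<in> {1..n}" and s1n: "s - 1 \<in> {1..n}"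
  using s by auto

lemma s_neq: "s \<noteq> s - 1" "s - 1 \<noteq> s"
  using s by auto

lemma coord: "coef \<sigma> (s - 1) = 0"
  using lower_coord[OF s2 \<sigma>] .

lemma mem_I:
  "D \<in> u_set n \<Longrightarrow> D \<in> I \<longleftrightarrow> (\<forall>l\<in>{1..<s}. component D l = 0) \<and>
     (\<forall>\<beta>\<in>supp (component D s). mless (s - 1) \<beta> (\<sigma> + single (s - 1) i))"
  unfolding I_def using shift_index[OF s \<sigma>] by (rule mem_below_iff[rotated])

lemma high_not_less:
  assumes "i < coef \<beta> (s - 1)"
  shows "\<not> mless (s - 1) \<beta> (\<sigma> + single (s - 1) i)"
  using assms s2 coord by (simp add: mless_top lookup_add del: One_nat_def)

text \<open>If the \<open>k\<close>-th component \<open>p\<close> of \<open>x\<close> is nonzero for some \<open>k < s\<close>, then \<open>x\<close> maps the monomial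
\<open>x\<^sub>k x\<^sub>s\<^sub>-\<^sub>1\<^sup>i\<^sup>+\<^sup>1\<close> to a nonzero multiple of \<open>p x\<^sub>s\<^sub>-\<^sub>1\<^sup>i\<^sup>+\<^sup>1\<close>, whose degree in \<open>x\<^sub>s\<^sub>-\<^sub>1\<close> is too high. The component
\<open>s - 1\<close> is treated first, as otherwise it would contribute a second term.\<close>

lemma components_vanish:
  assumes x: "x \<in> centralizer (u_alg n) I Y"
    and Y: "\<And>g. g \<in> polys (s - 1) \<Longrightarrow> vf_single n g s \<in> Y"
    and l: "l \<in> {1..<s}"
  shows "component x l = 0"
proof -
  have xn: "x \<in> u_set n"
    using x by (simp add: centralizer_def)
  have vanish: "component x k = 0" if k: "k \<in> {1..<s}"
    and others: "\<And>k'. k' \<in> {1..<s} \<Longrightarrow> k' \<noteq> k \<Longrightarrow> component x k' = 0 \<or> k' \<noteq> s - 1" for k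
  proof (rule ccontr)
    assume "component x k \<noteq> 0"
    then obtain \<delta> where \<delta>: "\<delta> \<in> supp (component x k)"
      using keys_eq_empty by blast
    \<comment> \<open>The test polynomial is \<open>x\<^sub>k x\<^sub>s\<^sub>-\<^sub>1\<^sup>i\<^sup>+\<^sup>1\<close>; after \<open>\<partial>\<^sub>k\<close> its degree in \<open>x\<^sub>s\<^sub>-\<^sub>1\<close> is still at least \<open>i + 1\<close>.\<close>
    define \<mu> where "\<mu> = single (s - 1) (Suc i)"
    define g :: "'k mpoly" where "g = single (single k 1 + \<mu>) 1"
    have g: "g \<in> polys (s - 1)"
      unfolding g_def \<mu>_def using k s2 by (intro polys_single) (auto simp: supp_expo_add split: if_splits)
    have B: "lie_bracket (u_alg n) (vf_single n g s) x \<in> I"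
      using x Y[OF g] by (auto simp: centralizer_def)
    have gn: "vf_single n g s \<in> u_set n"
      using g by (rule vf_single_mem)
    have "component (lie_bracket (u_alg n) (vf_single n g s) x) s = - act s (component x) g"
      using comp_bracket_vf_single[OF g xn sn sn] by simp
    moreover have "act s (component x) g = component x k * partial k g"
    proof (rule act_single_term[OF _ k])
      fix k' assume k': "k' \<in> {1..<s}" "k' \<noteq> k"
      show "component x k' * partial k' g = 0"
        using others[OF k'] k' by (auto simp: g_def \<mu>_def partial_single lookup_add lookup_single)
    qed
    moreover have "partial k g = single \<mu> (of_nat (Suc (coef \<mu> k)))"
      by (simp add: g_def partial_single lookup_add)
    ultimately have comp: "component (lie_bracket (u_alg n) (vf_single n g s) x) s =
        - (component x k * single \<mu> (of_nat (Suc (coef \<mu> k))))"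
      by simp
    have "coef (single \<mu> (of_nat (Suc (coef \<mu> k))) * component x k) (\<mu> + \<delta>) \<noteq> 0"
      unfolding coef_single_mult using \<delta> of_nat_neq_0[of "coef \<mu> k", where 'a='k] by (simp add: supp_iff del: of_nat_Suc)
    then have "\<mu> + \<delta> \<in> supp (component (lie_bracket (u_alg n) (vf_single n g s) x) s)"
      unfolding comp by (simp add: supp_iff mult.commute)
    then have "mless (s - 1) (\<mu> + \<delta>) (\<sigma> + single (s - 1) i)"
      using B mem_I[OF u_bracket[OF gn xn]] by blast
    moreover have "i < coef (\<mu> + \<delta>) (s - 1)"
      by (simp add: \<mu>_def lookup_add)
    ultimately show False
      using high_not_less by blast
  qed
  have top: "component x (s - 1) = 0"
    using s2 by (intro vanish) auto
  show ?thesis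
    using l top by (intro vanish) auto
qed

lemma vf_single_s_derived: 
  assumes "g \<in> polys (s - 1)"
  shows "vf_single n g s \<in> derived (u_alg n) (s - 1)" "vf_single n g s \<in> derived (u_alg n) (s - 2)"
proof -
  have "s - 1 \<le> n" "s - 2 \<le> n"
    using s by auto
  then show "vf_single n g s \<in> derived (u_alg n) (s - 1)" "vf_single n g s \<in> derived (u_alg n) (s - 2)"
    using vf_single_mem[OF assms] by (auto simp: mem_derived_iff comp_vf_single)
qed

lemma vf_single_pred_derived: 
  assumes "f \<in> polys (s - 2)"
  shows "vf_single n f (s - 1) \<in> u_set n" "vf_single n f (s - 1) \<in> derived (u_alg n) (s - 2)"
proof -
  have "s - 2 \<le> n" and eq: "s - 1 - 1 = s - 2"
    using s by auto
  then show "vf_single n f (s - 1) \<in> u_set n" "vf_single n f (s - 1) \<in> derived (u_alg n) (s - 2)"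
    using vf_single_mem[of f "s - 1" n] assms s2 by (auto simp: mem_derived_iff comp_vf_single eq)
qed

lemma comp_bracket_vf_single_pred:
  assumes "f \<in> polys (s - 2)" "x \<in> u_set n"
  shows "component (lie_bracket (u_alg n) (vf_single n f (s - 1)) x) s = f * partial (s - 1) (component x s)"
proof -
  have "f \<in> polys (s - 1 - 1)"
    using assms(1) by (simp add: diff_diff_left numeral_2_eq_2)
  then show ?thesis
    using comp_bracket_vf_single[OF _ assms(2) sn s1n, of f] s2 s_neq by (simp del: One_nat_def)
qed

lemma act_pred:
  assumes "\<And>k. k \<in> {1..s - 2} \<Longrightarrow> f k = 0"
  shows "act s f p = f (s - 1) * partial (s - 1) p"
  using assms s2 by (intro act_single_term) auto

lemma mless_pure_iff: "mless (s - 1) \<beta> (0 + single (s - 1) j) \<longleftrightarrow> coef \<beta> (s - 1) < j"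
proof -
  have "\<not> mless (s - 2) \<beta> (single (s - 1) j)"
    using s2 by (intro not_mless_le) (auto simp: lookup_single when_def)
  then show ?thesis
    using s2 by (simp add: mless_top del: One_nat_def)
qed

text \<open>The derived algebra contains \<open>f \<partial>\<^sub>s\<^sub>-\<^sub>1\<close> for all \<open>f\<close> in \<open>x\<^sub>1, \<dots>, x\<^sub>s\<^sub>-\<^sub>2\<close>. If the \<open>s\<close>-th component has
a monomial of degree greater than \<open>i\<close> in \<open>x\<^sub>s\<^sub>-\<^sub>1\<close>, then the choice \<open>f = x\<^sup>\<sigma>\<close> produces a monomial which is
not below \<open>\<sigma> + i e\<^sub>s\<^sub>-\<^sub>1\<close>. Conversely, these operators lower the degree in \<open>x\<^sub>s\<^sub>-\<^sub>1\<close>.\<close>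

lemma centralizer_derived:
  "centralizer (u_alg n) I (derived (u_alg n) (s - 2)) = below n (0 + single (s - 1) (Suc i), s)" (is "?C = ?B")
proof (intro set_eqI)
  fix x :: "'k oper"
  have mem_B: "x \<in> ?B \<longleftrightarrow> (\<forall>l\<in>{1..<s}. component x l = 0) \<and> (\<forall>\<beta>\<in>supp (component x s). coef \<beta> (s - 1) < Suc i)"
    if "x \<in> u_set n"
    using mem_below_iff[OF that shift_index[OF s, of 0 "Suc i"]] mless_pure_iff by simp
  show "x \<in> ?C \<longleftrightarrow> x \<in> ?B"
  proof
    assume x: "x \<in> ?C"
    then have xn: "x \<in> u_set n"
      by (simp add: centralizer_def)
    have "component x l = 0" if "l \<in> {1..<s}" for l
      using components_vanish[OF x vf_single_s_derived(2) that] .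
    moreover have "coef \<beta> (s - 1) < Suc i" if \<beta>: "\<beta> \<in> supp (component x s)" for \<beta>
    proof (rule ccontr)
      assume ge: "\<not> coef \<beta> (s - 1) < Suc i"
      define \<gamma> where "\<gamma> = \<beta> - single (s - 1) 1"
      have \<beta>\<gamma>: "\<beta> = \<gamma> + single (s - 1) 1"
        using ge expo_diff_add_single[of \<beta> "s - 1"] unfolding \<gamma>_def by simp
      have f: "(single \<sigma> 1 :: 'k mpoly) \<in> polys (s - 2)"
        using \<sigma> by (rule polys_single)
      let ?w = "vf_single n (single \<sigma> 1 :: 'k mpoly) (s - 1)"
      have "lie_bracket (u_alg n) ?w x \<in> I"
        using x vf_single_pred_derived(2)[OF f] by (auto simp: centralizer_def)
      moreover have "\<gamma> \<in> supp (partial (s - 1) (component x s))"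
        unfolding supp_partial using \<beta> \<beta>\<gamma> by simp
      then have "\<sigma> + \<gamma> \<in> supp (component (lie_bracket (u_alg n) ?w x) s)"
        unfolding comp_bracket_vf_single_pred[OF f xn] supp_single_mult by blast
      ultimately have "mless (s - 1) (\<sigma> + \<gamma>) (\<sigma> + single (s - 1) i)"
        using mem_I[OF u_bracket[OF vf_single_pred_derived(1)[OF f] xn]] by blast
      then have "mless (s - 1) \<gamma> (single (s - 1) i)"
        using mless_add_cancel[of "s - 1" \<gamma> \<sigma> "single (s - 1) i"] by (simp only: add.commute)
      moreover have "i \<le> coef \<gamma> (s - 1)"
        using ge \<beta>\<gamma> by (simp add: lookup_add)
      ultimately show False
        using mless_pure_iff[of \<gamma> i] by simp
    qed
    ultimately show "x \<in> ?B"
      using mem_B[OF xn] by blast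
  next
    assume B: "x \<in> ?B"
    then have xn: "x \<in> u_set n"
      by (simp add: seg_def)
    have x: "\<And>l. l \<in> {1..<s} \<Longrightarrow> component x l = 0"
      and xs: "\<And>\<beta>. \<beta> \<in> supp (component x s) \<Longrightarrow> coef \<beta> (s - 1) < Suc i"
      using B mem_B[OF xn] by blast+
    have "lie_bracket (u_alg n) q x \<in> I" if q: "q \<in> derived (u_alg n) (s - 2)" for q
    proof -
      have qn: "q \<in> u_set n" and q0: "\<And>k. k \<in> {1..s - 2} \<Longrightarrow> component q k = 0"
        using q mem_derived_iff[of "s - 2" n q] s by auto
      note br = bracket_vanishing[of x n s q, OF xn x qn]
      have "mless (s - 1) \<gamma> (\<sigma> + single (s - 1) i)"
        if \<gamma>: "\<gamma> \<in> supp (component (lie_bracket (u_alg n) q x) s)" for \<gamma>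
      proof -
        have "\<gamma> \<in> supp (component q (s - 1) * partial (s - 1) (component x s))"
          using \<gamma> br(2) act_pred[of "component q", OF q0] s by auto
        then obtain \<delta> \<beta> where *: "\<delta> \<in> supp (component q (s - 1))"
          "\<beta> + single (s - 1) 1 \<in> supp (component x s)" "\<gamma> = \<delta> + \<beta>"
          by (rule supp_mult_partialE)
        have "supp \<delta> \<subseteq> {1..s - 2}"
          using comp_polys[OF qn s1n] *(1) by (auto simp: polys_iff numeral_2_eq_2)
        then have "coef \<gamma> (s - 1) < i"
          using lower_coord[OF s2, of \<delta>] xs[OF *(2)] by (simp add: *(3) lookup_add)
        then show ?thesis
          using s2 by (simp add: mless_top lookup_add del: One_nat_def)
      qed
      then show ?thesis
        using mem_I[OF u_bracket[OF qn xn]] br(1) s by auto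
    qed
    then show "x \<in> ?C"
      using xn by (simp add: centralizer_def)
  qed
qed

lemma mem_derived_center:
  "vf_single n (1 :: 'k mpoly) (s - 1) \<in> derived_center (u_alg n) (s - 2)" (is ?A)
  "g \<in> polys (s - 1) \<Longrightarrow> vf_single n g s \<in> derived_center (u_alg n) (s - 2)"
proof -
  have Suc: "Suc (s - 2) = s - 1" and sn': "s - 1 \<le> n"
    using s by auto
  have *: "q \<in> derived_center (u_alg n) (s - 2)"
    if q: "q \<in> derived (u_alg n) (s - 2)" and c: "component q (s - 1) = Const c" for q c
  proof -
    have qn: "q \<in> u_set n" and q0: "\<And>k. k \<in> {1..s - 2} \<Longrightarrow> component q k = 0"
      using q mem_derived_iff[of "s - 2" n q] s by auto
    have "lie_bracket (u_alg n) z q \<in> derived (u_alg n) (Suc (s - 2))" if z: "z \<in> u_set n" for z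
      unfolding Suc mem_derived_iff[OF sn']
    proof (intro conjI ballI u_bracket z qn)
      fix l assume l: "l \<in> {1..s - 1}"
      have "act l (component q) p = 0" for p
        using l q0 by (intro act_eq_0) auto
      moreover have "act l (component z) (component q l) = 0"
      proof (cases "l = s - 1")
        case False
        then show ?thesis using l q0[of l] by auto
      qed (simp add: c del: One_nat_def)
      ultimately show "component (lie_bracket (u_alg n) z q) l = 0"
        using comp_bracket[OF z qn, of l] l s by auto
    qed
    then show ?thesis
      using q unfolding derived_center_def by blast
  qed
  show ?A
    using *[of "vf_single n (1 :: 'k mpoly) (s - 1)" 1] vf_single_pred_derived(2)[of "1 :: 'k mpoly"]
      polys_Const[of "1 :: 'k" "s - 2"] comp_vf_single[OF s1n, of "1 :: 'k mpoly" "s - 1"] by simp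
  show "vf_single n g s \<in> derived_center (u_alg n) (s - 2)" if g: "g \<in> polys (s - 1)"
    using *[of "vf_single n g s" 0] vf_single_s_derived(2)[OF g]
      comp_vf_single[OF s1n, of g s] s_neq by simp
qed

text \<open>The bracket with \<open>\<partial>\<^sub>k\<close> for \<open>k \<le> s - 2\<close> differentiates the component \<open>s - 1\<close>, which must therefore
be a constant.\<close>

lemma derived_center_const:
  fixes q :: "'k oper"
  assumes q: "q \<in> derived_center (u_alg n) (s - 2)"
  shows "q \<in> u_set n" "\<And>k. k \<in> {1..s - 2} \<Longrightarrow> component q k = 0" "\<exists>c. component q (s - 1) = Const c"
proof -
  have Suc: "Suc (s - 2) = s - 1" and sn': "s - 1 \<le> n"
    using s by auto
  have q': "q \<in> derived (u_alg n) (s - 2)"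
    using q by (simp add: derived_center_def)
  then show qn: "q \<in> u_set n"
    using mem_derived_iff[of "s - 2" n q] s by auto
  show "component q k = 0" if "k \<in> {1..s - 2}" for k
    using mem_derived_iff[of "s - 2" n q] s that q' by auto
  have p: "component q (s - 1) \<in> polys (s - 2)"
    using comp_polys[OF qn s1n] by (simp add: numeral_2_eq_2)
  have "partial k (component q (s - 1)) = 0" if k: "k \<in> {1..s - 2}" for k
  proof -
    have one: "(1 :: 'k mpoly) \<in> polys (k - 1)"
      using polys_Const[of 1] by simp
    have kn: "k \<in> {1..n}" and ks: "k < s - 1" "s - 1 \<noteq> k"
      using k s by auto
    have "lie_bracket (u_alg n) (vf_single n 1 k) q \<in> derived (u_alg n) (Suc (s - 2))"
      using q vf_single_mem[OF one] unfolding derived_center_def by blast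
    then have "component (lie_bracket (u_alg n) (vf_single n 1 k) q) (s - 1) = 0"
      using s2 unfolding Suc mem_derived_iff[OF sn'] by auto
    then show ?thesis
      using comp_bracket_vf_single[OF one qn s1n kn] ks by simp
  qed
  then show "\<exists>c. component q (s - 1) = Const c"
    using eq_Const_if_partials_zero[OF p] by blast
qed

text \<open>Up to components from \<open>s\<close> on, only the multiples of \<open>\<partial>\<^sub>s\<^sub>-\<^sub>1\<close> act, so the \<open>s\<close>-th component is
characterized by its derivative with respect to \<open>x\<^sub>s\<^sub>-\<^sub>1\<close> lying below \<open>\<sigma> + i e\<^sub>s\<^sub>-\<^sub>1\<close>.\<close>

lemma centralizer_derived_center:
  "centralizer (u_alg n) I (derived_center (u_alg n) (s - 2)) = below n (\<sigma> + single (s - 1) (Suc i), s)"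
  (is "?C = ?B")
proof (intro set_eqI)
  fix x :: "'k oper"
  have split: "\<sigma> + single (s - 1) (Suc i) = \<sigma> + single (s - 1) i + single (s - 1) 1"
    by (simp add: add.assoc flip: single_add)
  have mem_B: "x \<in> ?B \<longleftrightarrow> (\<forall>l\<in>{1..<s}. component x l = 0) \<and>
      (\<forall>\<beta>\<in>supp (component x s). mless (s - 1) \<beta> (\<sigma> + single (s - 1) (Suc i)))"
    if "x \<in> u_set n"
    using mem_below_iff[OF that shift_index[OF s \<sigma>]] .
  show "x \<in> ?C \<longleftrightarrow> x \<in> ?B"
  proof
    assume x: "x \<in> ?C"
    then have xn: "x \<in> u_set n"
      by (simp add: centralizer_def)
    have "component x l = 0" if "l \<in> {1..<s}" for l
      using components_vanish[OF x mem_derived_center(2) that] .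
    moreover have "mless (s - 1) \<beta> (\<sigma> + single (s - 1) (Suc i))" if \<beta>: "\<beta> \<in> supp (component x s)" for \<beta>
    proof (cases "coef \<beta> (s - 1) = 0")
      case True
      then show ?thesis
        using s2 by (simp add: mless_top lookup_add del: One_nat_def)
    next
      case False
      define \<gamma> where "\<gamma> = \<beta> - single (s - 1) 1"
      have \<beta>\<gamma>: "\<beta> = \<gamma> + single (s - 1) 1"
        using False expo_diff_add_single[of \<beta> "s - 1"] unfolding \<gamma>_def by simp
      have one: "(1 :: 'k mpoly) \<in> polys (s - 2)"
        using polys_Const[of 1] by simp
      let ?w = "vf_single n (1 :: 'k mpoly) (s - 1)"
      have "lie_bracket (u_alg n) ?w x \<in> I"
        using x mem_derived_center(1) by (auto simp: centralizer_def)
      moreover have "component (lie_bracket (u_alg n) ?w x) s = partial (s - 1) (component x s)"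
        using comp_bracket_vf_single_pred[OF one xn] by simp
      moreover have "\<gamma> \<in> supp (partial (s - 1) (component x s))"
        unfolding supp_partial using \<beta> \<beta>\<gamma> by simp
      ultimately have "mless (s - 1) \<gamma> (\<sigma> + single (s - 1) i)"
        using mem_I[OF u_bracket[OF vf_single_pred_derived(1)[OF one] xn]] by auto
      then show ?thesis
        unfolding \<beta>\<gamma> split mless_add_cancel .
    qed
    ultimately show "x \<in> ?B"
      using mem_B[OF xn] by blast
  next
    assume B: "x \<in> ?B"
    then have xn: "x \<in> u_set n"
      by (simp add: seg_def)
    have x: "\<And>l. l \<in> {1..<s} \<Longrightarrow> component x l = 0"
      and xs: "\<And>\<beta>. \<beta> \<in> supp (component x s) \<Longrightarrow> mless (s - 1) \<beta> (\<sigma> + single (s - 1) (Suc i))"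
      using B mem_B[OF xn] by blast+
    have "lie_bracket (u_alg n) q x \<in> I" if q: "q \<in> derived_center (u_alg n) (s - 2)" for q
    proof -
      note qc = derived_center_const[OF q]
      obtain c where c: "component q (s - 1) = Const c"
        using qc(3) by blast
      note br = bracket_vanishing[of x n s q, OF xn x qc(1)]
      have "mless (s - 1) \<gamma> (\<sigma> + single (s - 1) i)"
        if \<gamma>: "\<gamma> \<in> supp (component (lie_bracket (u_alg n) q x) s)" for \<gamma>
      proof -
        have "component (lie_bracket (u_alg n) q x) s = Const c * partial (s - 1) (component x s)"
          using br(2) act_pred[of "component q", OF qc(2)] s c by auto
        then have "\<gamma> \<in> supp (partial (s - 1) (component x s))"
          using \<gamma> by (simp add: supp_iff coef_Const_mult)
        then have "mless (s - 1) (\<gamma> + single (s - 1) 1) (\<sigma> + single (s - 1) i + single (s - 1) 1)"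
          using xs unfolding supp_partial split by blast
        then show ?thesis
          unfolding mless_add_cancel .
      qed
      then show ?thesis
        using mem_I[OF u_bracket[OF qc(1) xn]] br(1) s by auto
    qed
    then show "x \<in> ?C"
      using xn by (simp add: centralizer_def)
  qed
qed

end

section \<open>Recovering the block and the exponent\<close>

text \<open>Hence the block \<open>s\<close> is the derived length of the quotient.\<close>

lemma derived_subset_below_iff:
  assumes z: "(\<alpha>, s) \<in> basis_index n" and "k \<le> n"
  shows "derived (u_alg n) k \<subseteq> (below n (\<alpha>, s) :: 'k::field_char_0 oper set) \<longleftrightarrow> s \<le> k"
proof
  have s: "s \<in> {1..n}"
    using z by (rule basis_index_range)
  show "s \<le> k" if sub: "derived (u_alg n) k \<subseteq> (below n (\<alpha>, s) :: 'k oper set)"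
  proof (rule ccontr)
    assume "\<not> s \<le> k"
    let ?D = "basis_at n (\<alpha>, s) :: 'k oper"
    have D: "?D \<in> u_set n"
      using basis_at_mem[OF z] .
    have "component ?D l = 0" if "l \<in> {1..k}" for l
      using that \<open>\<not> s \<le> k\<close> assms(2) component_basis_elt[OF s, of l \<alpha>] by auto
    then have "?D \<in> below n (\<alpha>, s)"
      using sub D mem_derived_iff[OF assms(2), of ?D] by blast
    moreover have "\<alpha> \<in> supp (component ?D s)"
      using component_basis_elt[OF s s, of \<alpha>, where 'a='k] by simp
    ultimately show False
      using mem_below_iff[OF D z] mless_irrefl by blast
  qed
  show "derived (u_alg n) k \<subseteq> (below n (\<alpha>, s) :: 'k oper set)" if "s \<le> k"
  proof
    fix D :: "'k oper" assume "D \<in> derived (u_alg n) k"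
    then have "D \<in> u_set n" "\<And>l. l \<in> {1..k} \<Longrightarrow> component D l = 0"
      using mem_derived_iff[OF assms(2), of D] by blast+
    then show "D \<in> below n (\<alpha>, s)"
      using mem_below_iff[of D n \<alpha> s] z that s by auto
  qed
qed

lemma below_neq_un: "z \<in> basis_index n \<Longrightarrow> \<not> u_set n \<subseteq> (below n z :: 'k::field_char_0 oper set)"
  using derived_subset_below_iff[of "fst z" "snd z" n 0, where 'k='k] by (auto simp: basis_index_def)

lemma lie_alg_ideal_u: "lie_ideal (u_alg n) A \<Longrightarrow> lie_alg_ideal (u_alg n) A"
  using lie_alg_u by (simp add: lie_alg_ideal_def lie_alg_ideal_axioms_def)

lemma lie_correspondence_u:
  assumes "lie_ideal (u_alg n) I" "lie_ideal (u_alg m) J" "lie_corr (u_alg n) I (u_alg m) J \<rho>"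
  shows "lie_correspondence (u_alg n) I (u_alg m) J \<rho>"
  using assms by (simp add: lie_correspondence_def lie_correspondence_axioms_def lie_alg_ideal_u)

lemma below_ideal: "lie_ideal (u_alg n) (below n z)"
  using seg_ideal[OF down_closed_preds] .

lemma iless_shift:
  fixes s :: nat
  assumes "2 \<le> s" "supp \<sigma> \<subseteq> {1..s - 2}" "supp \<tau> \<subseteq> {1..s - 2}"
  shows "iless (\<sigma> + single (s - 1) i, s) (\<tau> + single (s - 1) j, s) \<longleftrightarrow> i < j \<or> i = j \<and> mless (s - 2) \<sigma> \<tau>"
proof -
  have "mless (s - 2) (\<sigma> + single (s - 1) i) (\<tau> + single (s - 1) j) = mless (s - 2) \<sigma> \<tau>"
    using assms(1) by (intro mless_cong) (auto simp: lookup_add lookup_single when_def)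
  then show ?thesis
    using assms lower_coord[OF assms(1,2)] lower_coord[OF assms(1,3)]
    by (simp add: mless_top lookup_add del: One_nat_def)
qed

lemma shift_decomp:
  fixes s :: nat
  assumes "(\<alpha>, s) \<in> basis_index n" "2 \<le> s"
  obtains \<sigma> i where "\<alpha> = \<sigma> + single (s - 1) i" "supp \<sigma> \<subseteq> {1..s - 2}"
proof
  define i where "i = coef \<alpha> (s - 1)"
  show eq: "\<alpha> = \<alpha> - single (s - 1) i + single (s - 1) i"
    by (intro poly_mapping_eqI) (auto simp: lookup_add lookup_minus lookup_single when_def i_def)
  show "supp (\<alpha> - single (s - 1) i) \<subseteq> {1..s - 2}"
  proof
    fix j assume "j \<in> supp (\<alpha> - single (s - 1) i)"
    then have "coef \<alpha> j - coef (single (s - 1) i) j \<noteq> 0"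
      by (simp add: supp_iff lookup_minus)
    then have "j \<noteq> s - 1" "j \<in> supp \<alpha>"
      by (auto simp: i_def supp_iff lookup_single)
    moreover have "supp \<alpha> \<subseteq> {1..s - 1}"
      using assms(1) by (simp add: basis_index_def)
    ultimately have "1 \<le> j" "j \<le> s - 1" "j \<noteq> s - 1"
      by auto
    then show "j \<in> {1..s - 2}"
      by simp
  qed
qed

text \<open>Let \<open>A \<tau>\<close> and \<open>B \<tau>\<close> be the ideals given by \<open>\<tau> + (i + 1) e\<^sub>s\<^sub>-\<^sub>1\<close> and \<open>\<tau> + (j + 1) e\<^sub>s\<^sub>-\<^sub>1\<close>. The two
centralizers are preserved by the correspondence, so it maps the chain of the \<open>B \<tau>\<close> with \<open>\<tau> \<le> \<sigma>'\<close>
strictly monotonically into the chain of the \<open>A \<tau>\<close> with \<open>\<tau> \<le> \<sigma>\<close>. A strictly monotone map between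
exponents never decreases its argument, so \<open>\<sigma>' \<le> \<sigma>\<close>.\<close>

lemma shift_le_of_corr:
  fixes s n m :: nat and \<rho> :: "('k::field_char_0 oper \<times> 'k oper) set"
  assumes s: "s \<in> {2..n}" "s \<in> {2..m}" and \<sigma>: "supp \<sigma> \<subseteq> {1..s - 2}" and \<sigma>': "supp \<sigma>' \<subseteq> {1..s - 2}"
    and corr: "lie_corr (u_alg n) (below n (\<sigma> + single (s - 1) i, s))
       (u_alg m) (below m (\<sigma>' + single (s - 1) j, s)) \<rho>"
  shows "\<not> mless (s - 2) \<sigma> \<sigma>'"
proof -
  define I where "I = (below n (\<sigma> + single (s - 1) i, s) :: 'k oper set)"
  define J where "J = (below m (\<sigma>' + single (s - 1) j, s) :: 'k oper set)"
  define A where "A \<tau> = (below n (\<tau> + single (s - 1) (Suc i), s) :: 'k oper set)" for \<tau>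
  define B where "B \<tau> = (below m (\<tau> + single (s - 1) (Suc j), s) :: 'k oper set)" for \<tau>
  have s2: "2 \<le> s"
    using s by simp
  interpret N: shifted_ideal n s \<sigma> i I
    using s \<sigma> by unfold_locales (auto simp: I_def)
  interpret M: shifted_ideal m s \<sigma>' j J
    using s \<sigma>' by unfold_locales (auto simp: J_def)
  interpret lie_correspondence "u_alg n" I "u_alg m" J \<rho>
    using corr unfolding I_def J_def by (intro lie_correspondence_u below_ideal)
  interpret C: lie_correspondence "u_alg m" J "u_alg n" I "\<rho>\<inverse>"
    by (rule converse)
  have A0: "centralizer (u_alg n) I (derived (u_alg n) (s - 2)) = A 0"
    and A\<sigma>: "centralizer (u_alg n) I (derived_center (u_alg n) (s - 2)) = A \<sigma>"
    unfolding A_def using N.centralizer_derived N.centralizer_derived_center by auto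
  have B0: "centralizer (u_alg m) J (derived (u_alg m) (s - 2)) = B 0"
    and B\<sigma>': "centralizer (u_alg m) J (derived_center (u_alg m) (s - 2)) = B \<sigma>'"
    unfolding B_def using M.centralizer_derived M.centralizer_derived_center by auto
  have idx: "(\<tau> + single (s - 1) k, s) \<in> basis_index n" "(\<tau> + single (s - 1) k, s) \<in> basis_index m"
    if "supp \<tau> \<subseteq> {1..s - 2}" for \<tau> k
    using shift_index[OF s(1) that] shift_index[OF s(2) that] .
  have A_mono: "A \<tau> \<subseteq> A \<tau>' \<longleftrightarrow> \<tau> = \<tau>' \<or> mless (s - 2) \<tau> \<tau>'"
    and B_mono: "B \<tau> \<subseteq> B \<tau>' \<longleftrightarrow> \<tau> = \<tau>' \<or> mless (s - 2) \<tau> \<tau>'"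
    if "supp \<tau> \<subseteq> {1..s - 2}" "supp \<tau>' \<subseteq> {1..s - 2}" for \<tau> \<tau>'
    unfolding A_def B_def using that s2
    by (simp_all only: below_subset_iff[OF idx(1)[OF that(1)] idx(1)[OF that(2)]]
        below_subset_iff[OF idx(2)[OF that(1)] idx(2)[OF that(2)]] iless_shift) auto
  have JB: "J \<subseteq> B \<tau>" if "supp \<tau> \<subseteq> {1..s - 2}" for \<tau>
    unfolding J_def B_def below_subset_iff[OF idx(2)[OF \<sigma>'] idx(2)[OF that]] iless_shift[OF s2 \<sigma>' that]
    by simp
  have IA: "I \<subseteq> A \<tau>" if "supp \<tau> \<subseteq> {1..s - 2}" for \<tau>
    unfolding I_def A_def below_subset_iff[OF idx(1)[OF \<sigma>] idx(1)[OF that]] iless_shift[OF s2 \<sigma> that]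
    by simp
  have derived_facts: "(below r (\<tau> + single (s - 1) k, s) :: 'k oper set) \<subseteq> derived (u_alg r) (Suc (s - 2))"
    "\<And>a b :: 'k oper. a \<in> derived (u_alg r) (Suc (s - 2)) \<Longrightarrow> b \<in> derived (u_alg r) (Suc (s - 2)) \<Longrightarrow>
      lie_add (u_alg r) a b \<in> derived (u_alg r) (Suc (s - 2))"
    if r: "s \<in> {2..r}" and \<tau>: "supp \<tau> \<subseteq> {1..s - 2}" for r \<tau> k
  proof -
    have Suc: "Suc (s - 2) = s - 1" and le: "s - 1 \<le> r"
      using r by auto
    show "(below r (\<tau> + single (s - 1) k, s) :: 'k oper set) \<subseteq> derived (u_alg r) (Suc (s - 2))"
    proof
      fix D :: "'k oper" assume D: "D \<in> below r (\<tau> + single (s - 1) k, s)"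
      then have Dr: "D \<in> u_set r"
        by (simp add: seg_def)
      show "D \<in> derived (u_alg r) (Suc (s - 2))"
        unfolding Suc mem_derived_iff[OF le]
        using D mem_below_iff[OF Dr shift_index[OF r \<tau>]] Dr s2 by auto
    qed
    show "lie_add (u_alg r) a b \<in> derived (u_alg r) (Suc (s - 2))"
      if "a \<in> derived (u_alg r) (Suc (s - 2))" "b \<in> derived (u_alg r) (Suc (s - 2))"
      for a b :: "'k oper"
      using that le unfolding Suc mem_derived_iff[OF le] by (auto simp: u_add comp_add)
  qed
  have to_B0: "y \<in> B 0" if "(x, y) \<in> \<rho>" "x \<in> A 0" for x y
    using corr_centralizer[OF _ that(1), of "derived (u_alg m) (s - 2)" "derived (u_alg n) (s - 2)"]
      that(2) C.corr_derived unfolding A0 B0 by blast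
  have to_A\<sigma>: "x \<in> A \<sigma>" if "(x, y) \<in> \<rho>" "y \<in> B \<sigma>'" for x y
  proof -
    have "\<exists>q'\<in>derived_center (u_alg m) (s - 2). (q', q) \<in> \<rho>\<inverse>"
      if "q \<in> derived_center (u_alg n) (s - 2)" for q
      using corr_derived_center[OF _ _ that] derived_facts[OF s(2) \<sigma>'] unfolding J_def by blast
    then show ?thesis
      using C.corr_centralizer[of "derived_center (u_alg n) (s - 2)" "derived_center (u_alg m) (s - 2)" y x]
        that unfolding A\<sigma> B\<sigma>' by blast
  qed
  \<comment> \<open>The preimages of the chain on the right are ideals in the chain on the left.\<close>
  define K where "K \<tau> = \<rho>\<inverse> `` B \<tau>" for \<tau>
  have K: "\<exists>\<tau>'. supp \<tau>' \<subseteq> {1..s - 2} \<and> (\<tau>' = \<sigma> \<or> mless (s - 2) \<tau>' \<sigma>) \<and> K \<tau> = A \<tau>'"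
    if \<tau>: "supp \<tau> \<subseteq> {1..s - 2}" "\<tau> = \<sigma>' \<or> mless (s - 2) \<tau> \<sigma>'" for \<tau>
  proof -
    have "lie_ideal (u_alg n) (K \<tau>)"
      unfolding K_def B_def by (intro C.corr_image_ideal below_ideal)
    then consider "K \<tau> = u_set n" | z where "z \<in> basis_index n" "K \<tau> = below n z"
      by (rule ideal_cases)
    moreover have K\<sigma>: "K \<tau> \<subseteq> A \<sigma>"
      using to_A\<sigma> B_mono[OF \<tau>(1) \<sigma>'] \<tau>(2) unfolding K_def by blast
    moreover have "\<not> u_set n \<subseteq> A \<sigma>"
      unfolding A_def using below_neq_un idx(1)[OF \<sigma>] by blast
    ultimately obtain z where z: "z \<in> basis_index n" "K \<tau> = below n z"
      by metis
    have 0: "A 0 \<subseteq> K \<tau>"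
    proof
      fix x assume x: "x \<in> A 0"
      then have "x \<in> u_set n"
        by (simp add: A_def seg_def)
      then obtain y where "(x, y) \<in> \<rho>"
        using corr_left by blast
      then have "y \<in> B \<tau>"
        using to_B0 x B_mono[of 0 \<tau>] \<tau>(1) mless_total[of 0 "s - 2" \<tau>] by (metis empty_subsetI keys_zero not_mless_0 subsetD)
      then show "x \<in> K \<tau>"
        using \<open>(x, y) \<in> \<rho>\<close> by (auto simp: K_def)
    qed
    have supp0: "supp (0 :: expo) \<subseteq> {1..s - 2}"
      by simp
    obtain \<alpha> l where zl: "z = (\<alpha>, l)"
      by (cases z)
    have low: "(0 + single (s - 1) (Suc i), s) = z \<or> iless (0 + single (s - 1) (Suc i), s) z"
      using 0 below_subset_iff[OF idx(1)[OF supp0] z(1), where 'k='k] unfolding z(2) A_def by blast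
    have high: "z = (\<sigma> + single (s - 1) (Suc i), s) \<or> iless z (\<sigma> + single (s - 1) (Suc i), s)"
      using K\<sigma> below_subset_iff[OF z(1) idx(1)[OF \<sigma>], where 'k='k] unfolding z(2) A_def by blast
    have "l = s"
      using low high by (auto simp: zl)
    then obtain \<tau>' k where \<tau>': "\<alpha> = \<tau>' + single (s - 1) k" "supp \<tau>' \<subseteq> {1..s - 2}"
      using shift_decomp[of \<alpha> s n] z(1) s2 zl by blast
    have coefs: "coef \<tau>' (s - 1) = 0" "coef \<sigma> (s - 1) = 0"
      using lower_coord[OF s2] \<tau>'(2) \<sigma> by blast+
    have "Suc i \<le> k"
    proof (cases "(0 + single (s - 1) (Suc i), s) = z")
      case True
      then have eq: "0 + single (s - 1) (Suc i) = \<tau>' + single (s - 1) k"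
        unfolding zl \<tau>'(1) prod.inject by blast
      show ?thesis
        using arg_cong[OF eq, of "\<lambda>\<alpha>. coef \<alpha> (s - 1)"] by (simp add: lookup_add coefs del: One_nat_def)
    next
      case False
      then show ?thesis
        using low iless_shift[OF s2 supp0 \<tau>'(2), of "Suc i" k] unfolding zl \<open>l = s\<close> \<tau>'(1) by auto
    qed
    moreover have "k \<le> Suc i \<and> (k = Suc i \<longrightarrow> \<tau>' = \<sigma> \<or> mless (s - 2) \<tau>' \<sigma>)"
    proof (cases "z = (\<sigma> + single (s - 1) (Suc i), s)")
      case True
      then have eq: "\<tau>' + single (s - 1) k = \<sigma> + single (s - 1) (Suc i)"
        unfolding zl \<tau>'(1) prod.inject by blast
      have "k = Suc i"
        using arg_cong[OF eq, of "\<lambda>\<alpha>. coef \<alpha> (s - 1)"] by (simp add: lookup_add coefs del: One_nat_def)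
      then show ?thesis
        using True by (simp add: zl \<tau>'(1))
    next
      case False
      then show ?thesis
        using high iless_shift[OF s2 \<tau>'(2) \<sigma>, of k "Suc i"] unfolding zl \<open>l = s\<close> \<tau>'(1) by auto
    qed
    ultimately have "k = Suc i" "\<tau>' = \<sigma> \<or> mless (s - 2) \<tau>' \<sigma>"
      by auto
    then show ?thesis
      using \<tau>' z(2) zl \<open>l = s\<close> by (auto simp: A_def)
  qed
  then obtain f where f: "\<And>\<tau>. supp \<tau> \<subseteq> {1..s - 2} \<Longrightarrow> \<tau> = \<sigma>' \<or> mless (s - 2) \<tau> \<sigma>' \<Longrightarrow>
     supp (f \<tau>) \<subseteq> {1..s - 2} \<and> (f \<tau> = \<sigma> \<or> mless (s - 2) (f \<tau>) \<sigma>) \<and> K \<tau> = A (f \<tau>)"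
    by metis
  have strict: "mless (s - 2) (f \<tau>) (f \<tau>')"
    if \<tau>: "supp \<tau> \<subseteq> {1..s - 2}" and \<tau>': "supp \<tau>' \<subseteq> {1..s - 2}" "\<tau>' = \<sigma>' \<or> mless (s - 2) \<tau>' \<sigma>'"
      and less: "mless (s - 2) \<tau> \<tau>'" for \<tau> \<tau>'
  proof -
    have "\<tau> = \<sigma>' \<or> mless (s - 2) \<tau> \<sigma>'"
      using less \<tau>'(2) mless_trans by blast
    note f1 = f[OF \<tau> this] and f2 = f[OF \<tau>']
    have "K \<tau> \<subseteq> K \<tau>'"
      using B_mono[OF \<tau> \<tau>'(1)] less unfolding K_def by blast
    then have "f \<tau> = f \<tau>' \<or> mless (s - 2) (f \<tau>) (f \<tau>')"
      using A_mono[of "f \<tau>" "f \<tau>'"] f1 f2 by auto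
    moreover have "f \<tau> \<noteq> f \<tau>'"
    proof
      assume "f \<tau> = f \<tau>'"
      then have eq: "K \<tau> = K \<tau>'"
        using f1 f2 by simp
      have "B \<tau>' \<subseteq> B \<tau>"
      proof
        fix y assume y: "y \<in> B \<tau>'"
        then have "y \<in> u_set m"
          by (simp add: B_def seg_def)
        then obtain x where xy: "(x, y) \<in> \<rho>"
          using corr_right by blast
        then have "x \<in> K \<tau>"
          using y eq by (auto simp: K_def)
        then show "y \<in> B \<tau>"
          using C.corr_image_inverse[of "B \<tau>" y x] JB[OF \<tau>] xy below_ideal unfolding K_def B_def by blast
      qed
      then have "\<tau>' = \<tau> \<or> mless (s - 2) \<tau>' \<tau>"
        using B_mono[OF \<tau>'(1) \<tau>] by blast
      then show False
        using less mless_trans mless_irrefl by blast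
    qed
    ultimately show ?thesis by blast
  qed
  \<comment> \<open>If \<open>f \<tau> < \<tau>\<close>, then \<open>f (f \<tau>) < f \<tau>\<close>, which contradicts the minimality of \<open>\<tau>\<close>.\<close>
  have "\<not> mless (s - 2) (f \<tau>) \<tau>" if "supp \<tau> \<subseteq> {1..s - 2}" "\<tau> = \<sigma>' \<or> mless (s - 2) \<tau> \<sigma>'" for \<tau>
    using wf_mless[of "s - 2"] that
  proof (induction \<tau> rule: wf_induct_rule)
    case (less \<tau>)
    note f\<tau> = f[OF less.prems]
    show ?case
    proof
      assume lt: "mless (s - 2) (f \<tau>) \<tau>"
      then have "f \<tau> = \<sigma>' \<or> mless (s - 2) (f \<tau>) \<sigma>'"
        using less.prems(2) mless_trans by blast
      then have "\<not> mless (s - 2) (f (f \<tau>)) (f \<tau>)"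
        using less.IH[of "f \<tau>"] lt f\<tau> by blast
      then show False
        using strict[of "f \<tau>" \<tau>] less.prems lt f\<tau> by blast
    qed
  qed
  then have "\<not> mless (s - 2) (f \<sigma>') \<sigma>'"
    using \<sigma>' by blast
  then show ?thesis
    using f[OF \<sigma>'] mless_trans by blast
qed

section \<open>The isomorphism criterion\<close>

lemma preds_1_ordIso: "omega_tail n 1 +\<^sub>o ord_zero =o ile (preds n (0, 1))"
proof -
  let ?A = "{(\<alpha>, l) \<in> basis_index n. 1 < l}"
  have "omega_tail n 1 +\<^sub>o ord_zero =o ile (?A \<union> {})"
    by (rule ord_add_ile[where n = n, OF _ _ omega_tail_ordIso ord_zero_ile]) auto
  moreover have "?A \<union> {} = preds n (0, 1)"
    by (auto simp: preds_def)
  ultimately show ?thesis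
    by simp
qed

lemma basis_index_ordIso:
  assumes "1 \<le> n"
  shows "omega_tail n 1 +\<^sub>o ord_one =o ile (basis_index n)"
proof -
  let ?A = "{(\<alpha>, l) \<in> basis_index n. 1 < l}"
  let ?B = "{\<alpha> :: expo. supp \<alpha> \<subseteq> {1..1 - 1}} \<times> {1 :: nat}"
  have "ord_one =o ile ?B"
    using block_ordIso[of 1 n] assms by simp
  moreover have "?A \<union> ?B \<subseteq> basis_index n"
    using assms by (auto simp: basis_index_def)
  ultimately have "omega_tail n 1 +\<^sub>o ord_one =o ile (?A \<union> ?B)"
    by (intro ord_add_ile[where n = n] omega_tail_ordIso) auto
  moreover have "?A \<union> ?B = basis_index n"
  proof (intro set_eqI iffI)
    fix z assume z: "z \<in> basis_index n"
    show "z \<in> ?A \<union> ?B"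
      using z by (cases "snd z = 1") (auto simp: basis_index_def)
  qed (use assms in \<open>auto simp: basis_index_def\<close>)
  ultimately show ?thesis
    by simp
qed

lemma I_ideal_below: 
  assumes "lam =o r" "r =o ile (preds n z)"
  shows "I_ideal n lam = below n z"
  using ordIso_transitive[OF assms] down_closed_preds by (intro I_ideal_eq_seg)

lemma I_ideal_top:
  assumes "lam =o omega_tail n 1 +\<^sub>o ord_one" "1 \<le> n"
  shows "I_ideal n lam = u_set n"
proof -
  have "down_closed n (basis_index n)"
    by (auto simp: down_closed_def)
  then show ?thesis
    unfolding seg_basis_index[symmetric]
    by (rule I_ideal_eq_seg) (rule ordIso_transitive[OF assms(1) basis_index_ordIso[OF assms(2)]])
qed

text \<open>The criterion before its translation into ordinals: the quotients agree if and only if the ideals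
are given by the same block and the same exponent, up to a power of the last variable of the block.\<close>

theorem quotients_isomorphic_iff:
  fixes n m :: nat and I J :: "'k::field_char_0 oper set"
  assumes nm: "2 \<le> n" "n \<le> m" and I: "lie_ideal (u_alg n) I" and J: "lie_ideal (u_alg m) J"
  shows "lie_isomorphic (lie_quotient (u_alg n) I) (lie_quotient (u_alg m) J) \<longleftrightarrow>
    (\<exists>s\<in>{2..n}. \<exists>\<sigma> i j. supp \<sigma> \<subseteq> {1..s - 2} \<and>
       I = below n (\<sigma> + single (s - 1) i, s) \<and> J = below m (\<sigma> + single (s - 1) j, s)) \<or>
    I = below n (0, 1) \<and> J = below m (0, 1) \<or> I = u_set n \<and> J = u_set m"
    (is "?L \<longleftrightarrow> ?R")
proof
  assume ?R
  then have "\<exists>\<rho>. lie_corr (u_alg n) I (u_alg m) J \<rho>"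
  proof (elim disjE bexE exE conjE)
    fix s \<sigma> i j assume "s \<in> {2..n}" "supp \<sigma> \<subseteq> {1..s - 2}"
      "I = below n (\<sigma> + single (s - 1) i, s)" "J = below m (\<sigma> + single (s - 1) j, s)"
    then show ?thesis
      using shift_corr_lie_corr[of s n m \<sigma> i j] nm by auto
  next
    assume "I = below n (0, 1)" "J = below m (0, 1)"
    then show ?thesis
      using first_component_lie_corr[of n m] nm by auto
  next
    assume "I = u_set n" "J = u_set m"
    then show ?thesis
      using trivial_lie_corr by blast
  qed
  then obtain \<rho> where "lie_corr (u_alg n) I (u_alg m) J \<rho>" by blast
  then show ?L
    using lie_correspondence.quotients_isomorphic[OF lie_correspondence_u[OF I J]] by blast
next
  assume ?L
  then obtain \<rho> where \<rho>: "lie_corr (u_alg n) I (u_alg m) J \<rho>"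
    using quotients_isomorphic_imp_corr[OF lie_alg_ideal_u[OF I] lie_alg_ideal_u[OF J]] by blast
  interpret lie_correspondence "u_alg n" I "u_alg m" J \<rho>
    using lie_correspondence_u[OF I J \<rho>] .
  interpret C: lie_correspondence "u_alg m" J "u_alg n" I "\<rho>\<inverse>"
    by (rule converse)
  have derived_iff: "derived (u_alg n) k \<subseteq> I \<longleftrightarrow> derived (u_alg m) k \<subseteq> J" for k
    using corr_derived_subset C.corr_derived_subset by blast
  have IJ: "I \<subseteq> u_set n" "J \<subseteq> u_set m"
    using L.ideal_carrier M.ideal_carrier by blast+
  show ?R
  proof (cases "I = u_set n")
    case True
    then have "J = u_set m"
      using derived_iff[of 0] IJ by auto
    then show ?thesis
      using True by blast
  next
    case False
    then obtain \<alpha> s where \<alpha>: "(\<alpha>, s) \<in> basis_index n" "I = below n (\<alpha>, s)"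
      using ideal_cases[OF I] by (metis surj_pair)
    have "J \<noteq> u_set m"
      using derived_iff[of 0] IJ False by auto
    then obtain \<beta> t where \<beta>: "(\<beta>, t) \<in> basis_index m" "J = below m (\<beta>, t)"
      using ideal_cases[OF J] by (metis surj_pair)
    have s: "s \<in> {1..n}"
      using basis_index_range[OF \<alpha>(1)] .
    have iff: "s \<le> k \<longleftrightarrow> t \<le> k" if "k \<le> n" for k
      using derived_iff[of k] derived_subset_below_iff[OF \<alpha>(1) that, where 'k='k]
        derived_subset_below_iff[OF \<beta>(1), of k, where 'k='k] that nm unfolding \<alpha>(2) \<beta>(2) by simp
    have "t \<le> s"
      using iff[of s] s by simp
    moreover from this have "s \<le> t"
      using iff[of t] s by simp
    ultimately have t: "t = s"
      by simp
    show ?thesis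
    proof (cases "s = 1")
      case True
      then have "\<alpha> = 0" "\<beta> = 0"
        using \<alpha>(1) \<beta>(1) t by (auto simp: basis_index_def)
      then show ?thesis
        using True \<alpha>(2) \<beta>(2) t by simp
    next
      case False
      then have s2: "2 \<le> s"
        using s by auto
      obtain \<sigma> i where \<sigma>: "\<alpha> = \<sigma> + single (s - 1) i" "supp \<sigma> \<subseteq> {1..s - 2}"
        using shift_decomp[OF \<alpha>(1) s2] .
      obtain \<sigma>' j where \<sigma>': "\<beta> = \<sigma>' + single (s - 1) j" "supp \<sigma>' \<subseteq> {1..s - 2}"
        using shift_decomp[of \<beta> s m] \<beta>(1) s2 t by blast
      have ss: "s \<in> {2..n}" "s \<in> {2..m}"
        using s2 s nm by auto
      have corr': "lie_corr (u_alg n) (below n (\<sigma> + single (s - 1) i, s))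
          (u_alg m) (below m (\<sigma>' + single (s - 1) j, s)) \<rho>"
        using \<rho> unfolding \<alpha>(2) \<beta>(2) t \<sigma>(1) \<sigma>'(1) .
      have "\<sigma> = \<sigma>'"
        using shift_le_of_corr[OF ss \<sigma>(2) \<sigma>'(2) corr']
          shift_le_of_corr[OF ss(2,1) \<sigma>'(2) \<sigma>(2) lie_corr_converse[OF corr']]
          mless_total[OF \<sigma>(2) \<sigma>'(2)] by blast
      then show ?thesis
        using ss(1) \<sigma> \<sigma>' \<alpha>(2) \<beta>(2) t by blast
    qed
  qed
qed

theorem corollary5p2:
  fixes n m :: nat
    and I J :: "('k::field_char_0 mpoly \<Rightarrow> 'k mpoly) set"
  assumes "2 \<le> n" and "n < m"
    and "lie_ideal (u_alg n) I" and "lie_ideal (u_alg m) J"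
  shows "lie_isomorphic (lie_quotient (u_alg n) I) (lie_quotient (u_alg m) J) \<longleftrightarrow>
    (\<exists>lam mu :: nat rel. I = I_ideal n lam \<and> J = I_ideal m mu \<and>
      ((\<exists>\<nu> i j. below_omega_pow (n - 2) \<nu> \<and>
          lam =o omega_mult i (n - 2) +\<^sub>o \<nu> \<and>
          mu =o omega_tail m n +\<^sub>o omega_mult j (n - 2) +\<^sub>o \<nu>) \<or>
       (\<exists>s\<in>{2..n - 1}. \<exists>\<nu> i j. below_omega_pow (s - 2) \<nu> \<and>
          lam =o omega_tail n s +\<^sub>o omega_mult i (s - 2) +\<^sub>o \<nu> \<and>
          mu =o omega_tail m s +\<^sub>o omega_mult j (s - 2) +\<^sub>o \<nu>) \<or>
       (\<exists>\<epsilon>\<in>{ord_zero, ord_one}.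
          lam =o omega_tail n 1 +\<^sub>o \<epsilon> \<and>
          mu =o omega_tail m 1 +\<^sub>o \<epsilon>)))" (is "_ \<longleftrightarrow> (\<exists>lam mu. ?P lam mu)")
proof -
  have nm: "n \<le> m" "1 \<le> n" "1 \<le> m" and nn: "n \<in> {2..m}"
    using assms by auto
  note main = quotients_isomorphic_iff[OF assms(1) nm(1) assms(3,4)]
  have top: "lam =o omega_mult i (n - 2) +\<^sub>o \<nu> \<Longrightarrow> I_ideal n lam = (below n (\<sigma> + single (n - 1) i, n) :: ('k mpoly \<Rightarrow> 'k mpoly) set)"
    if "supp \<sigma> \<subseteq> {1..n - 2}" "\<nu> =o initial_type (n - 2) \<sigma>" for lam \<nu> i \<sigma>
    using I_ideal_below preds_last_block_ordIso[OF assms(1) that] by blast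
  have mid: "lam =o omega_tail r s +\<^sub>o omega_mult i (s - 2) +\<^sub>o \<nu> \<Longrightarrow>
      I_ideal r lam = (below r (\<sigma> + single (s - 1) i, s) :: ('k mpoly \<Rightarrow> 'k mpoly) set)"
    if "s \<in> {2..r}" "supp \<sigma> \<subseteq> {1..s - 2}" "\<nu> =o initial_type (s - 2) \<sigma>" for lam \<nu> i \<sigma> r s
    using I_ideal_below preds_ordIso[OF that] by blast
  have low: "lam =o omega_tail r 1 +\<^sub>o ord_zero \<Longrightarrow> I_ideal r lam = (below r (0, 1) :: ('k mpoly \<Rightarrow> 'k mpoly) set)" for lam r
    using I_ideal_below preds_1_ordIso by blast
  have self: "r =o r" if "r =o ile A" for r :: "nat rel" and A
    using ordIso_reflexive that by (auto simp: ordIso_def)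
  show ?thesis
    unfolding main
  proof
    assume "\<exists>lam mu. ?P lam mu"
    then obtain lam mu where IJ: "I = I_ideal n lam" "J = I_ideal m mu" and P: "?P lam mu"
      by blast
    from P consider
      (a) \<nu> i j where "below_omega_pow (n - 2) \<nu>" "lam =o omega_mult i (n - 2) +\<^sub>o \<nu>"
        "mu =o omega_tail m n +\<^sub>o omega_mult j (n - 2) +\<^sub>o \<nu>"
      | (b) s \<nu> i j where "s \<in> {2..n - 1}" "below_omega_pow (s - 2) \<nu>"
        "lam =o omega_tail n s +\<^sub>o omega_mult i (s - 2) +\<^sub>o \<nu>"
        "mu =o omega_tail m s +\<^sub>o omega_mult j (s - 2) +\<^sub>o \<nu>"
      | (c0) "lam =o omega_tail n 1 +\<^sub>o ord_zero" "mu =o omega_tail m 1 +\<^sub>o ord_zero"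
      | (c1) "lam =o omega_tail n 1 +\<^sub>o ord_one" "mu =o omega_tail m 1 +\<^sub>o ord_one"
      by blast
    then show "(\<exists>s\<in>{2..n}. \<exists>\<sigma> i j. supp \<sigma> \<subseteq> {1..s - 2} \<and>
       I = below n (\<sigma> + single (s - 1) i, s) \<and> J = below m (\<sigma> + single (s - 1) j, s)) \<or>
      I = below n (0, 1) \<and> J = below m (0, 1) \<or> I = u_set n \<and> J = u_set m"
    proof cases
      case a
      obtain \<sigma> where \<sigma>: "supp \<sigma> \<subseteq> {1..n - 2}" "\<nu> =o initial_type (n - 2) \<sigma>"
        using a(1) below_omega_pow_iff by blast
      have "n \<in> {2..n}"
        using assms by simp
      then show ?thesis
        using IJ top[OF \<sigma> a(2)] mid[OF nn \<sigma> a(3)] \<sigma>(1) by blast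
    next
      case b
      obtain \<sigma> where \<sigma>: "supp \<sigma> \<subseteq> {1..s - 2}" "\<nu> =o initial_type (s - 2) \<sigma>"
        using b(2) below_omega_pow_iff by blast
      have s: "s \<in> {2..n}" "s \<in> {2..m}"
        using b(1) nm by auto
      then show ?thesis
        using IJ mid[OF s(1) \<sigma> b(3)] mid[OF s(2) \<sigma> b(4)] \<sigma>(1) by blast
    next
      case c0
      then show ?thesis
        using IJ low by blast
    next
      case c1
      then show ?thesis
        using IJ I_ideal_top nm by blast
    qed
  next
    assume "(\<exists>s\<in>{2..n}. \<exists>\<sigma> i j. supp \<sigma> \<subseteq> {1..s - 2} \<and>
       I = below n (\<sigma> + single (s - 1) i, s) \<and> J = below m (\<sigma> + single (s - 1) j, s)) \<or>
      I = below n (0, 1) \<and> J = below m (0, 1) \<or> I = u_set n \<and> J = u_set m"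
    then consider (s) s \<sigma> i j where "s \<in> {2..n}" "supp \<sigma> \<subseteq> {1..s - 2}"
       "I = below n (\<sigma> + single (s - 1) i, s)" "J = below m (\<sigma> + single (s - 1) j, s)"
      | (c0) "I = below n (0, 1)" "J = below m (0, 1)" | (c1) "I = u_set n" "J = u_set m"
      by blast
    then show "\<exists>lam mu. ?P lam mu"
    proof cases
      case s
      define \<nu> where "\<nu> = initial_type (s - 2) \<sigma>"
      have \<nu>: "\<nu> =o initial_type (s - 2) \<sigma>"
        unfolding \<nu>_def using initial_type_ordIso[OF s(1), of \<sigma> 0] by (rule self)
      have b: "below_omega_pow (s - 2) \<nu>"
        using \<nu> s(2) below_omega_pow_iff by blast
      have sm: "s \<in> {2..m}"
        using s(1) nm by auto
      note mu = preds_ordIso[OF sm s(2) \<nu>, of j]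
      show ?thesis
      proof (cases "s = n")
        case True
        note lam = preds_last_block_ordIso[OF assms(1), of \<sigma> \<nu> i, folded True, OF s(2) \<nu>]
        have "I = I_ideal n (omega_mult i (s - 2) +\<^sub>o \<nu>)"
          using top[of \<sigma> \<nu>, folded True, OF s(2) \<nu> self[OF lam]] s(3) True by simp
        moreover have "J = I_ideal m (omega_tail m s +\<^sub>o omega_mult j (s - 2) +\<^sub>o \<nu>)"
          using mid[OF sm s(2) \<nu> self[OF mu]] s(4) by simp
        ultimately show ?thesis
          using b self[OF lam] self[OF mu] unfolding True by blast
      next
        case False
        then have s': "s \<in> {2..n - 1}"
          using s(1) by auto
        note lam = preds_ordIso[OF s(1,2) \<nu>, of i]
        have "I = I_ideal n (omega_tail n s +\<^sub>o omega_mult i (s - 2) +\<^sub>o \<nu>)"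
          using mid[OF s(1,2) \<nu> self[OF lam]] s(3) by simp
        moreover have "J = I_ideal m (omega_tail m s +\<^sub>o omega_mult j (s - 2) +\<^sub>o \<nu>)"
          using mid[OF sm s(2) \<nu> self[OF mu]] s(4) by simp
        ultimately show ?thesis
          using b s' self[OF lam] self[OF mu] by blast
      qed
    next
      case c0
      then show ?thesis
        using low[OF self[OF preds_1_ordIso]] self[OF preds_1_ordIso] by blast
    next
      case c1
      then show ?thesis
        using I_ideal_top[OF self[OF basis_index_ordIso[OF nm(2)]] nm(2)]
          I_ideal_top[OF self[OF basis_index_ordIso[OF nm(3)]] nm(3)]
          self[OF basis_index_ordIso[OF nm(2)]] self[OF basis_index_ordIso[OF nm(3)]] by blast
    qed
  qed
qed

end
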